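(* Let $\mathcal{E}=(L|K,v)$ be a Kummer extension of valued fields of prime degree $q=(vL:vK)$, and let $\zeta_q\in K$ be a primitive $q$-th root of unity. Then one of the following two cases holds (and case (i) always holds if $q\neq\mathrm{char}\,Kv$): (i) there is a Kummer generator $\eta\in L$ such that $vL=vK+\mathbb{Z}v\eta$ and $\mathcal{O}_L=\bigcup_{c\in K,\ v(c\eta)>0}\mathcal{O}_K[c\eta]$; (ii) there is a Kummer generator $\eta\in L$ which is a $1$-unit such that for $\xi:=\frac{\eta-1}{\zeta_q-1}$ we have $v\xi<0$, $vL=vK+\mathbb{Z}v\xi$, and $\mathcal{O}_L=\bigcup_{c\in K,\ v(c\xi^j)>0}\mathcal{O}_K[c\xi^j]$ for suitable $j\in\{1,\dots,q-1\}$. In case (i), $$\Omega_{\mathcal{O}_L|\mathcal{O}_K}\cong\mathcal{M}_{\mathcal{E}}/q\mathcal{M}_{\mathcal{E}}^q$$ as $\mathcal{O}_L$-modules. If $q\neq\mathrm{char}\,Kv$, then $\mathcal{M}_{\mathcal{E}}/q\mathcal{M}_{\mathcal{E}}^q=\mathcal{M}_{\mathcal{E}}/\mathcal{M}_{\mathcal{E}}^q$. If $q=\mathrm{char}\,Kv$, then $$\mathcal{M}_{\mathcal{E}}/q\mathcal{M}_{\mathcal{E}}^q\cong(\zeta_q-1)\mathcal{M}_{\mathcal{E}}/((\zeta_q-1)\mathcal{M}_{\mathcal{E}})^q=I_{\mathcal{E}}\mathcal{M}_{\mathcal{E}}/(I_{\mathcal{E}}\mathcal{M}_{\mathcal{E}})^q.$$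 Moreover, in case (i), $\Omega_{\mathcal{O}_L|\mathcal{O}_K}=0$ if and only if $q\notin\mathcal{M}_{\mathcal{E}}$ and $\mathcal{M}_{\mathcal{E}}$ is a nonprincipal $\mathcal{O}_{\mathcal{E}}$-ideal. The condition $q\notin\mathcal{M}_{\mathcal{E}}$ always holds when $q\neq\mathrm{char}\,Kv$. In case (ii), $$\Omega_{\mathcal{O}_L|\mathcal{O}_K}\cong\xi^{-1}\mathcal{M}_{\mathcal{E}}/(\xi^{-1}\mathcal{M}_{\mathcal{E}})^q=I_{\mathcal{E}}\mathcal{M}_{\mathcal{E}}/(I_{\mathcal{E}}\mathcal{M}_{\mathcal{E}})^q$$ as $\mathcal{O}_L$-modules; in particular, $\Omega_{\mathcal{O}_L|\mathcal{O}_K}\neq0$.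
   Context: Valuations are Krull valuations of arbitrary rank. $(L|K,v)$ denotes a field extension $L|K$ with a valuation $v$ on $L$, $K$ being endowed with the restriction of $v$. $\mathcal{O}_K,\mathcal{O}_L$ are the valuation rings, $vK,vL$ the value groups, $Kv$ the residue field of $K$, and $vx$ is the value of an element $x$. $\Omega_{B|A}$ is the module of relative Kähler differentials. A Kummer extension of prime degree $q$ is a Galois extension $L|K$ of degree $q\ne\mathrm{char}\,K$ where $K$ contains all $q$-th roots of unity; a Kummer generator is an element $\eta$ with $L=K(\eta)$ and $\eta^q\in K$. A $1$-unit is an element $u$ of the valuation ring with $v(u-1)>0$. The extensions considered here are automatically unibranched. For an extension $\mathcal{E}=(L|K,v)$ of prime degree equal to $(vL:vK)$, $H_{\mathcal{E}}$ denotes the largest convex subgroup of $vL$ that is also a convex subgroup of $vK$; $\mathcal{O}_{\mathcal{E}}=\{a\in L\mid\exists\gamma\in H_{\mathcal{E}}:va\ge\gamma\}$ is a valuation ring of $L$ with maximal ideal $\mathcal{M}_{\mathcal{E}}=\{a\in L\mid va>\gamma\text{ for all }\gamma\in H_{\mathcal{E}}\}$, which is also an $\mathcal{O}_L$-ideal. $I_{\mathcal{E}}$ is the ramification ideal of $\mathcal{E}$: the $\mathcal{O}_L$-ideal generated by all elements $\frac{\sigma b-b}{b}$ with $\sigma\in\mathrm{Gal}(L|K)$ and $b\in L^\times$. Products and powers are those of $\mathcal{O}_L$-ideals. *)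

theory Defs
  imports
    "HOL-Algebra.Algebraic_Closure_Type"
    "HOL-Algebra.Generated_Fields"
    "HOL-Algebra.Ideal_Product"
    "HOL-Algebra.Finite_Extensions"
    "HOL-Algebra.Module"
    "HOL-Algebra.QuotRing"
begin

section \<open>Quotient modules and modules of differentials\<close>

text \<open>
  Module records extend ring records. The fields \<open>mult\<close> and \<open>one\<close> of a module record play no
  role in the locale \<open>module\<close> and are left \<open>undefined\<close> below.
\<close>

definition quot_module :: "('a, 'b, 'm) module_scheme \<Rightarrow> 'b set \<Rightarrow> ('a, 'b set) module" where
  "quot_module M N =
     \<lparr>carrier = a_rcosets\<^bsub>M\<^esub> N, monoid.mult = undefined, one = undefined, zero = N, add = set_add M,
      module.smult = (\<lambda>r C. \<Union>x\<in>C. N +>\<^bsub>M\<^esub> (r \<odot>\<^bsub>M\<^esub> x))\<rparr>"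

definition ideal_module :: "('a, 'm) ring_scheme \<Rightarrow> 'a set \<Rightarrow> ('a, 'a) module" where
  "ideal_module R I =
     \<lparr>carrier = I, monoid.mult = undefined, one = undefined, zero = \<zero>\<^bsub>R\<^esub>, add = add R, module.smult = monoid.mult R\<rparr>"

abbreviation ideal_quot :: "('a, 'm) ring_scheme \<Rightarrow> 'a set \<Rightarrow> 'a set \<Rightarrow> ('a, 'a set) module" where
  "ideal_quot R I J \<equiv> quot_module (ideal_module R I) J"

definition module_isomorphic ::
  "('a, 'r) ring_scheme \<Rightarrow> ('a, 'b, 'm) module_scheme \<Rightarrow> ('a, 'c, 'n) module_scheme \<Rightarrow> bool" where
  "module_isomorphic R M N \<longleftrightarrow>
     (\<exists>f. bij_betw f (carrier M) (carrier N) \<and>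
          (\<forall>x\<in>carrier M. \<forall>y\<in>carrier M. f (x \<oplus>\<^bsub>M\<^esub> y) = f x \<oplus>\<^bsub>N\<^esub> f y) \<and>
          (\<forall>r\<in>carrier R. \<forall>x\<in>carrier M. f (r \<odot>\<^bsub>M\<^esub> x) = r \<odot>\<^bsub>N\<^esub> f x))"

definition free_module :: "('a, 'm) ring_scheme \<Rightarrow> 'x set \<Rightarrow> ('a, 'x \<Rightarrow> 'a) module" where
  "free_module R V =
     \<lparr>carrier = {f. (\<forall>x\<in>V. f x \<in> carrier R) \<and> (\<forall>x. x \<notin> V \<longrightarrow> f x = \<zero>\<^bsub>R\<^esub>) \<and>
                    finite {x. f x \<noteq> \<zero>\<^bsub>R\<^esub>}},
      monoid.mult = undefined, one = undefined, zero = (\<lambda>x. \<zero>\<^bsub>R\<^esub>),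
      add = (\<lambda>f g x. f x \<oplus>\<^bsub>R\<^esub> g x), module.smult = (\<lambda>r f x. r \<otimes>\<^bsub>R\<^esub> f x)\<rparr>"

definition free_gen :: "('a, 'm) ring_scheme \<Rightarrow> 'x \<Rightarrow> 'x \<Rightarrow> 'a" where
  "free_gen R x = (\<lambda>y. if y = x then \<one>\<^bsub>R\<^esub> else \<zero>\<^bsub>R\<^esub>)"

definition gen_submodule ::
  "('a, 'r) ring_scheme \<Rightarrow> ('a, 'b, 'm) module_scheme \<Rightarrow> 'b set \<Rightarrow> 'b set" where
  "gen_submodule R M S = \<Inter>{N. submodule N R M \<and> S \<subseteq> N}"

text \<open>
  For a subring \<open>A\<close> of a commutative ring \<open>B\<close>, the module of relative differentials is the free
  \<open>B\<close>-module on symbols \<open>db\<close> (here \<open>free_gen B b\<close>), \<open>b \<in> B\<close>, modulo additivity, the Leibniz rule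
  and \<open>da = 0\<close> for \<open>a \<in> A\<close>.
\<close>

definition kaehler_relations :: "('a, 'm) ring_scheme \<Rightarrow> 'a set \<Rightarrow> ('a \<Rightarrow> 'a) set" where
  "kaehler_relations B A = (let F = free_module B (carrier B); d = free_gen B in
     {d (x \<oplus>\<^bsub>B\<^esub> y) \<ominus>\<^bsub>F\<^esub> (d x \<oplus>\<^bsub>F\<^esub> d y) | x y. x \<in> carrier B \<and> y \<in> carrier B} \<union>
     {d (x \<otimes>\<^bsub>B\<^esub> y) \<ominus>\<^bsub>F\<^esub> (x \<odot>\<^bsub>F\<^esub> d y \<oplus>\<^bsub>F\<^esub> y \<odot>\<^bsub>F\<^esub> d x) | x y. x \<in> carrier B \<and> y \<in> carrier B} \<union>
     d ` A)"

definition kaehler :: "('a, 'm) ring_scheme \<Rightarrow> 'a set \<Rightarrow> ('a, ('a \<Rightarrow> 'a) set) module" where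
  "kaehler B A =
     quot_module (free_module B (carrier B))
       (gen_submodule B (free_module B (carrier B)) (kaehler_relations B A))"


lemma free_module_is_module:
  fixes R (structure) and V :: "'x set"
  assumes "cring R"
  shows "Module.module R (free_module R V)"
proof -
  interpret cring R by fact
  show ?thesis
  proof (rule moduleI[OF assms])
    have fin: "finite {x. f x \<oplus> g x \<noteq> \<zero>}" if "finite {x. f x \<noteq> \<zero>}" "finite {x. g x \<noteq> \<zero>}" for f g :: "'x \<Rightarrow> 'a"
      by (rule finite_subset[OF _ finite_UnI[OF that]]) auto
    show "abelian_group (free_module R V)"
    proof (rule abelian_groupI)
      fix f assume f: "f \<in> carrier (free_module R V)"
      let ?g = "\<lambda>x. if x \<in> V then \<ominus> f x else \<zero>"
      have "finite {x. ?g x \<noteq> \<zero>}"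
        by (rule finite_subset[of _ "{x. f x \<noteq> \<zero>}"]) (use f in \<open>auto simp: free_module_def\<close>)
      then show "\<exists>g\<in>carrier (free_module R V). g \<oplus>\<^bsub>free_module R V\<^esub> f = \<zero>\<^bsub>free_module R V\<^esub>"
        using f by (intro bexI[of _ ?g]) (auto simp: free_module_def l_neg fun_eq_iff)
    next
      fix f g assume fg: "f \<in> carrier (free_module R V)" "g \<in> carrier (free_module R V)"
      then have c: "f x \<in> carrier R \<and> g x \<in> carrier R" for x
        by (cases "x \<in> V") (auto simp: free_module_def)
      from fg show "f \<oplus>\<^bsub>free_module R V\<^esub> g \<in> carrier (free_module R V)"
        and "f \<oplus>\<^bsub>free_module R V\<^esub> g = g \<oplus>\<^bsub>free_module R V\<^esub> f"
        using fin c by (auto simp: free_module_def fun_eq_iff a_comm)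
    next
      fix f g h assume *: "f \<in> carrier (free_module R V)" "g \<in> carrier (free_module R V)"
         "h \<in> carrier (free_module R V)"
      then have "f x \<in> carrier R \<and> g x \<in> carrier R \<and> h x \<in> carrier R" for x
        by (cases "x \<in> V") (auto simp: free_module_def)
      then show "f \<oplus>\<^bsub>free_module R V\<^esub> g \<oplus>\<^bsub>free_module R V\<^esub> h = f \<oplus>\<^bsub>free_module R V\<^esub> (g \<oplus>\<^bsub>free_module R V\<^esub> h)"
        by (auto simp: free_module_def fun_eq_iff a_assoc)
    next
      fix f assume *: "f \<in> carrier (free_module R V)"
      then have "f x \<in> carrier R" for x
        by (cases "x \<in> V") (auto simp: free_module_def)
      then show "\<zero>\<^bsub>free_module R V\<^esub> \<oplus>\<^bsub>free_module R V\<^esub> f = f"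
        by (auto simp: free_module_def fun_eq_iff)
    qed (auto simp: free_module_def)
  next
    fix a f assume a: "a \<in> carrier R" and f: "f \<in> carrier (free_module R V)"
    have "finite {x. a \<otimes> f x \<noteq> \<zero>}"
    proof (rule finite_subset)
      show "{x. a \<otimes> f x \<noteq> \<zero>} \<subseteq> {x. f x \<noteq> \<zero>}" using a by auto
      show "finite {x. f x \<noteq> \<zero>}" using f by (simp add: free_module_def)
    qed
    then show "a \<odot>\<^bsub>free_module R V\<^esub> f \<in> carrier (free_module R V)"
      using a f by (simp add: free_module_def)
  next
    fix a f g assume "a \<in> carrier R" "f \<in> carrier (free_module R V)" "g \<in> carrier (free_module R V)"
    moreover from this have "f x \<in> carrier R \<and> g x \<in> carrier R" for x
      by (cases "x \<in> V") (auto simp: free_module_def)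
    ultimately show "a \<odot>\<^bsub>free_module R V\<^esub> (f \<oplus>\<^bsub>free_module R V\<^esub> g) =
       a \<odot>\<^bsub>free_module R V\<^esub> f \<oplus>\<^bsub>free_module R V\<^esub> a \<odot>\<^bsub>free_module R V\<^esub> g"
      by (auto simp: free_module_def fun_eq_iff r_distr)
  next
    fix a b f assume "a \<in> carrier R" "b \<in> carrier R" "f \<in> carrier (free_module R V)"
    moreover from this have "f x \<in> carrier R" for x
      by (cases "x \<in> V") (auto simp: free_module_def)
    ultimately show "(a \<oplus> b) \<odot>\<^bsub>free_module R V\<^esub> f =
       a \<odot>\<^bsub>free_module R V\<^esub> f \<oplus>\<^bsub>free_module R V\<^esub> b \<odot>\<^bsub>free_module R V\<^esub> f"
     "(a \<otimes> b) \<odot>\<^bsub>free_module R V\<^esub> f = a \<odot>\<^bsub>free_module R V\<^esub> (b \<odot>\<^bsub>free_module R V\<^esub> f)"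
      by (auto simp: free_module_def fun_eq_iff l_distr m_assoc)
  next
    fix f assume *: "f \<in> carrier (free_module R V)"
    then have "f x \<in> carrier R" for x
      by (cases "x \<in> V") (auto simp: free_module_def)
    then show "\<one> \<odot>\<^bsub>free_module R V\<^esub> f = f"
      by (auto simp: free_module_def fun_eq_iff)
  qed
qed

lemma gen_submodule_is_submodule:
  fixes R (structure) and M (structure)
  assumes "Module.module R M" "S \<subseteq> carrier M"
  shows "submodule (gen_submodule R M S) R M"
proof -
  interpret Module.module R M by fact
  have c: "carrier M \<in> {N. submodule N R M \<and> S \<subseteq> N}"
    using assms carrier_is_submodule by auto
  note E = submoduleE
  show ?thesis
  proof (rule submoduleI)
    show "gen_submodule R M S \<subseteq> carrier M" using c by (auto simp: gen_submodule_def)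
  qed (use E submodule.axioms(1)[THEN subgroup.one_closed] in \<open>auto simp: gen_submodule_def\<close>)
qed

lemma quot_module_is_module:
  fixes R (structure) and M (structure)
  assumes "Module.module R M" "submodule N R M"
  shows "Module.module R (quot_module M N)"
proof -
  interpret Module.module R M by fact
  note E = submoduleE[OF assms(2)]
  interpret N: abelian_subgroup N M
    by (rule abelian_subgroupI3) (auto intro: additive_subgroup.intro submodule.axioms(1) assms(2) M.abelian_group_axioms)
  have sm: "a \<odot>\<^bsub>quot_module M N\<^esub> (N +>\<^bsub>M\<^esub> x) = N +>\<^bsub>M\<^esub> (a \<odot>\<^bsub>M\<^esub> x)"
    if a: "a \<in> carrier R" and x: "x \<in> carrier M" for a x
  proof -
    have "N +>\<^bsub>M\<^esub> (a \<odot>\<^bsub>M\<^esub> y) = N +>\<^bsub>M\<^esub> (a \<odot>\<^bsub>M\<^esub> x)" if y: "y \<in> N +>\<^bsub>M\<^esub> x" for y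
    proof -
      obtain h where h: "h \<in> N" "y = h \<oplus>\<^bsub>M\<^esub> x" using y by (auto simp: a_r_coset_def')
      have hc: "h \<in> carrier M" using h E by auto
      have "a \<odot>\<^bsub>M\<^esub> y = a \<odot>\<^bsub>M\<^esub> h \<oplus>\<^bsub>M\<^esub> a \<odot>\<^bsub>M\<^esub> x"
        using h hc \<open>a \<in> carrier R\<close> \<open>x \<in> carrier M\<close> by (simp add: smult_r_distr)
      moreover have "a \<odot>\<^bsub>M\<^esub> h \<in> N" using E h \<open>a \<in> carrier R\<close> by auto
      ultimately have "a \<odot>\<^bsub>M\<^esub> y \<in> N +>\<^bsub>M\<^esub> (a \<odot>\<^bsub>M\<^esub> x)" by (auto simp: a_r_coset_def')
      then show ?thesis
        by (intro a_repr_independence[symmetric] smult_closed a x N.a_subgroup)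
    qed
    then have "(\<Union>y\<in>N +>\<^bsub>M\<^esub> x. N +>\<^bsub>M\<^esub> (a \<odot>\<^bsub>M\<^esub> y)) = (\<Union>y\<in>N +>\<^bsub>M\<^esub> x. N +>\<^bsub>M\<^esub> (a \<odot>\<^bsub>M\<^esub> x))"
      by (rule SUP_cong[OF refl])
    also have "\<dots> = N +>\<^bsub>M\<^esub> (a \<odot>\<^bsub>M\<^esub> x)"
      using N.a_rcos_self[OF x] by blast
    finally show ?thesis by (simp add: quot_module_def)
  qed
  have ad: "(N +>\<^bsub>M\<^esub> x) \<oplus>\<^bsub>quot_module M N\<^esub> (N +>\<^bsub>M\<^esub> y) = N +>\<^bsub>M\<^esub> (x \<oplus>\<^bsub>M\<^esub> y)"
    if "x \<in> carrier M" "y \<in> carrier M" for x y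
    using that by (simp add: quot_module_def N.a_rcos_sum)
  have car: "V \<in> carrier (quot_module M N) \<longleftrightarrow> (\<exists>x\<in>carrier M. V = N +>\<^bsub>M\<^esub> x)" for V
    by (auto simp: quot_module_def A_RCOSETS_def' a_r_coset_def')
  have mem: "N +>\<^bsub>M\<^esub> x \<in> carrier (quot_module M N)" if "x \<in> carrier M" for x
    unfolding car by (rule bexI[OF _ that]) (rule refl)
  show ?thesis
  proof (rule moduleI[OF R.is_cring])
    have zero: "\<zero>\<^bsub>quot_module M N\<^esub> = N +>\<^bsub>M\<^esub> \<zero>\<^bsub>M\<^esub>"
      using a_coset_add_zero[OF E(1)] by (simp add: quot_module_def)
    have inv: "\<exists>D\<in>carrier (quot_module M N). D \<oplus>\<^bsub>quot_module M N\<^esub> C = \<zero>\<^bsub>quot_module M N\<^esub>"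
      if C: "C \<in> carrier (quot_module M N)" for C
    proof -
      obtain x where x: "x \<in> carrier M" "C = N +>\<^bsub>M\<^esub> x" using iffD1[OF car C] by blast
      then have "(N +>\<^bsub>M\<^esub> (\<ominus>\<^bsub>M\<^esub> x)) \<oplus>\<^bsub>quot_module M N\<^esub> C = \<zero>\<^bsub>quot_module M N\<^esub>"
        using ad[OF M.a_inv_closed[OF x(1)] x(1)] M.l_neg[OF x(1)] by (simp only: x(2) zero)
      moreover have "N +>\<^bsub>M\<^esub> (\<ominus>\<^bsub>M\<^esub> x) \<in> carrier (quot_module M N)"
        unfolding car by (rule bexI[OF refl M.a_inv_closed[OF x(1)]])
      ultimately show ?thesis by (rule bexI)
    qed
    show "abelian_group (quot_module M N)"
    proof (rule abelian_groupI)
      fix C D assume C: "C \<in> carrier (quot_module M N)" and D: "D \<in> carrier (quot_module M N)"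
      obtain x y where xy: "x \<in> carrier M" "C = N +>\<^bsub>M\<^esub> x" "y \<in> carrier M" "D = N +>\<^bsub>M\<^esub> y"
        using iffD1[OF car C] iffD1[OF car D] by blast
      show "C \<oplus>\<^bsub>quot_module M N\<^esub> D \<in> carrier (quot_module M N)"
        unfolding car xy(2,4) ad[OF xy(1,3)] by (rule bexI[OF refl M.a_closed[OF xy(1,3)]])
      show "C \<oplus>\<^bsub>quot_module M N\<^esub> D = D \<oplus>\<^bsub>quot_module M N\<^esub> C"
        using xy by (simp add: ad M.a_comm)
    next
      fix C D F assume C: "C \<in> carrier (quot_module M N)" and D: "D \<in> carrier (quot_module M N)"
        and F: "F \<in> carrier (quot_module M N)"
      obtain x y z where "x \<in> carrier M" "C = N +>\<^bsub>M\<^esub> x" "y \<in> carrier M" "D = N +>\<^bsub>M\<^esub> y"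
        "z \<in> carrier M" "F = N +>\<^bsub>M\<^esub> z"
        using iffD1[OF car C] iffD1[OF car D] iffD1[OF car F] by blast
      then show "C \<oplus>\<^bsub>quot_module M N\<^esub> D \<oplus>\<^bsub>quot_module M N\<^esub> F =
          C \<oplus>\<^bsub>quot_module M N\<^esub> (D \<oplus>\<^bsub>quot_module M N\<^esub> F)"
        by (simp add: ad M.a_assoc)
    next
      fix C assume C: "C \<in> carrier (quot_module M N)"
      obtain x where x: "x \<in> carrier M" "C = N +>\<^bsub>M\<^esub> x" using iffD1[OF car C] by blast
      show "\<zero>\<^bsub>quot_module M N\<^esub> \<oplus>\<^bsub>quot_module M N\<^esub> C = C"
        unfolding zero x(2) ad[OF M.zero_closed x(1)] M.l_zero[OF x(1)] ..
    next
      show "\<zero>\<^bsub>quot_module M N\<^esub> \<in> carrier (quot_module M N)"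
        unfolding zero car by (rule bexI[OF refl M.zero_closed])
    qed (rule inv)
  qed (auto dest!: iffD1[OF car] simp: mem sm ad smult_l_distr smult_r_distr smult_assoc1)
qed

lemma kaehler_relations_closed:
  assumes "cring B" "A \<subseteq> carrier B"
  shows "kaehler_relations B A \<subseteq> carrier (free_module B (carrier B))"
proof -
  interpret M: Module.module B "free_module B (carrier B)"
    using free_module_is_module[OF assms(1)] .
  have "free_gen B x \<in> carrier (free_module B (carrier B))" if "x \<in> carrier B" for x
  proof -
    have "finite {y. free_gen B x y \<noteq> \<zero>\<^bsub>B\<^esub>}"
      by (rule finite_subset[of _ "{x}"]) (auto simp: free_gen_def)
    then show ?thesis using that by (auto simp: free_module_def) (auto simp: free_gen_def)
  qed
  then show ?thesis using assms(2)
    by (auto simp: kaehler_relations_def Let_def)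
qed

lemma kaehler_is_module:
  assumes "cring B" "A \<subseteq> carrier B"
  shows "Module.module B (kaehler B A)"
  unfolding kaehler_def
  by (intro quot_module_is_module gen_submodule_is_submodule free_module_is_module
      kaehler_relations_closed assms)


section \<open>Characteristic, Galois and Kummer extensions\<close>

text \<open>
  The field \<open>L\<close> is the type \<open>'l\<close>; \<open>ring_of_type_algebra\<close> is the corresponding record. The
  field \<open>K\<close> is a subset of \<open>L\<close>.
\<close>

text \<open>The same convention as for \<open>CHAR\<close> of a type: the value is \<open>0\<close> if no positive multiple of
  \<open>1\<close> vanishes.\<close>

definition ring_char :: "('a, 'm) ring_scheme \<Rightarrow> nat" where
  "ring_char R = Gcd {n. [n] \<cdot>\<^bsub>R\<^esub> \<one>\<^bsub>R\<^esub> = \<zero>\<^bsub>R\<^esub>}"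

definition primitive_root_of_unity :: "nat \<Rightarrow> 'a::monoid_mult \<Rightarrow> bool" where
  "primitive_root_of_unity n z \<longleftrightarrow> z ^ n = 1 \<and> (\<forall>k. 0 < k \<and> k < n \<longrightarrow> z ^ k \<noteq> 1)"

definition gal :: "'l::field set \<Rightarrow> ('l \<Rightarrow> 'l) set" where
  "gal K = {\<sigma> \<in> ring_iso ring_of_type_algebra ring_of_type_algebra. \<forall>x\<in>K. \<sigma> x = x}"

definition galois_extension :: "'l::field set \<Rightarrow> bool" where
  "galois_extension K \<longleftrightarrow>
     subfield K ring_of_type_algebra \<and>
     (\<exists>n. ring.dimension ring_of_type_algebra n K (UNIV :: 'l set)) \<and>
     {x. \<forall>\<sigma>\<in>gal K. \<sigma> x = x} = K"

text \<open>Since \<open>q\<close> differs from the characteristic, there are exactly \<open>q\<close> many \<open>q\<close>-th roots of unity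
  in an algebraic closure of \<open>K\<close>; so \<open>K\<close> contains all of them iff it contains \<open>q\<close> many.\<close>

definition kummer_extension :: "'l::field set \<Rightarrow> nat \<Rightarrow> bool" where
  "kummer_extension K q \<longleftrightarrow>
     prime q \<and> galois_extension K \<and>
     ring.dimension ring_of_type_algebra q K (UNIV :: 'l set) \<and>
     q \<noteq> CHAR('l) \<and> card {x \<in> K. x ^ q = 1} = q"

definition kummer_generator :: "'l::field set \<Rightarrow> nat \<Rightarrow> 'l \<Rightarrow> bool" where
  "kummer_generator K q \<eta> \<longleftrightarrow>
     generate_field ring_of_type_algebra (K \<union> {\<eta>}) = UNIV \<and> \<eta> ^ q \<in> K"

abbreviation adjoin :: "'l::field set \<Rightarrow> 'l \<Rightarrow> 'l set" where
  "adjoin A x \<equiv> ring.simple_extension ring_of_type_algebra A x"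


section \<open>Valuations\<close>

text \<open>
  A Krull valuation is written additively, with values in an arbitrary ordered abelian group; its
  value group is the image of the nonzero elements. The value of \<open>0\<close> is infinity by convention,
  so the number \<open>v 0\<close> carries no meaning: comparisons are made through \<open>val_ge\<close> and \<open>val_gt\<close>
  wherever the argument might be \<open>0\<close>.
\<close>

definition valuation :: "('l::field \<Rightarrow> 'g::linordered_ab_group_add) \<Rightarrow> bool" where
  "valuation v \<longleftrightarrow>
     (\<forall>x y. x \<noteq> 0 \<longrightarrow> y \<noteq> 0 \<longrightarrow> v (x * y) = v x + v y) \<and>
     (\<forall>x y. x \<noteq> 0 \<longrightarrow> y \<noteq> 0 \<longrightarrow> x + y \<noteq> 0 \<longrightarrow> min (v x) (v y) \<le> v (x + y))"

definition val_ge :: "('l::field \<Rightarrow> 'g::linordered_ab_group_add) \<Rightarrow> 'l \<Rightarrow> 'g \<Rightarrow> bool" where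
  "val_ge v x \<gamma> \<longleftrightarrow> x = 0 \<or> \<gamma> \<le> v x"

definition val_gt :: "('l::field \<Rightarrow> 'g::linordered_ab_group_add) \<Rightarrow> 'l \<Rightarrow> 'g \<Rightarrow> bool" where
  "val_gt v x \<gamma> \<longleftrightarrow> x = 0 \<or> \<gamma> < v x"

definition value_group :: "'l::field set \<Rightarrow> ('l \<Rightarrow> 'g::linordered_ab_group_add) \<Rightarrow> 'g set" where
  "value_group F v = v ` (F - {0})"

definition val_ring :: "'l::field set \<Rightarrow> ('l \<Rightarrow> 'g::linordered_ab_group_add) \<Rightarrow> 'l set" where
  "val_ring F v = {x \<in> F. val_ge v x 0}"

definition val_ideal :: "'l::field set \<Rightarrow> ('l \<Rightarrow> 'g::linordered_ab_group_add) \<Rightarrow> 'l set" where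
  "val_ideal F v = {x \<in> F. val_gt v x 0}"

text \<open>\<open>set_ring A\<close> is the subring \<open>A\<close> of \<open>L\<close> as a ring record.\<close>

abbreviation set_ring :: "'l::field set \<Rightarrow> 'l ring" where
  "set_ring A \<equiv> ring_of_type_algebra\<lparr>carrier := A\<rparr>"

abbreviation OL :: "('l::field \<Rightarrow> 'g::linordered_ab_group_add) \<Rightarrow> 'l ring" where
  "OL v \<equiv> set_ring (val_ring UNIV v)"

definition residue_field ::
  "'l::field set \<Rightarrow> ('l \<Rightarrow> 'g::linordered_ab_group_add) \<Rightarrow> 'l set ring" where
  "residue_field F v = set_ring (val_ring F v) Quot val_ideal F v"

text \<open>The index \<open>(vL : vK)\<close>, as the number of cosets; it is \<open>0\<close> if there are infinitely many.\<close>

definition value_index :: "'l::field set \<Rightarrow> ('l \<Rightarrow> 'g::linordered_ab_group_add) \<Rightarrow> nat" where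
  "value_index K v = card ((\<lambda>\<gamma>. (+) \<gamma> ` value_group K v) ` value_group UNIV v)"

definition int_multiple :: "int \<Rightarrow> 'g::ab_group_add \<Rightarrow> 'g" where
  "int_multiple n g = (if 0 \<le> n then (\<Sum>i<nat n. g) else - (\<Sum>i<nat (- n). g))"

definition add_multiples :: "'g::ab_group_add set \<Rightarrow> 'g \<Rightarrow> 'g set" where
  "add_multiples G g = {a + int_multiple n g | a n. a \<in> G}"

definition one_unit :: "('l::field \<Rightarrow> 'g::linordered_ab_group_add) \<Rightarrow> 'l \<Rightarrow> bool" where
  "one_unit v u \<longleftrightarrow> u \<in> val_ring UNIV v \<and> val_gt v (u - 1) 0"

definition convex_subgroup :: "'g::linordered_ab_group_add set \<Rightarrow> 'g set \<Rightarrow> bool" where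
  "convex_subgroup H G \<longleftrightarrow>
     H \<subseteq> G \<and> 0 \<in> H \<and> (\<forall>a\<in>H. \<forall>b\<in>H. a + b \<in> H) \<and> (\<forall>a\<in>H. - a \<in> H) \<and>
     (\<forall>a\<in>H. \<forall>c\<in>H. \<forall>b\<in>G. a \<le> b \<and> b \<le> c \<longrightarrow> b \<in> H)"

text \<open>The convex subgroups of \<open>vL\<close> form a chain, so the greatest element exists.\<close>

definition HE :: "'l::field set \<Rightarrow> ('l \<Rightarrow> 'g::linordered_ab_group_add) \<Rightarrow> 'g set" where
  "HE K v =
     (GREATEST H. convex_subgroup H (value_group UNIV v) \<and> convex_subgroup H (value_group K v))"

definition OE :: "'l::field set \<Rightarrow> ('l \<Rightarrow> 'g::linordered_ab_group_add) \<Rightarrow> 'l set" where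
  "OE K v = {a. \<exists>\<gamma>\<in>HE K v. val_ge v a \<gamma>}"

definition ME :: "'l::field set \<Rightarrow> ('l \<Rightarrow> 'g::linordered_ab_group_add) \<Rightarrow> 'l set" where
  "ME K v = {a. \<forall>\<gamma>\<in>HE K v. val_gt v a \<gamma>}"

definition ramification_ideal ::
  "'l::field set \<Rightarrow> ('l \<Rightarrow> 'g::linordered_ab_group_add) \<Rightarrow> 'l set" where
  "ramification_ideal K v = Idl\<^bsub>OL v\<^esub> {(\<sigma> b - b) / b | \<sigma> b. \<sigma> \<in> gal K \<and> b \<noteq> 0}"

text \<open>Products and powers of \<open>O\<^sub>L\<close>-ideals: \<open>ideals_set\<close> has the ideal product as multiplication.\<close>

abbreviation OL_prod ::
  "('l::field \<Rightarrow> 'g::linordered_ab_group_add) \<Rightarrow> 'l set \<Rightarrow> 'l set \<Rightarrow> 'l set" where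
  "OL_prod v I J \<equiv> I \<otimes>\<^bsub>ideals_set (OL v)\<^esub> J"

abbreviation OL_power ::
  "('l::field \<Rightarrow> 'g::linordered_ab_group_add) \<Rightarrow> 'l set \<Rightarrow> nat \<Rightarrow> 'l set" where
  "OL_power v I n \<equiv> I [^]\<^bsub>ideals_set (OL v)\<^esub> n"

abbreviation scale_ideal :: "'l::field \<Rightarrow> 'l set \<Rightarrow> 'l set" where
  "scale_ideal a I \<equiv> (*) a ` I"


section \<open>The two cases\<close>

definition kummer_case_i ::
  "'l::field set \<Rightarrow> ('l \<Rightarrow> 'g::linordered_ab_group_add) \<Rightarrow> nat \<Rightarrow> 'l \<Rightarrow> bool" where
  "kummer_case_i K v q \<eta> \<longleftrightarrow>
     kummer_generator K q \<eta> \<and>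
     value_group UNIV v = add_multiples (value_group K v) (v \<eta>) \<and>
     val_ring UNIV v = (\<Union>c\<in>{c\<in>K. val_gt v (c * \<eta>) 0}. adjoin (val_ring K v) (c * \<eta>))"

definition kummer_case_ii ::
  "'l::field set \<Rightarrow> ('l \<Rightarrow> 'g::linordered_ab_group_add) \<Rightarrow> nat \<Rightarrow> 'l \<Rightarrow> 'l \<Rightarrow> bool" where
  "kummer_case_ii K v q \<zeta> \<eta> \<longleftrightarrow>
     kummer_generator K q \<eta> \<and> one_unit v \<eta> \<and>
     (let \<xi> = (\<eta> - 1) / (\<zeta> - 1) in
        v \<xi> < 0 \<and>
        value_group UNIV v = add_multiples (value_group K v) (v \<xi>) \<and>
        (\<exists>j\<in>{1..q - 1}.
           val_ring UNIV v =
             (\<Union>c\<in>{c\<in>K. val_gt v (c * \<xi> ^ j) 0}. adjoin (val_ring K v) (c * \<xi> ^ j))))"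

end

theory Submission
  imports Defs "HOL-Computational_Algebra.Polynomial"
begin

text \<open>
  If \<open>v t \<notin> vK\<close>, then \<open>1, t, \<dots>, t\<^sup>q\<^sup>-\<^sup>1\<close> have values in distinct cosets of \<open>vK\<close>, so they
  form a basis of \<open>L|K\<close> and the value of \<open>\<Sum>a\<^sub>i t\<^sup>i\<close> is the minimum of the values of its terms. This
  controls everything: the extension is unibranched, every \<open>\<eta> \<in> L\<close> has a best approximation
  in \<open>K\<close>, and a Kummer generator can be modified so that either \<open>v \<eta>\<close> or \<open>v (\<eta> - 1)\<close> is not in \<open>vK\<close>.

  Suppose that \<open>\<O>\<^sub>L\<close> is the union of the rings \<open>\<O>\<^sub>K[u]\<close>, \<open>u = c t\<close> with \<open>c \<in> K\<close>, \<open>v u > 0\<close>. If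
  \<open>h\<close> is the minimal polynomial of \<open>u\<close>, then \<open>\<Omega>\<close> of \<open>\<O>\<^sub>K[u]\<close> is generated by \<open>du\<close> with annihilator
  generated by \<open>h'(u)\<close>. Sending \<open>du\<close> to \<open>u\<close> is compatible with the inclusions between these rings,
  and if \<open>v (h'(u)) = v (s u\<^sup>q\<^sup>-\<^sup>1)\<close> for a fixed \<open>s\<close>, then in the union the generators \<open>u\<close> yield \<open>\<M>\<^sub>\<E>\<close> and the
  relations \<open>u h'(u)\<close> yield \<open>s \<M>\<^sub>\<E>\<^sup>q\<close>, whence \<open>\<Omega> \<cong> \<M>\<^sub>\<E> / s \<M>\<^sub>\<E>\<^sup>q\<close>. In case (i) \<open>t = \<eta>\<close> and \<open>s = q\<close>;
  in case (ii) \<open>t = \<xi>\<^sup>j\<close> and \<open>s = \<xi>\<^sup>1\<^sup>-\<^sup>q\<close>, because \<open>v (\<sigma> \<xi>\<^sup>j - \<xi>\<^sup>j) = v (\<xi>\<^sup>j\<^sup>-\<^sup>1)\<close> for \<open>\<sigma> \<noteq> 1\<close>.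
\<close>


section \<open>Polynomials with coefficients in a subring\<close>

text \<open>Both cases start from one Kummer element. If its value is outside \<open>vK\<close>, its
  powers with exponents prime to \<open>q\<close> are again Kummer generators, so the exponent
  needed to generate \<O> is absorbed into \<eta>. Otherwise division by the best approximation
  gives a 1-unit; powers of \<xi> do not in general come from Kummer generators, so \<open>j\<close>
  stays visible in case (ii). The bound \<open>v (\<eta> - 1) \<le> v (\<zeta> - 1)\<close> makes
  \<open>v \<xi>\<close> negative and excludes residue characteristics other than \<open>q\<close>.
  The choice of exponent matters when \<open>ME K v\<close> is principal over \<open>OE K v\<close>:
  the coset of \<open>vK\<close> containing the value of a generator is then prescribed. In the
  nonprincipal case the ideal equals its powers, and every nontrivial coset serves. \<O> need not be
  generated over \<A> by one element, but each identity about differentials involves finitely many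
  elements and can be checked in one ring \<open>\<A>[u]\<close>. The quotient obtained is rewritten
  by multiplication with some \<open>w\<close> such that \<open>v s = v (w ^ (q - 1))\<close>. A
  generator \<open>w\<close> of the ramification ideal has this property; for \<open>s = q\<close>
  this is because \<open>q\<close> is the product of the \<open>1 - \<zeta> ^ i\<close>.\<close>

definition polys_over :: "'a::zero set \<Rightarrow> 'a poly set" where
  "polys_over S = {p. \<forall>i. coeff p i \<in> S}"

text \<open>One locale serves \<O>, \<A>, \<open>K\<close>, \<open>OE K v\<close> and the fixed set
  of an automorphism. All of them are subsets of the same type, so polynomials over them are
  compared without coefficient maps.\<close>

locale subring_set =
  fixes S :: "'a::idom set"
  assumes one_in: "1 \<in> S"
    and diff_in: "a \<in> S \<Longrightarrow> b \<in> S \<Longrightarrow> a - b \<in> S"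
    and mult_in: "a \<in> S \<Longrightarrow> b \<in> S \<Longrightarrow> a * b \<in> S"
begin

lemma zero_in: "0 \<in> S"
  using diff_in[OF one_in one_in] by simp

lemma minus_in: "a \<in> S \<Longrightarrow> - a \<in> S"
  using diff_in[OF zero_in, of a] by simp

lemma add_in: "a \<in> S \<Longrightarrow> b \<in> S \<Longrightarrow> a + b \<in> S"
  using diff_in[of a "- b"] minus_in[of b] by simp

lemma power_in: "a \<in> S \<Longrightarrow> a ^ n \<in> S"
  by (induction n) (auto intro: one_in mult_in)

lemma sum_in: "(\<And>x. x \<in> I \<Longrightarrow> f x \<in> S) \<Longrightarrow> sum f I \<in> S"
  by (induction I rule: infinite_finite_induct) (auto intro: zero_in add_in)

lemma of_nat_in: "of_nat n \<in> S"
  by (induction n) (auto intro: zero_in one_in add_in)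

lemma poly_in: "p \<in> polys_over S \<Longrightarrow> x \<in> S \<Longrightarrow> poly p x \<in> S"
  unfolding poly_altdef by (intro sum_in mult_in power_in) (auto simp: polys_over_def)

lemma pCons_polys_over: "pCons a p \<in> polys_over S \<longleftrightarrow> a \<in> S \<and> p \<in> polys_over S"
  by (auto simp: polys_over_def coeff_pCons split: nat.splits)

lemma monom_polys_over: "a \<in> S \<Longrightarrow> monom a n \<in> polys_over S"
  by (auto simp: polys_over_def intro: zero_in)

lemma zero_polys_over: "0 \<in> polys_over S"
  by (auto simp: polys_over_def intro: zero_in)

lemma add_polys_over: "p \<in> polys_over S \<Longrightarrow> r \<in> polys_over S \<Longrightarrow> p + r \<in> polys_over S"
  by (auto simp: polys_over_def intro: add_in)

lemma diff_polys_over: "p \<in> polys_over S \<Longrightarrow> r \<in> polys_over S \<Longrightarrow> p - r \<in> polys_over S"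
  by (auto simp: polys_over_def intro: diff_in)

lemma mult_polys_over: "p \<in> polys_over S \<Longrightarrow> r \<in> polys_over S \<Longrightarrow> p * r \<in> polys_over S"
  by (auto simp: polys_over_def coeff_mult intro: sum_in mult_in)

lemma pderiv_polys_over: "p \<in> polys_over S \<Longrightarrow> pderiv p \<in> polys_over S"
  by (auto simp: polys_over_def coeff_pderiv simp flip: of_nat_Suc intro: mult_in of_nat_in)

lemma scale_polys_over:
  assumes "p \<in> polys_over S" "c \<in> S"
  shows "p \<circ>\<^sub>p [:0, c:] \<in> polys_over S"
  using assms by (auto simp: polys_over_def coeff_pcompose_linear intro: mult_in power_in)

text \<open>No coefficient is ever divided because \<open>h\<close> is monic. This allows elements
  of \<open>\<A>[u]\<close> to be written with degree below \<open>q\<close> while the coefficients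
  stay integral.\<close>

lemma monic_division:
  assumes h: "h \<in> polys_over S" "lead_coeff h = 1" "0 < degree h" and p: "p \<in> polys_over S"
  shows "\<exists>n\<in>polys_over S. \<exists>r\<in>polys_over S. p = h * n + r \<and> degree r < degree h"
  using p
proof (induction "degree p" arbitrary: p rule: less_induct)
  case less
  show ?case
  proof (cases "degree p < degree h")
    case True
    then show ?thesis
      using less.prems zero_polys_over by (intro bexI[of _ 0] bexI[of _ p]) auto
  next
    case False
    define m where "m = monom (lead_coeff p) (degree p - degree h)"
    define r where "r = p - h * m"
    have m: "m \<in> polys_over S"
      unfolding m_def using less.prems by (intro monom_polys_over) (auto simp: polys_over_def)
    have r: "r \<in> polys_over S"
      unfolding r_def by (intro diff_polys_over mult_polys_over less.prems h m)
    have "degree r < degree p"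
    proof -
      have "coeff (h * m) (degree p) = lead_coeff p"
        using False h by (simp add: m_def mult.commute[of h] coeff_monom_mult)
      moreover have "degree (h * m) \<le> degree p"
        using degree_mult_le[of h m] degree_monom_le[of "lead_coeff p" "degree p - degree h"] False
        unfolding m_def by linarith
      ultimately have *: "coeff r (degree p) = 0" "degree r \<le> degree p"
        by (auto simp: r_def intro: degree_diff_le)
      then show ?thesis
        using h(3) False leading_coeff_0_iff[of r] by (cases "degree r = degree p") auto
    qed
    from less.hyps[OF this r] obtain n s where
      *: "n \<in> polys_over S" "s \<in> polys_over S" "r = h * n + s" "degree s < degree h" by blast
    have "p = h * (n + m) + s" using *(3) by (simp add: r_def algebra_simps)
    then show ?thesis using * m add_polys_over by blast
  qed
qed

lemma prod_polys_over: "(\<And>i. i \<in> I \<Longrightarrow> f i \<in> polys_over S) \<Longrightarrow> prod f I \<in> polys_over S"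
proof (induction I rule: infinite_finite_induct)
  case empty
  show ?case using monom_polys_over[OF one_in, of 0] by (simp add: monom_0 one_pCons)
next
  case (infinite I)
  show ?case using monom_polys_over[OF one_in, of 0] infinite by (simp add: monom_0 one_pCons)
qed (auto intro: mult_polys_over)

text \<open>The cofactor is the geometric sum. It gives the divisibility of
  \<open>\<zeta> ^ k - 1\<close> by \<open>\<zeta> - 1\<close> and of
  \<open>(1 + \<epsilon>) ^ i - 1\<close> by \<epsilon>.\<close>

lemma power_diff_one: "x \<in> S \<Longrightarrow> \<exists>r\<in>S. x ^ n - 1 = (x - 1) * r"
  by (intro bexI[of _ "\<Sum>i<n. x ^ i"]) (auto simp: power_diff_1_eq intro: sum_in power_in)

end

text \<open>\<open>simple_extension\<close> is generated by the Horner step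
  \<open>k1 * x + k2\<close>, which is the evaluation of \<open>pCons\<close>; so both inclusions
  are parallel inductions.\<close>

lemma adjoin_eq:
  fixes S :: "'l::field set"
  assumes "subring_set S"
  shows "adjoin S x = {poly p x | p. p \<in> polys_over S}"
proof -
  interpret subring_set S by fact
  interpret R: ring "ring_of_type_algebra :: 'l ring" by (rule ring_from_type_algebra)
  show ?thesis
  proof (intro equalityI subsetI)
    fix y assume "y \<in> adjoin S x"
    then show "y \<in> {poly p x | p. p \<in> polys_over S}"
    proof (induction rule: R.simple_extension.induct)
      case zero
      show ?case using zero_polys_over by (auto intro!: exI[of _ 0] simp: ring_of_type_algebra_def)
    next
      case (lin k1 k2)
      then obtain p where "k1 = poly p x" "p \<in> polys_over S" by auto
      with lin show ?case
        by (auto intro!: exI[of _ "pCons k2 p"] simp: ring_of_type_algebra_def pCons_polys_over)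
    qed
  next
    fix y assume "y \<in> {poly p x | p. p \<in> polys_over S}"
    then obtain p where "y = poly p x" "p \<in> polys_over S" by auto
    then show "y \<in> adjoin S x"
    proof (induction p arbitrary: y)
      case 0
      then show ?case using R.simple_extension.zero[of S x] by (simp add: ring_of_type_algebra_def)
    next
      case (pCons a p)
      then show ?case using R.simple_extension.lin[of "poly p x" S x a]
        by (simp add: ring_of_type_algebra_def pCons_polys_over algebra_simps)
    qed
  qed
qed

text \<open>Both sides are monic of degree \<open>n\<close>, so their difference has degree below
  \<open>n\<close> but \<open>n\<close> roots.\<close>

lemma poly_prod_roots:
  fixes p :: "'a::idom poly"
  assumes "degree p = n" "lead_coeff p = 1" "\<And>i. i < n \<Longrightarrow> poly p (r i) = 0" "inj_on r {..<n}"
  shows "p = (\<Prod>i<n. [:- r i, 1:])"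
proof (rule poly_eqI_degree_lead_coeff[where n = n and A = "r ` {..<n}"])
  show "degree p \<le> n" "card (r ` {..<n}) \<ge> n"
    using assms by (auto simp: card_image)
  have "degree (\<Prod>i<n. [:- r i, 1:]) = n"
    by (subst degree_prod_eq_sum_degree) auto
  then show "degree (\<Prod>i<n. [:- r i, 1:]) \<le> n" "coeff p n = coeff (\<Prod>i<n. [:- r i, 1:]) n"
    using assms lead_coeff_prod[of "\<lambda>i. [:- r i, 1:]" "{..<n}"] by auto
  show "poly p z = poly (\<Prod>i<n. [:- r i, 1:]) z" if "z \<in> r ` {..<n}" for z
    using that assms(3) by (auto simp: poly_prod)
qed

text \<open>In the product rule only the term that differentiates the vanishing factor survives.
  This yields both the factorization of \<open>q\<close> by roots of unity and the value of the
  derivative of a minimal polynomial.\<close>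

lemma pderiv_prod_root:
  fixes r :: "nat \<Rightarrow> 'a::idom"
  shows "poly (pderiv (\<Prod>i<Suc n. [:- r i, 1:])) (r 0) = (\<Prod>i=1..n. r 0 - r i)"
proof -
  have eq: "(\<Prod>i<Suc n. [:- r i, 1:]) = [:- r 0, 1:] * (\<Prod>i=1..n. [:- r i, 1:])"
    by (simp only: prod.lessThan_Suc_shift prod.atLeast1_atMost_eq One_nat_def)
  show ?thesis
    unfolding eq pderiv_mult by (simp add: pderiv_pCons poly_prod del: mult_pCons_left mult_pCons_right)
qed


section \<open>Subrings and ideals of a field as ring records\<close>

lemma set_ring_simps [simp]:
  "carrier (set_ring S) = S"
  "x \<otimes>\<^bsub>set_ring S\<^esub> y = x * y" "x \<oplus>\<^bsub>set_ring S\<^esub> y = x + y"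
  "\<zero>\<^bsub>set_ring S\<^esub> = 0" "\<one>\<^bsub>set_ring S\<^esub> = 1"
  "x \<otimes>\<^bsub>ring_of_type_algebra\<^esub> y = x * y" "x \<oplus>\<^bsub>ring_of_type_algebra\<^esub> y = x + y"
  "\<zero>\<^bsub>ring_of_type_algebra\<^esub> = 0" "\<one>\<^bsub>ring_of_type_algebra\<^esub> = 1"
  by (auto simp: ring_of_type_algebra_def)

lemma cring_set_ring:
  fixes S :: "'l::field set"
  assumes "subring_set S" shows "cring (set_ring S)"
proof -
  interpret subring_set S by fact
  show ?thesis
  proof (rule cringI)
    show "abelian_group (set_ring S)"
      using minus_in by (intro abelian_groupI) (auto simp: ring_of_type_algebra_def add_in zero_in
        intro!: bexI[of _ "- _"])
    show "comm_monoid (set_ring S)"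
      by (intro comm_monoidI) (auto simp: ring_of_type_algebra_def mult_in one_in)
  qed (auto simp: ring_of_type_algebra_def algebra_simps)
qed

lemma ideal_set_ring:
  fixes S :: "'l::field set"
  assumes S: "subring_set S" and I: "I \<subseteq> S" "0 \<in> I" "\<And>x y. x \<in> I \<Longrightarrow> y \<in> I \<Longrightarrow> x + y \<in> I"
    "\<And>r x. r \<in> S \<Longrightarrow> x \<in> I \<Longrightarrow> r * x \<in> I"
  shows "ideal I (set_ring S)"
proof -
  interpret subring_set S by fact
  interpret R: cring "set_ring S" using S by (rule cring_set_ring)
  have inv: "\<ominus>\<^bsub>set_ring S\<^esub> x = - x" if "x \<in> S" for x
    using R.l_neg[of x] that by (simp add: eq_neg_iff_add_eq_0)
  show ?thesis
  proof (rule idealI)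
    show "subgroup I (add_monoid (set_ring S))"
    proof (rule R.add.subgroupI)
      show "\<ominus>\<^bsub>set_ring S\<^esub> x \<in> I" if "x \<in> I" for x
        using inv[of x] that I I(4)[of "- 1" x] minus_in[OF one_in] by auto
    qed (use I in auto)
    show "x \<otimes>\<^bsub>set_ring S\<^esub> a \<in> I" "a \<otimes>\<^bsub>set_ring S\<^esub> x \<in> I"
      if "a \<in> I" "x \<in> carrier (set_ring S)" for a x
      using I(4)[of x a] that by (simp_all add: mult.commute)
  qed (rule R.ring_axioms)
qed


section \<open>Valued fields\<close>

locale valued_field =
  fixes v :: "'l::field \<Rightarrow> 'g::linordered_ab_group_add"
  assumes valuation_v: "valuation v"
begin

abbreviation "\<O> \<equiv> val_ring UNIV v"

lemma v_mult: "x \<noteq> 0 \<Longrightarrow> y \<noteq> 0 \<Longrightarrow> v (x * y) = v x + v y"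
  using valuation_v by (auto simp: valuation_def)

lemma v_one [simp]: "v 1 = 0"
  using v_mult[of 1 1] by simp

text \<open>Multiples of \<open>v x\<close> are written as \<open>v (x ^ n)\<close>, since the value
  group carries no scalar multiplication. The three signs are carried through one induction and then
  exclude each other.\<close>

lemma v_power_0_iff: "x \<noteq> 0 \<Longrightarrow> 0 < n \<Longrightarrow> v (x ^ n) = 0 \<longleftrightarrow> v x = 0"
  and v_power_pos_iff: "x \<noteq> 0 \<Longrightarrow> 0 < n \<Longrightarrow> 0 < v (x ^ n) \<longleftrightarrow> 0 < v x"
proof -
  have "(0 < v x \<longrightarrow> 0 < v (x ^ Suc n)) \<and> (v x = 0 \<longrightarrow> v (x ^ Suc n) = 0) \<and> (v x < 0 \<longrightarrow> v (x ^ Suc n) < 0)"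
    if "x \<noteq> 0" for x n
  proof (induction n)
    case (Suc n)
    have "v (x ^ Suc (Suc n)) = v x + v (x ^ Suc n)"
      using that v_mult[of x "x ^ Suc n"] by simp
    with Suc show ?case by (auto intro: add_pos_pos add_neg_neg)
  qed simp
  then have *: "(0 < v x \<longrightarrow> 0 < v (x ^ n)) \<and> (v x = 0 \<longrightarrow> v (x ^ n) = 0) \<and> (v x < 0 \<longrightarrow> v (x ^ n) < 0)"
    if "x \<noteq> 0" "0 < n" for x n using that by (cases n) auto
  show "v (x ^ n) = 0 \<longleftrightarrow> v x = 0" "0 < v (x ^ n) \<longleftrightarrow> 0 < v x" if "x \<noteq> 0" "0 < n"
    using *[OF that] by (metis less_irrefl less_linear less_asym)+
qed

lemma v_minus [simp]: "v (- x) = v x"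
proof (cases "x = 0")
  case False
  \<comment> \<open>The square of \<open>- 1\<close> is 1, and an ordered group has no
    torsion.\<close>
  have "v (- 1) = 0"
    using v_power_0_iff[of "- 1" 2] by simp
  then show ?thesis using v_mult[of "-1" x] False by simp
qed simp

lemma v_inverse: "x \<noteq> 0 \<Longrightarrow> v (inverse x) = - v x"
  using v_mult[of x "inverse x"] by (simp add: eq_neg_iff_add_eq_0 add.commute)

lemma v_divide: "x \<noteq> 0 \<Longrightarrow> y \<noteq> 0 \<Longrightarrow> v (x / y) = v x - v y"
  by (simp add: divide_inverse v_mult v_inverse)

lemma v_prod: "(\<And>i. i \<in> I \<Longrightarrow> f i \<noteq> 0) \<Longrightarrow> v (\<Prod>i\<in>I. f i) = (\<Sum>i\<in>I. v (f i))"
  by (induction I rule: infinite_finite_induct) (auto simp: v_mult)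

lemma v_power_mono:
  assumes "x \<noteq> 0" "y \<noteq> 0" "v x \<le> v y" shows "v (x ^ n) \<le> v (y ^ n)"
proof (induction n)
  case (Suc n)
  then show ?case using assms by (simp add: v_mult add_mono)
qed simp

lemma val_ge_simps [simp]: "val_ge v 0 \<gamma>" "val_gt v 0 \<gamma>" "x \<noteq> 0 \<Longrightarrow> val_ge v x \<gamma> \<longleftrightarrow> \<gamma> \<le> v x"
   "x \<noteq> 0 \<Longrightarrow> val_gt v x \<gamma> \<longleftrightarrow> \<gamma> < v x"
  by (auto simp: val_ge_def val_gt_def)

lemma val_ge_minus [simp]: "val_ge v (- x) \<gamma> = val_ge v x \<gamma>" "val_gt v (- x) \<gamma> = val_gt v x \<gamma>"
  by (auto simp: val_ge_def val_gt_def)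

lemma val_ge_add: "val_ge v x \<gamma> \<Longrightarrow> val_ge v y \<gamma> \<Longrightarrow> val_ge v (x + y) \<gamma>"
  and val_gt_add: "val_gt v x \<gamma> \<Longrightarrow> val_gt v y \<gamma> \<Longrightarrow> val_gt v (x + y) \<gamma>"
proof -
  have *: "x \<noteq> 0 \<Longrightarrow> y \<noteq> 0 \<Longrightarrow> x + y \<noteq> 0 \<Longrightarrow> min (v x) (v y) \<le> v (x + y)"
    using valuation_v by (auto simp: valuation_def)
  show "val_ge v x \<gamma> \<Longrightarrow> val_ge v y \<gamma> \<Longrightarrow> val_ge v (x + y) \<gamma>"
    using * by (cases "x = 0"; cases "y = 0"; cases "x + y = 0") (auto simp: min_le_iff_disj)
  show "val_gt v x \<gamma> \<Longrightarrow> val_gt v y \<gamma> \<Longrightarrow> val_gt v (x + y) \<gamma>"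
    using * by (cases "x = 0"; cases "y = 0"; cases "x + y = 0") (auto simp: min_le_iff_disj)
qed

lemma val_ge_diff: "val_ge v x \<gamma> \<Longrightarrow> val_ge v y \<gamma> \<Longrightarrow> val_ge v (x - y) \<gamma>"
  and val_gt_diff: "val_gt v x \<gamma> \<Longrightarrow> val_gt v y \<gamma> \<Longrightarrow> val_gt v (x - y) \<gamma>"
  using val_ge_add[of x \<gamma> "- y"] val_gt_add[of x \<gamma> "- y"] by auto

lemma val_ge_sum: "(\<And>i. i \<in> I \<Longrightarrow> val_ge v (f i) \<gamma>) \<Longrightarrow> val_ge v (sum f I) \<gamma>"
  by (induction I rule: infinite_finite_induct) (auto intro: val_ge_add)

lemma val_gt_sum: "(\<And>i. i \<in> I \<Longrightarrow> val_gt v (f i) \<gamma>) \<Longrightarrow> val_gt v (sum f I) \<gamma>"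
  by (induction I rule: infinite_finite_induct) (auto intro: val_gt_add)

lemma val_ge_mult: "val_ge v x a \<Longrightarrow> val_ge v y b \<Longrightarrow> val_ge v (x * y) (a + b)"
  by (cases "x = 0"; cases "y = 0") (auto simp: v_mult intro: add_mono)

text \<open>If \<open>x + y\<close> had larger value than \<open>x\<close>, then so would
  \<open>x = (x + y) - y\<close>.\<close>

lemma v_add_eq: "x \<noteq> 0 \<Longrightarrow> val_gt v y (v x) \<Longrightarrow> x + y \<noteq> 0 \<and> v (x + y) = v x"
proof -
  assume *: "x \<noteq> 0" "val_gt v y (v x)"
  have "\<not> val_gt v (x + y) (v x)"
    using val_gt_diff[of "x + y" "v x" y] * by auto
  moreover have "val_ge v (x + y) (v x)"
    using * by (intro val_ge_add) (auto simp: val_ge_def val_gt_def)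
  ultimately show ?thesis by (auto simp: val_ge_def val_gt_def)
qed

lemma O_iff: "x \<in> \<O> \<longleftrightarrow> x = 0 \<or> 0 \<le> v x"
  by (auto simp: val_ring_def val_ge_def)

lemma O_subring: "subring_set \<O>"
  using val_ge_mult[of _ 0 _ 0] by unfold_locales (auto simp: val_ring_def val_ge_diff)

sublocale O: subring_set \<O> by (rule O_subring)

lemma divide_in_O_iff: "x \<noteq> 0 \<Longrightarrow> y / x \<in> \<O> \<longleftrightarrow> val_ge v y (v x)"
  by (cases "y = 0") (auto simp: O_iff v_divide val_ge_def)

end

section \<open>Totally ramified extensions of prime degree\<close>

lemma gal_hom:
  fixes K :: "'l::field set"
  assumes "\<sigma> \<in> gal K"
  shows gal_add: "\<sigma> (x + y) = \<sigma> x + \<sigma> y" and gal_mult: "\<sigma> (x * y) = \<sigma> x * \<sigma> y"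
    and gal_one: "\<sigma> 1 = 1" and gal_inj: "\<sigma> x = \<sigma> y \<longleftrightarrow> x = y" and gal_fix: "a \<in> K \<Longrightarrow> \<sigma> a = a"
proof -
  have h: "\<sigma> \<in> ring_hom ring_of_type_algebra ring_of_type_algebra" "bij \<sigma>" "\<forall>x\<in>K. \<sigma> x = x"
    using assms by (auto simp: gal_def ring_iso_def ring_of_type_algebra_def)
  show "\<sigma> (x + y) = \<sigma> x + \<sigma> y" "\<sigma> (x * y) = \<sigma> x * \<sigma> y" "\<sigma> 1 = 1"
    using ring_hom_add[OF h(1), of x y] ring_hom_mult[OF h(1), of x y] ring_hom_one[OF h(1)]
    by (auto simp: ring_of_type_algebra_def)
  show "\<sigma> x = \<sigma> y \<longleftrightarrow> x = y" using h(2) by (simp add: bij_def inj_eq)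
  show "a \<in> K \<Longrightarrow> \<sigma> a = a" using h(3) by simp
qed

lemma gal_zero [simp]: "\<sigma> \<in> gal K \<Longrightarrow> \<sigma> 0 = 0"
  using gal_add[of \<sigma> K 0 0] by (metis add_cancel_right_left add_0_left)

lemma gal_eq_0_iff: "\<sigma> \<in> gal K \<Longrightarrow> \<sigma> x = 0 \<longleftrightarrow> x = 0"
  using gal_inj[of \<sigma> K x 0] by simp

lemma gal_minus: "\<sigma> \<in> gal K \<Longrightarrow> \<sigma> (- x) = - \<sigma> x"
  using gal_add[of \<sigma> K x "- x"] by (simp add: eq_neg_iff_add_eq_0 add.commute)

lemma gal_diff: "\<sigma> \<in> gal K \<Longrightarrow> \<sigma> (x - y) = \<sigma> x - \<sigma> y"
  using gal_add[of \<sigma> K x "- y"] by (simp add: gal_minus)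

lemma gal_power: "\<sigma> \<in> gal K \<Longrightarrow> \<sigma> (x ^ n) = \<sigma> x ^ n"
  by (induction n) (auto simp: gal_one gal_mult)

lemma gal_divide: "\<sigma> \<in> gal K \<Longrightarrow> \<sigma> (x / y) = \<sigma> x / \<sigma> y"
  using gal_mult[of \<sigma> K "x / y" y] by (cases "y = 0") (auto simp: gal_eq_0_iff field_simps)

lemma gal_sum: "\<sigma> \<in> gal K \<Longrightarrow> \<sigma> (sum f I) = (\<Sum>i\<in>I. \<sigma> (f i))"
  by (induction I rule: infinite_finite_induct) (auto simp: gal_add)

lemma gal_funpow: "\<sigma> \<in> gal K \<Longrightarrow> \<sigma> ^^ n \<in> gal K"
proof (induction n)
  case 0
  then show ?case by (auto simp: gal_def ring_iso_def ring_hom_def ring_of_type_algebra_def id_def[symmetric])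
next
  case (Suc n)
  then show ?case using bij_comp[of "\<sigma> ^^ n" \<sigma>]
    by (auto simp: gal_def ring_iso_def ring_hom_def ring_of_type_algebra_def comp_def)
qed

lemma gal_poly:
  assumes "\<sigma> \<in> gal K" "p \<in> polys_over K"
  shows "\<sigma> (poly p x) = poly p (\<sigma> x)"
  using assms by (auto simp: poly_altdef gal_sum gal_mult gal_power gal_fix polys_over_def)

lemma map_poly_gal_prod:
  assumes \<sigma>: "\<sigma> \<in> gal K"
  shows "map_poly \<sigma> (\<Prod>i\<in>I. [:- r i, 1:]) = (\<Prod>i\<in>I. [:- \<sigma> (r i), 1:])"
proof -
  have c: "coeff (map_poly \<sigma> p) n = \<sigma> (coeff p n)" for p n
    using \<sigma> by (simp add: coeff_map_poly)
  have m: "map_poly \<sigma> (p * r) = map_poly \<sigma> p * map_poly \<sigma> r" for p r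
    using \<sigma> by (intro poly_eqI) (simp add: c coeff_mult gal_sum gal_mult)
  have l: "map_poly \<sigma> [:- a, 1:] = [:- \<sigma> a, 1:]" for a
    using \<sigma> by (intro poly_eqI) (auto simp: c coeff_pCons gal_minus gal_one split: nat.splits)
  have "map_poly \<sigma> 1 = 1"
    using \<sigma> by (intro poly_eqI) (auto simp: c coeff_1 gal_one)
  then show ?thesis
    by (induction I rule: infinite_finite_induct) (auto simp: m l simp del: mult_pCons_left)
qed

lemma subring_set_if_subring:
  fixes S :: "'l::field set"
  assumes "subring S ring_of_type_algebra" shows "subring_set S"
proof -
  interpret R: ring "ring_of_type_algebra :: 'l ring" by (rule ring_from_type_algebra)
  note E = subringE[OF assms]
  have m: "- a \<in> S" if "a \<in> S" for a
  proof -
    have "\<ominus>\<^bsub>ring_of_type_algebra\<^esub> a + a = 0"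
      using R.l_neg[of a] by (simp add: ring_of_type_algebra_def)
    then have "\<ominus>\<^bsub>ring_of_type_algebra\<^esub> a = - a" by (simp add: eq_neg_iff_add_eq_0)
    then show ?thesis using E(5)[OF that] by simp
  qed
  show ?thesis
  proof
    fix a b assume "a \<in> S" "b \<in> S"
    then show "a - b \<in> S" using E(7)[of a "- b"] m[of b] by (simp add: ring_of_type_algebra_def)
  qed (use E in \<open>auto simp: ring_of_type_algebra_def\<close>)
qed

locale totally_ramified = valued_field v
  for v :: "'l::field \<Rightarrow> 'g::linordered_ab_group_add" +
  fixes K :: "'l set" and q :: nat
  assumes subfield_K: "subfield K ring_of_type_algebra"
    and dim_K: "ring.dimension ring_of_type_algebra q K (UNIV :: 'l set)"
    and prime_q: "prime q"
    and index_q: "value_index K v = q"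
begin

abbreviation "\<Gamma> \<equiv> value_group K v"

lemma K_subring: "subring_set K"
  by (rule subring_set_if_subring[OF subfieldE(1)[OF subfield_K]])

sublocale K: subring_set K by (rule K_subring)

lemma K_inverse:
  assumes "a \<in> K" shows "inverse a \<in> K"
proof (cases "a = 0")
  case False
  interpret R: field "ring_of_type_algebra :: 'l ring" by (rule field_from_type_algebra)
  have "a \<in> K - {\<zero>\<^bsub>ring_of_type_algebra\<^esub>}" using assms False by simp
  note * = R.subfield_m_inv[OF subfield_K this]
  then have "inv\<^bsub>ring_of_type_algebra\<^esub> a = inverse a" using inverse_unique[of a] by simp
  then show ?thesis using *(1) by simp
qed (use assms in simp)

lemma K_divide: "a \<in> K \<Longrightarrow> b \<in> K \<Longrightarrow> a / b \<in> K"
  by (simp add: divide_inverse K.mult_in K_inverse)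

section \<open>Values inside and outside the value group of \<open>K\<close>\<close>

lemma Gamma_iff: "\<gamma> \<in> \<Gamma> \<longleftrightarrow> (\<exists>a\<in>K. a \<noteq> 0 \<and> \<gamma> = v a)"
  by (auto simp: value_group_def)

lemma Gamma_v: "a \<in> K \<Longrightarrow> a \<noteq> 0 \<Longrightarrow> v a \<in> \<Gamma>"
  by (auto simp: value_group_def)

lemma Gamma_add: "\<gamma> \<in> \<Gamma> \<Longrightarrow> \<delta> \<in> \<Gamma> \<Longrightarrow> \<gamma> + \<delta> \<in> \<Gamma>"
  unfolding Gamma_iff by (metis K.mult_in no_zero_divisors v_mult)

lemma Gamma_minus: "\<gamma> \<in> \<Gamma> \<Longrightarrow> - \<gamma> \<in> \<Gamma>"
  unfolding Gamma_iff by (metis K_inverse inverse_nonzero_iff_nonzero v_inverse)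

lemma Gamma_0: "0 \<in> \<Gamma>"
  unfolding Gamma_iff using K.one_in by (intro bexI[of _ 1]) auto

lemma Gamma_diff: "\<gamma> \<in> \<Gamma> \<Longrightarrow> \<delta> \<in> \<Gamma> \<Longrightarrow> \<gamma> - \<delta> \<in> \<Gamma>"
  using Gamma_add[of \<gamma> "- \<delta>"] Gamma_minus by simp

lemma Gamma_add_iff: "\<delta> \<in> \<Gamma> \<Longrightarrow> \<gamma> + \<delta> \<in> \<Gamma> \<longleftrightarrow> \<gamma> \<in> \<Gamma>"
  using Gamma_diff[of "\<gamma> + \<delta>" \<delta>] Gamma_add by auto

lemma Gamma_sum: "(\<And>i. i \<in> I \<Longrightarrow> f i \<in> \<Gamma>) \<Longrightarrow> sum f I \<in> \<Gamma>"
  by (induction I rule: infinite_finite_induct) (auto intro: Gamma_0 Gamma_add)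

lemma Gamma_power: "x \<noteq> 0 \<Longrightarrow> v x \<in> \<Gamma> \<Longrightarrow> v (x ^ n) \<in> \<Gamma>"
  by (induction n) (auto intro: Gamma_0 Gamma_add simp: v_mult)

text \<open>Nonvanishing is included because \<open>v 0\<close> is an arbitrary element. These
  elements take the place of a uniformizer: each of them generates \<open>L\<close> over
  \<open>K\<close>, and its powers represent the cosets of \<Gamma>.\<close>

definition outside :: "'l \<Rightarrow> bool" where
  "outside x \<longleftrightarrow> x \<noteq> 0 \<and> v x \<notin> \<Gamma>"

lemma q_ge_2: "2 \<le> q" and q_pos: "0 < q"
  using prime_ge_2_nat[OF prime_q] by simp_all

text \<open>Otherwise all translates of \<Gamma> coincide, although the index is at least 2.\<close>

lemma ex_outside: "\<exists>t. outside t"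
proof (rule ccontr)
  assume "\<not> ?thesis"
  then have "value_group UNIV v = \<Gamma>"
    by (auto simp: outside_def value_group_def)
  moreover have "(+) \<gamma> ` \<Gamma> = \<Gamma>" if "\<gamma> \<in> \<Gamma>" for \<gamma>
  proof (intro equalityI subsetI)
    fix \<delta> assume "\<delta> \<in> \<Gamma>"
    then show "\<delta> \<in> (+) \<gamma> ` \<Gamma>" using Gamma_diff[OF _ that] by (intro image_eqI[of _ _ "\<delta> - \<gamma>"]) auto
  qed (use that Gamma_add in auto)
  ultimately have "(\<lambda>\<gamma>. (+) \<gamma> ` \<Gamma>) ` value_group UNIV v \<subseteq> {\<Gamma>}" by auto
  from card_mono[OF _ this] show False
    using index_q q_ge_2 by (simp add: value_index_def)
qed

text \<open>Translation by \<open>v x\<close> permutes the \<open>q\<close> cosets of \<open>vK\<close>, so the sum of a system of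
  representatives changes by \<open>q v x\<close> and by an element of \<open>vK\<close>.\<close>

lemma power_q_Gamma:
  assumes "x \<noteq> 0" shows "v (x ^ q) \<in> \<Gamma>"
proof -
  define C where "C = (\<lambda>\<gamma>. (+) \<gamma> ` \<Gamma>) ` value_group UNIV v"
  have card_C: "card C = q" using index_q by (simp add: value_index_def C_def)
  then have fin: "finite C" using q_pos card.infinite by fastforce
  define T where "T = (\<lambda>c. (+) (v x) ` c)"
  have T_C: "T c \<in> C" if c: "c \<in> C" for c
  proof -
    obtain y where y: "y \<noteq> 0" "c = (+) (v y) ` \<Gamma>" using c by (auto simp: C_def value_group_def)
    then have "T c = (+) (v (x * y)) ` \<Gamma>"
      using assms by (simp add: T_def image_image v_mult add.assoc)
    then show ?thesis using y assms by (auto simp: C_def value_group_def)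
  qed
  have "inj_on T C"
    unfolding T_def by (rule inj_onI) (simp add: inj_image_eq_iff)
  with T_C fin have bij: "bij_betw T C C"
    using endo_inj_surj[of C T] by (auto simp: bij_betw_def)
  define r where "r = (\<lambda>c. SOME \<gamma>. \<gamma> \<in> (c :: 'g set))"
  have r: "r c \<in> c" if c: "c \<in> C" for c
  proof -
    obtain g where "c = (+) g ` \<Gamma>" using c by (auto simp: C_def)
    then have "g \<in> c" using Gamma_0 by force
    then show ?thesis unfolding r_def by (rule someI)
  qed
  have diff: "r (T c) - r c - v x \<in> \<Gamma>" if c: "c \<in> C" for c
  proof -
    obtain g where g: "c = (+) g ` \<Gamma>" using c by (auto simp: C_def)
    obtain a b where "a \<in> \<Gamma>" "b \<in> \<Gamma>" "r c = g + a" "r (T c) = v x + (g + b)"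
      using r[OF c] r[OF T_C[OF c]] g by (auto simp: T_def)
    then show ?thesis using Gamma_diff[of b a] by (simp add: algebra_simps)
  qed
  have "(\<Sum>c\<in>C. r (T c) - r c - v x) \<in> \<Gamma>"
    using diff by (rule Gamma_sum)
  also have "(\<Sum>c\<in>C. r (T c) - r c - v x) = - (\<Sum>c\<in>C. v x)"
    using sum.reindex_bij_betw[OF bij, of r] by (simp add: sum_subtractf)
  also have "(\<Sum>c\<in>C. v x) = v (x ^ q)"
    using v_prod[of C "\<lambda>_. x"] assms card_C by simp
  finally show ?thesis using Gamma_minus by fastforce
qed

lemma bezout_q:
  assumes "\<not> q dvd n" obtains a b where "n * a = q * b + 1"
proof -
  have "n \<noteq> 0" using assms by (metis dvd_0_right)
  moreover have "gcd n q = 1"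
    using prime_imp_coprime[OF prime_q assms] by (simp add: coprime_iff_gcd_eq_1 gcd.commute)
  ultimately show ?thesis using that bezout_nat[of n q] by auto
qed

text \<open>\<open>q\<close> times the value of \<open>t\<close> lies in \<Gamma>. Inverting
  \<open>n\<close> modulo \<open>q\<close> therefore recovers the coset of \<open>v t\<close> from
  that of \<open>v (t ^ n)\<close>.\<close>

lemma outside_power:
  assumes t: "outside t" and n: "\<not> q dvd n"
  shows "outside (t ^ n)"
proof (rule ccontr)
  assume "\<not> ?thesis"
  then have *: "v (t ^ n) \<in> \<Gamma>" "t \<noteq> 0" using t by (auto simp: outside_def)
  obtain a b where ab: "n * a = q * b + 1" using bezout_q[OF n] .
  have "v ((t ^ n) ^ a) \<in> \<Gamma>" using * by (intro Gamma_power[of "t ^ n"]) auto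
  also have "(t ^ n) ^ a = t * (t ^ q) ^ b" using ab by (simp flip: power_mult)
  also have "v \<dots> = v t + v ((t ^ q) ^ b)" using *(2) by (simp add: v_mult)
  finally have "v t + v ((t ^ q) ^ b) \<in> \<Gamma>" .
  moreover have "v ((t ^ q) ^ b) \<in> \<Gamma>" using *(2) by (intro Gamma_power[OF _ power_q_Gamma]) auto
  ultimately have "v t \<in> \<Gamma>" using Gamma_add_iff by blast
  then show False using t by (simp add: outside_def)
qed

lemma outside_mult: "outside t \<Longrightarrow> x \<noteq> 0 \<Longrightarrow> v x \<in> \<Gamma> \<Longrightarrow> outside (x * t)"
  using Gamma_add_iff[of "v x" "v t"] by (auto simp: outside_def v_mult add.commute)

lemma outside_mult_K: "outside t \<Longrightarrow> a \<in> K \<Longrightarrow> a \<noteq> 0 \<Longrightarrow> outside (a * t)"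
  by (auto intro: outside_mult Gamma_v)

lemma outside_inverse: "outside t \<Longrightarrow> outside (inverse t)"
  using Gamma_minus[of "- v t"] by (auto simp: outside_def v_inverse)

lemma not_dvd_less: "0 < i \<Longrightarrow> i < q \<Longrightarrow> \<not> q dvd i"
  by (auto dest: dvd_imp_le)

lemma outside_monomial:
  "outside t \<Longrightarrow> a \<in> K \<Longrightarrow> a \<noteq> 0 \<Longrightarrow> 0 < i \<Longrightarrow> i < q \<Longrightarrow> outside (a * t ^ i)"
  by (intro outside_mult_K outside_power not_dvd_less)

text \<open>For \<open>i < j\<close>, cancelling \<open>t ^ i\<close> would give the outside element
  \<open>b * t ^ (j - i)\<close> the value of an element of \<open>K\<close>.\<close>

lemma monomial_class:
  assumes t: "outside t" and "a \<in> K" "a \<noteq> 0" "b \<in> K" "b \<noteq> 0" "i < q" "j < q"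
    and eq: "v (a * t ^ i) = v (b * t ^ j)"
  shows "i = j"
proof -
  have *: "\<not> i < j" if ab: "a \<in> K" "a \<noteq> 0" "b \<in> K" "b \<noteq> 0" "j < q" "v (a * t ^ i) = v (b * t ^ j)"
    for a b i j
  proof
    assume ij: "i < j"
    have t0: "t \<noteq> 0" using t by (simp add: outside_def)
    have "b * t ^ j = (b * t ^ (j - i)) * t ^ i" using ij by (simp flip: power_add)
    then have "v a = v (b * t ^ (j - i))" using ab t0 by (simp add: v_mult)
    moreover have "outside (b * t ^ (j - i))" using ab t ij by (intro outside_monomial) auto
    ultimately show False using Gamma_v[of a] ab by (simp add: outside_def)
  qed
  show ?thesis using *[of a b j i] *[of b a i j] assms by (metis linorder_neqE_nat)
qed

lemma v_poly:
  assumes t: "outside t" and p: "p \<in> polys_over K" "degree p < q" "p \<noteq> 0"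
  obtains i where "i \<le> degree p" "coeff p i \<noteq> 0" "poly p t \<noteq> 0" "v (poly p t) = v (coeff p i * t ^ i)"
    "\<And>j. val_ge v (coeff p j * t ^ j) (v (poly p t))"
proof -
  have t0: "t \<noteq> 0" using t by (simp add: outside_def)
  define J where "J = {i. i \<le> degree p \<and> coeff p i \<noteq> 0}"
  have J: "finite J" "J \<noteq> {}" using p(3) by (auto simp: J_def)
  define f where "f = (\<lambda>i. v (coeff p i * t ^ i))"
  obtain i where i: "i \<in> J" "\<And>j. j \<in> J \<Longrightarrow> f i \<le> f j"
    using ex_min_if_finite[of "f ` J"] J by (metis (no_types, lifting) arg_min_least arg_min_if_finite(1))
  \<comment> \<open>Strictness comes from \<open>monomial_class\<close>, which is where the
    exponents must stay below \<open>q\<close>; it is what prevents cancellation of the dominant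
    term.\<close>
  have gt: "val_gt v (coeff p j * t ^ j) (f i)" if "j \<noteq> i" "j \<le> degree p" for j
  proof (cases "coeff p j = 0")
    case False
    then have "j \<in> J" using that by (simp add: J_def)
    moreover have "f i \<noteq> f j"
      using monomial_class[OF t, of "coeff p i" "coeff p j" i j] i(1) False that p
      by (auto simp: f_def J_def polys_over_def)
    ultimately have "f i < f j" using i(2)[of j] by simp
    then show ?thesis using False t0 by (simp add: f_def)
  qed simp
  have i0: "coeff p i \<noteq> 0" "i \<le> degree p" using i by (auto simp: J_def)
  have "poly p t = coeff p i * t ^ i + (\<Sum>j\<in>{..degree p} - {i}. coeff p j * t ^ j)"
    unfolding poly_altdef using i0 by (subst sum.remove[of _ i]) auto
  moreover have "val_gt v (\<Sum>j\<in>{..degree p} - {i}. coeff p j * t ^ j) (f i)"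
    by (intro val_gt_sum gt) auto
  ultimately have v: "poly p t \<noteq> 0 \<and> v (poly p t) = f i"
    using v_add_eq[of "coeff p i * t ^ i"] i0 t0 by (auto simp: f_def)
  have "val_ge v (coeff p j * t ^ j) (v (poly p t))" for j
  proof (cases "j \<in> J")
    case True
    then show ?thesis using i(2)[of j] v by (auto simp: val_ge_def f_def)
  next
    case False
    then have "coeff p j = 0" by (auto simp: J_def coeff_eq_0)
    then show ?thesis by simp
  qed
  with v i0 show ?thesis by (intro that[of i]) (auto simp: f_def)
qed

text \<open>Terms never cancel, so a lower bound for the value can be tested coefficient by
  coefficient. With \<open>val_ge\<close> this covers zero coefficients and the zero polynomial
  too.\<close>

lemma val_ge_poly_iff:
  assumes "outside t" "p \<in> polys_over K" "degree p < q"
  shows "val_ge v (poly p t) \<gamma> \<longleftrightarrow> (\<forall>j. val_ge v (coeff p j * t ^ j) \<gamma>)"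
proof
  assume *: "val_ge v (poly p t) \<gamma>"
  show "\<forall>j. val_ge v (coeff p j * t ^ j) \<gamma>"
  proof (cases "p = 0")
    case False
    obtain i where "poly p t \<noteq> 0" "\<And>j. val_ge v (coeff p j * t ^ j) (v (poly p t))"
      using v_poly[OF assms False] by metis
    then show ?thesis using * by (auto simp: val_ge_def intro: order_trans)
  qed simp
qed (auto simp: poly_altdef intro: val_ge_sum)

lemma poly_eq_0_imp: 
  assumes "outside t" "p \<in> polys_over K" "degree p < q" "poly p t = 0" shows "p = 0"
  using v_poly[OF assms(1-3)] assms(4) by metis

text \<open>The list is reversed so that \<open>t ^ n\<close> is added at the head, as in the
  recursion of \<open>Span\<close>. Vanishing of all coefficients from \<open>n\<close> on replaces
  a degree bound because \<open>n = 0\<close> must describe the zero space.\<close>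

lemma Span_powers:
  "ring.Span ring_of_type_algebra K (map (\<lambda>i. t ^ i) (rev [0..<n])) =
     {poly p t | p. p \<in> polys_over K \<and> (\<forall>i\<ge>n. coeff p i = 0)}"
proof -
  interpret R: ring "ring_of_type_algebra :: 'l ring" by (rule ring_from_type_algebra)
  show ?thesis
  proof (induction n)
    case 0
    have "{poly p t | p. p \<in> polys_over K \<and> (\<forall>i\<ge>0. coeff p i = 0)} = {0}"
      using K.zero_polys_over by (auto simp: poly_eq_iff[symmetric] intro!: exI[of _ 0]) (metis coeff_0 poly_0 poly_eqI)
    moreover have "R.Span K (map (\<lambda>i. t ^ i) (rev [0..<0])) = {\<zero>\<^bsub>ring_of_type_algebra\<^esub>}" by simp
    ultimately show ?case unfolding ring_of_type_algebra_def by simp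
  next
    case (Suc n)
    have "R.Span K (map (\<lambda>i. t ^ i) (rev [0..<Suc n])) =
       {a * t ^ n + y | a y. a \<in> K \<and> y \<in> {poly p t | p. p \<in> polys_over K \<and> (\<forall>i\<ge>n. coeff p i = 0)}}"
    proof -
      have "R.line_extension K a E = {k * a + y | k y. k \<in> K \<and> y \<in> E}" for a and E :: "'l set"
        unfolding R.line_extension_def unfolding set_add_defs set_mult_def r_coset_def ring_of_type_algebra_def
        by (simp, blast)
      then show ?thesis using Suc by simp
    qed
    also have "\<dots> = {poly p t | p. p \<in> polys_over K \<and> (\<forall>i\<ge>Suc n. coeff p i = 0)}"
    proof (intro equalityI subsetI)
      fix x assume "x \<in> {a * t ^ n + y | a y. a \<in> K \<and> y \<in> {poly p t | p. p \<in> polys_over K \<and> (\<forall>i\<ge>n. coeff p i = 0)}}"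
      then obtain a p where "a \<in> K" "p \<in> polys_over K" "\<forall>i\<ge>n. coeff p i = 0" "x = a * t ^ n + poly p t" by auto
      then show "x \<in> {poly p t | p. p \<in> polys_over K \<and> (\<forall>i\<ge>Suc n. coeff p i = 0)}"
        by (auto intro!: exI[of _ "monom a n + p"] K.add_polys_over K.monom_polys_over simp: poly_monom)
    next
      fix x assume "x \<in> {poly p t | p. p \<in> polys_over K \<and> (\<forall>i\<ge>Suc n. coeff p i = 0)}"
      then obtain p where p: "p \<in> polys_over K" "\<forall>i\<ge>Suc n. coeff p i = 0" "x = poly p t" by auto
      define r where "r = p - monom (coeff p n) n"
      have "r \<in> polys_over K" unfolding r_def using p
        by (intro K.diff_polys_over K.monom_polys_over) (auto simp: polys_over_def)
      moreover have "\<forall>i\<ge>n. coeff r i = 0" using p(2) by (auto simp: r_def Suc_le_eq)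
      moreover have "x = coeff p n * t ^ n + poly r t" using p by (simp add: r_def poly_monom)
      moreover have "coeff p n \<in> K" using p by (auto simp: polys_over_def)
      ultimately show "x \<in> {a * t ^ n + y | a y. a \<in> K \<and> y \<in> {poly p t | p. p \<in> polys_over K \<and> (\<forall>i\<ge>n. coeff p i = 0)}}"
        by blast
    qed
    finally show ?case .
  qed
qed

lemma ex_poly:
  assumes t: "outside t"
  obtains p where "p \<in> polys_over K" "degree p < q" "poly p t = y"
proof -
  interpret R: ring "ring_of_type_algebra :: 'l ring" by (rule ring_from_type_algebra)
  have ind: "R.independent K (map (\<lambda>i. t ^ i) (rev [0..<n]))" if "n \<le> q" for n
    using that
  proof (induction n)
    case (Suc n)
    have "t ^ n \<notin> R.Span K (map (\<lambda>i. t ^ i) (rev [0..<n]))"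
    proof
      assume "t ^ n \<in> R.Span K (map (\<lambda>i. t ^ i) (rev [0..<n]))"
      then obtain p where p: "p \<in> polys_over K" "\<forall>i\<ge>n. coeff p i = 0" "t ^ n = poly p t"
        unfolding Span_powers by auto
      define r where "r = monom 1 n - p"
      have "r \<in> polys_over K" unfolding r_def
        by (intro K.diff_polys_over K.monom_polys_over K.one_in p)
      moreover have "degree r \<le> n" using p(2) by (intro degree_le) (auto simp: r_def)
      moreover have "poly r t = 0" using p(3) by (simp add: r_def poly_monom)
      ultimately have "r = 0" using poly_eq_0_imp[OF t] Suc.prems by simp
      moreover have "coeff r n = 1" using p(2) by (simp add: r_def)
      ultimately show False by simp
    qed
    then show ?case using R.li_Cons[of "t ^ n" K] Suc by (simp add: ring_of_type_algebra_def)
  qed simp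
  have "R.Span K (map (\<lambda>i. t ^ i) (rev [0..<q])) = UNIV"
    using R.independent_length_eq_dimension[OF subfield_K dim_K ind[OF order_refl]] by simp
  then have "y \<in> {poly p t | p. p \<in> polys_over K \<and> (\<forall>i\<ge>q. coeff p i = 0)}"
    unfolding Span_powers by simp
  then obtain p where p: "p \<in> polys_over K" "\<forall>i\<ge>q. coeff p i = 0" "poly p t = y" by auto
  moreover have "degree p < q"
    using p(2) q_pos by (metis degree_0 leading_coeff_0_iff not_le)
  ultimately show ?thesis using that by blast
qed

text \<open>The constant coefficient of the expansion of \<open>y\<close> in an outside element
  serves as \<open>a\<close>: all remaining monomials are outside, and the dominant one decides the
  value.\<close>

lemma approx:
  obtains a where "a \<in> K" "y = a \<or> outside (y - a)"
proof -
  obtain t where t: "outside t" using ex_outside by blast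
  obtain p where p: "p \<in> polys_over K" "degree p < q" "poly p t = y" using ex_poly[OF t] .
  define r where "r = p - [:coeff p 0:]"
  have a: "coeff p 0 \<in> K" using p by (auto simp: polys_over_def)
  have r: "r \<in> polys_over K"
    unfolding r_def by (intro K.diff_polys_over p) (simp add: K.pCons_polys_over a K.zero_polys_over)
  have deg: "degree r < q" unfolding r_def using p(2) q_pos by (intro degree_diff_less) auto
  have y: "y - coeff p 0 = poly r t" using p(3) by (simp add: r_def)
  show ?thesis
  proof (cases "r = 0")
    case True
    then show ?thesis using that[OF a] y by simp
  next
    case False
    obtain i where i: "i \<le> degree r" "coeff r i \<noteq> 0" "poly r t \<noteq> 0" "v (poly r t) = v (coeff r i * t ^ i)"
      using v_poly[OF t r deg False] by metis
    have "i \<noteq> 0" using i(2) unfolding r_def by (intro notI) simp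
    then have "outside (coeff r i * t ^ i)"
      using i deg r by (intro outside_monomial t) (auto simp: polys_over_def)
    then have "outside (poly r t)" using i by (simp add: outside_def)
    then show ?thesis using that[OF a] y by simp
  qed
qed

text \<open>The values of \<open>y - a\<close> and \<open>a\<close> differ because only the latter
  is in \<Gamma>. If \<open>y - a\<close> had the smaller one, then \<open>y\<close> would share it,
  against the assumption on \<open>v y\<close>.\<close>

lemma approx_Gamma:
  assumes "y \<noteq> 0" "y \<notin> K" "v y \<in> \<Gamma>"
  obtains a where "a \<in> K" "a \<noteq> 0" "v a = v y" "outside (y - a)" "v y < v (y - a)"
proof -
  obtain a where a: "a \<in> K" "outside (y - a)" using approx[of y] assms(2) by metis
  have a0: "a \<noteq> 0" using a assms by (auto simp: outside_def)
  have z: "y - a \<noteq> 0" "v (y - a) \<noteq> v a" using a a0 Gamma_v[of a] by (auto simp: outside_def)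
  have "\<not> v (y - a) < v a"
    using v_add_eq[of "y - a" a] z a0 a assms(3) by (auto simp: outside_def)
  then have "v a < v (y - a)" using z by simp
  moreover from this have "v a = v y" using v_add_eq[of a "y - a"] a0 z by simp
  ultimately show ?thesis using that a a0 by metis
qed

text \<open>This stands in for the argument that an extension of prime degree has no intermediate
  fields: \<open>F\<close> contains an outside element \<open>y - a\<close>, and polynomials in it
  already exhaust \<open>L\<close>.\<close>

lemma subfield_outside:
  assumes F: "subring_set F" "K \<subseteq> F" and y: "y \<in> F" "y \<notin> K"
  shows "F = UNIV"
proof -
  interpret F: subring_set F by fact
  obtain a where a: "a \<in> K" "outside (y - a)" using approx[of y] y(2) by metis
  have "x \<in> F" for x
  proof -
    obtain p where p: "p \<in> polys_over K" "degree p < q" "poly p (y - a) = x" using ex_poly[OF a(2)] .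
    then have "p \<in> polys_over F" using F by (auto simp: polys_over_def)
    then show ?thesis using F.poly_in[of p "y - a"] F.diff_in[of y a] y a F p by auto
  qed
  then show ?thesis by auto
qed

lemma generate_field_iff: "generate_field ring_of_type_algebra (K \<union> {\<eta>}) = UNIV \<longleftrightarrow> \<eta> \<notin> K"
proof -
  interpret R: field "ring_of_type_algebra :: 'l ring" by (rule field_from_type_algebra)
  let ?F = "generate_field ring_of_type_algebra (K \<union> {\<eta>})"
  have sub: "subfield ?F ring_of_type_algebra"
    by (rule R.generate_field_is_subfield) (simp add: ring_of_type_algebra_def)
  have F: "subring_set ?F" by (rule subring_set_if_subring[OF subfieldE(1)[OF sub]])
  have incl: "K \<union> {\<eta>} \<subseteq> ?F" by (auto intro: generate_field.incl)
  show ?thesis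
  proof
    assume *: "?F = UNIV"
    show "\<eta> \<notin> K"
    proof
      assume "\<eta> \<in> K"
      then have "?F \<subseteq> K"
        by (intro R.generate_field_min_subfield1 subfield_K) (auto simp: ring_of_type_algebra_def)
      then show False using * ex_outside Gamma_v by (auto simp: outside_def)
    qed
  next
    assume "\<eta> \<notin> K"
    then show "?F = UNIV" using subfield_outside[OF F] incl by auto
  qed
qed

text \<open>Expand \<open>t ^ q = poly b t\<close>. Absence of cancellation bounds the value of the
  \<open>i\<close>-th coefficient from below by that of \<open>t ^ (q - i)\<close>. If \<sigma>
  lowered the value of \<open>t\<close>, every term of the conjugate relation would have larger
  value than \<open>\<sigma> t ^ q\<close>, a contradiction.\<close>

lemma gal_v_ge:
  assumes \<sigma>: "\<sigma> \<in> gal K" and t: "outside t" shows "v t \<le> v (\<sigma> t)"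
proof (rule ccontr)
  assume "\<not> ?thesis"
  then have less: "v (\<sigma> t) < v t" by simp
  have t0: "t \<noteq> 0" and s0: "\<sigma> t \<noteq> 0" using t \<sigma> by (auto simp: outside_def gal_eq_0_iff)
  obtain b where b: "b \<in> polys_over K" "degree b < q" "poly b t = t ^ q" using ex_poly[OF t] .
  have "val_ge v (poly b t) (v (t ^ q))" using t0 b(3) by simp
  then have ge: "val_ge v (coeff b i * t ^ i) (v (t ^ q))" for i
    using val_ge_poly_iff[OF t b(1,2)] by blast
  have gt: "val_gt v (coeff b i * \<sigma> t ^ i) (v (\<sigma> t ^ q))" if "i \<le> degree b" for i
  proof (cases "coeff b i = 0")
    case False
    have "v (t ^ q) \<le> v (coeff b i * t ^ i)" using ge[of i] False t0 by simp
    then have "0 \<le> v (coeff b i / t ^ (q - i))"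
      using that b(2) False t0
      by (simp add: v_divide v_mult flip: power_add) (simp add: power_diff v_divide algebra_simps)
    moreover have "0 < v ((t / \<sigma> t) ^ (q - i))"
      using less t0 s0 that b(2) by (subst v_power_pos_iff) (auto simp: v_divide)
    ultimately have "0 < v (coeff b i / t ^ (q - i) * (t / \<sigma> t) ^ (q - i))"
      using False t0 s0 by (subst v_mult) (auto intro: add_nonneg_pos)
    also have "coeff b i / t ^ (q - i) * (t / \<sigma> t) ^ (q - i) = coeff b i * \<sigma> t ^ i / \<sigma> t ^ q"
      using t0 s0 that b(2) by (simp add: power_divide power_diff)
    finally show ?thesis using False s0 by (simp add: v_divide)
  qed simp
  have "val_gt v (poly b (\<sigma> t)) (v (\<sigma> t ^ q))"
    unfolding poly_altdef by (intro val_gt_sum gt) auto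
  also have "poly b (\<sigma> t) = \<sigma> t ^ q"
    using gal_poly[OF \<sigma> b(1), of t] b(3) \<sigma> by (simp add: gal_power)
  finally show False using s0 by simp
qed

text \<open>For outside elements the reverse inequality is the first one applied to the inverse. An
  element with value in \<Gamma> becomes outside after multiplication with an outside
  \<open>t\<close>.\<close>

lemma gal_v:
  assumes \<sigma>: "\<sigma> \<in> gal K" shows "v (\<sigma> y) = v y"
proof (cases "y = 0")
  case False
  have *: "v (\<sigma> t) = v t" if t: "outside t" for t
  proof (rule antisym)
    have "\<sigma> (inverse t) = inverse (\<sigma> t)" using gal_divide[OF \<sigma>, of 1 t] gal_one[OF \<sigma>] by (simp add: divide_inverse)
    then show "v (\<sigma> t) \<le> v t"
      using gal_v_ge[OF \<sigma> outside_inverse[OF t]] t \<sigma> by (auto simp: outside_def v_inverse gal_eq_0_iff)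
  qed (rule gal_v_ge[OF \<sigma> t])
  show ?thesis
  proof (cases "outside y")
    case True
    then show ?thesis by (rule *)
  next
    case out: False
    obtain t where t: "outside t" using ex_outside by blast
    have "outside (y * t)" using out False t by (intro outside_mult) (auto simp: outside_def)
    from *[OF this] *[OF t] show ?thesis
      using False t \<sigma> by (auto simp: outside_def gal_mult v_mult gal_eq_0_iff)
  qed
qed (use \<sigma> in simp)

lemma gal_val_ge: "\<sigma> \<in> gal K \<Longrightarrow> val_ge v (\<sigma> y) \<gamma> \<longleftrightarrow> val_ge v y \<gamma>"
  by (simp add: val_ge_def gal_v gal_eq_0_iff)

lemma gal_O: "\<sigma> \<in> gal K \<Longrightarrow> \<sigma> y \<in> \<O> \<longleftrightarrow> y \<in> \<O>"
  by (simp add: O_iff gal_v gal_eq_0_iff)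

text \<open>The fixed set of \<sigma> is a ring containing \<open>K\<close>, so it is
  \<open>K\<close> or everything. Hence a single nontrivial automorphism recognizes
  \<open>K\<close>.\<close>

lemma gal_fixed_imp:
  assumes \<sigma>: "\<sigma> \<in> gal K" "\<sigma> \<noteq> id" and y: "\<sigma> y = y" shows "y \<in> K"
proof (rule ccontr)
  assume "y \<notin> K"
  have "{x. \<sigma> x = x} = UNIV"
  proof (rule subfield_outside[OF _ _ _ \<open>y \<notin> K\<close>])
    show "subring_set {x. \<sigma> x = x}"
      using \<sigma>(1) by unfold_locales (auto simp: gal_one gal_diff gal_mult)
  qed (use \<sigma> y in \<open>auto simp: gal_fix\<close>)
  then show False using \<sigma>(2) by (auto simp: fun_eq_iff)
qed

text \<open>\<sigma> permutes the factors cyclically, so the coefficients are fixed by \<sigma>. The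
  roots need not be distinct.\<close>

lemma orbit_poly_over:
  assumes \<sigma>: "\<sigma> \<in> gal K" "\<sigma> \<noteq> id" and n: "(\<sigma> ^^ n) y = y" "0 < n"
  shows "(\<Prod>i<n. [:- (\<sigma> ^^ i) y, 1:]) \<in> polys_over K"
proof -
  let ?P = "\<Prod>i<n. [:- (\<sigma> ^^ i) y, 1:]"
  obtain m where m: "n = Suc m" using n(2) by (cases n) auto
  have "map_poly \<sigma> ?P = (\<Prod>i<n. [:- (\<sigma> ^^ Suc i) y, 1:])"
    using map_poly_gal_prod[OF \<sigma>(1)] by simp
  also have "\<dots> = (\<Prod>i<m. [:- (\<sigma> ^^ Suc i) y, 1:]) * [:- y, 1:]"
    using n(1) unfolding m prod.lessThan_Suc by simp
  also have "\<dots> = ?P"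
    unfolding m prod.lessThan_Suc_shift by (simp only: mult.commute funpow.simps(1) id_apply)
  finally have *: "map_poly \<sigma> ?P = ?P" .
  have "\<sigma> (coeff ?P i) = coeff ?P i" for i
    using arg_cong[OF *, of "\<lambda>p. coeff p i"] \<sigma>(1) by (simp add: coeff_map_poly)
  then show ?thesis using gal_fixed_imp[OF \<sigma>] by (simp add: polys_over_def)
qed

lemma degree_orbit_poly: "degree (\<Prod>i<n. [:- f i, 1:]) = n"
  "lead_coeff (\<Prod>i<n. [:- f i, 1:] :: 'l poly) = 1"
  by (subst degree_prod_eq_sum_degree) (auto simp: lead_coeff_prod)

text \<open>The iterates of an outside \<open>t\<close> are roots of one polynomial of degree at
  most \<open>q\<close>, so \<open>t\<close> has some period \<open>n \<le> q\<close>. Its orbit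
  polynomial lies over \<open>K\<close> and vanishes at \<open>t\<close>, which is impossible for
  \<open>n < q\<close>. Since \<open>t\<close> generates \<open>L\<close>, the period of
  \<open>t\<close> is one for every element.\<close>

lemma gal_order:
  assumes \<sigma>: "\<sigma> \<in> gal K" "\<sigma> \<noteq> id"
  shows "\<sigma> ^^ q = id"
proof -
  obtain t where t: "outside t" using ex_outside by blast
  obtain b where b: "b \<in> polys_over K" "degree b < q" "poly b t = t ^ q" using ex_poly[OF t] .
  define m where "m = monom 1 q - b"
  have m: "m \<in> polys_over K" unfolding m_def by (intro K.diff_polys_over K.monom_polys_over K.one_in b)
  have "coeff m q = 1" using b(2) by (simp add: m_def coeff_eq_0)
  then have m0: "m \<noteq> 0" by auto
  have deg: "degree m \<le> q" unfolding m_def using b(2) by (intro degree_diff_le) (auto simp: degree_monom_le)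
  have root: "poly m ((\<sigma> ^^ i) t) = 0" for i
    using gal_poly[OF gal_funpow[OF \<sigma>(1), of i] m, of t] b(3) gal_funpow[OF \<sigma>(1), of i]
    by (simp add: m_def poly_monom)
  have "\<not> inj_on (\<lambda>i. (\<sigma> ^^ i) t) {..q}"
  proof
    assume inj: "inj_on (\<lambda>i. (\<sigma> ^^ i) t) {..q}"
    have "card {..q} \<le> card {x. poly m x = 0}"
      using root by (intro card_inj_on_le[OF inj]) (auto simp: poly_roots_finite m0)
    also have "\<dots> \<le> degree m" using card_poly_roots_bound[OF m0] .
    finally show False using deg by simp
  qed
  then obtain i j where ij: "i < j" "j \<le> q" "(\<sigma> ^^ i) t = (\<sigma> ^^ j) t"
    unfolding inj_on_def by (metis atMost_iff linorder_neqE_nat)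
  define n where "n = j - i"
  have "(\<sigma> ^^ i) ((\<sigma> ^^ n) t) = (\<sigma> ^^ i) t"
    using ij by (simp add: n_def flip: comp_apply[of "\<sigma> ^^ i"] funpow_add)
  then have "(\<sigma> ^^ n) t = t" using gal_inj[OF gal_funpow[OF \<sigma>(1), of i]] by blast
  then have n: "(\<sigma> ^^ n) t = t" "0 < n" "n \<le> q"
    using ij by (auto simp: n_def)
  let ?P = "\<Prod>i<n. [:- (\<sigma> ^^ i) t, 1:]"
  have "poly ?P t = 0" using n(2) by (auto simp: poly_prod intro!: prod_zero bexI[of _ 0])
  moreover have "?P \<noteq> 0" by (auto simp: prod_zero_iff)
  ultimately have "\<not> n < q"
    using poly_eq_0_imp[OF t orbit_poly_over[OF \<sigma> n(1,2)]] by (auto simp: degree_orbit_poly)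
  then have q: "(\<sigma> ^^ q) t = t" using n by simp
  show ?thesis
  proof
    fix y
    obtain p where p: "p \<in> polys_over K" "degree p < q" "poly p t = y" using ex_poly[OF t] .
    show "(\<sigma> ^^ q) y = id y"
      using gal_poly[OF gal_funpow[OF \<sigma>(1), of q] p(1), of t] p(3) q by simp
  qed
qed

end

section \<open>Ideals of the valuation ring\<close>

context valued_field
begin

text \<open>Of two elements of \<open>L\<close>, one is an \<O>-multiple of the other. Therefore
  sums in products and powers of ideals collapse to single terms.\<close>

lemma dominating:
  obtains z a b where "z \<in> {x, y}" "a \<in> \<O>" "b \<in> \<O>" "x = a * z" "y = b * z"
proof (cases "y \<noteq> 0 \<and> (x = 0 \<or> v y \<le> v x)")
  case True
  then show ?thesis using that[of y "x / y" 1] by (auto simp: divide_in_O_iff O.one_in val_ge_def)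
next
  case False
  show ?thesis
  proof (cases "x = 0")
    case True
    then show ?thesis using False that[of 0 1 1] O.one_in by simp
  next
    case x0: False
    then have "y / x \<in> \<O>" using False by (auto simp: divide_in_O_iff val_ge_def)
    then show ?thesis using x0 that[of x 1 "y / x"] O.one_in by simp
  qed
qed

definition O_ideal :: "'l set \<Rightarrow> bool" where
  "O_ideal I \<longleftrightarrow> I \<subseteq> \<O> \<and> 0 \<in> I \<and> (\<forall>x\<in>I. \<forall>y\<in>I. x + y \<in> I) \<and> (\<forall>r\<in>\<O>. \<forall>x\<in>I. r * x \<in> I)"

lemma O_idealD:
  assumes "O_ideal I"
  shows "x \<in> I \<Longrightarrow> x \<in> \<O>" "0 \<in> I" "x \<in> I \<Longrightarrow> y \<in> I \<Longrightarrow> x + y \<in> I" "r \<in> \<O> \<Longrightarrow> x \<in> I \<Longrightarrow> r * x \<in> I"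
    "x \<in> I \<Longrightarrow> - x \<in> I" "x \<in> I \<Longrightarrow> y \<in> I \<Longrightarrow> x - y \<in> I"
proof -
  show 1: "x \<in> I \<Longrightarrow> x \<in> \<O>" "0 \<in> I" "x \<in> I \<Longrightarrow> y \<in> I \<Longrightarrow> x + y \<in> I" "r \<in> \<O> \<Longrightarrow> x \<in> I \<Longrightarrow> r * x \<in> I" for x y r
    using assms by (auto simp: O_ideal_def)
  show 2: "x \<in> I \<Longrightarrow> - x \<in> I" for x using 1(4)[of "- 1" x] O.minus_in[OF O.one_in] by simp
  show "x \<in> I \<Longrightarrow> y \<in> I \<Longrightarrow> x - y \<in> I" using 1(3)[of x "- y"] 2[of y] by simp
qed

lemma O_idealI_dominating:
  assumes "I \<subseteq> \<O>" "0 \<in> I" "\<And>r x. r \<in> \<O> \<Longrightarrow> x \<in> I \<Longrightarrow> r * x \<in> I"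
  shows "O_ideal I"
proof -
  have "x + y \<in> I" if "x \<in> I" "y \<in> I" for x y
  proof -
    obtain z a b where "z \<in> {x, y}" "a \<in> \<O>" "b \<in> \<O>" "x = a * z" "y = b * z" using dominating .
    then show ?thesis using that assms(3)[of "a + b" z] by (auto simp: O.add_in algebra_simps)
  qed
  then show ?thesis using assms by (auto simp: O_ideal_def)
qed

lemma ideal_if_O_ideal: "O_ideal I \<Longrightarrow> ideal I (OL v)"
  by (rule ideal_set_ring[OF O_subring]) (auto simp: O_ideal_def)

lemma O_ideal_iff: "O_ideal I \<longleftrightarrow> ideal I (OL v)"
proof
  assume "ideal I (OL v)"
  then interpret ideal I "OL v" .
  show "O_ideal I"
    using a_subset I_l_closed additive_subgroup.a_closed[OF additive_subgroup_axioms]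
      additive_subgroup.zero_closed[OF additive_subgroup_axioms] by (auto simp: O_ideal_def)
qed (rule ideal_if_O_ideal)

lemma O_ideal_O: "O_ideal \<O>"
  by (auto simp: O_ideal_def O.zero_in O.add_in O.mult_in)

lemma O_ideal_scale: "a \<in> \<O> \<Longrightarrow> O_ideal I \<Longrightarrow> O_ideal (scale_ideal a I)"
proof (rule O_idealI_dominating)
  assume a: "a \<in> \<O>" and I: "O_ideal I"
  show "scale_ideal a I \<subseteq> \<O>" using a O_idealD(1)[OF I] by (auto intro: O.mult_in)
  show "0 \<in> scale_ideal a I" using O_idealD(2)[OF I] by force
  fix r x assume "r \<in> \<O>" "x \<in> scale_ideal a I"
  then obtain y where "y \<in> I" "x = a * y" by auto
  then show "r * x \<in> scale_ideal a I"
    using O_idealD(4)[OF I \<open>r \<in> \<O>\<close>, of y] by (auto simp: mult.left_commute)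
qed

lemma O_ideal_mono: "O_ideal I \<Longrightarrow> x \<in> I \<Longrightarrow> x \<noteq> 0 \<Longrightarrow> val_ge v y (v x) \<Longrightarrow> y \<in> I"
  using O_idealD(4)[of I "y / x" x] by (simp add: divide_in_O_iff)

lemma O_prod_eq:
  assumes "O_ideal I" "O_ideal J"
  shows "OL_prod v I J = {x * y | x y. x \<in> I \<and> y \<in> J}"
proof -
  have "z \<in> {x * y | x y. x \<in> I \<and> y \<in> J}" if "z \<in> ideal_prod (OL v) I J" for z
    using that
  proof (induction rule: ideal_prod.induct)
    case (sum s1 s2)
    then obtain x y x' y' where *: "s1 = x * y" "s2 = x' * y'" "x \<in> I" "x' \<in> I" "y \<in> J" "y' \<in> J" by auto
    obtain z a a' where z: "z \<in> {x, x'}" "a \<in> \<O>" "a' \<in> \<O>" "x = a * z" "x' = a' * z" using dominating .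
    have "s1 + s2 = z * (a * y + a' * y')" using * z by (simp add: algebra_simps)
    moreover have "a * y + a' * y' \<in> J" using * z assms by (auto intro!: O_idealD)
    moreover have "z \<in> I" using * z by auto
    ultimately show ?case unfolding set_ring_simps by blast
  qed auto
  then show ?thesis
    by (auto simp: ideals_set_def intro: ideal_prod.prod[where R = "OL v", simplified])
qed

lemma O_ideal_powers:
  assumes I: "O_ideal I"
  shows "O_ideal {r * x ^ n | r x. r \<in> \<O> \<and> x \<in> I}"
proof (rule O_idealI_dominating)
  show "{r * x ^ n | r x. r \<in> \<O> \<and> x \<in> I} \<subseteq> \<O>"
    using O_idealD(1)[OF I] by (auto intro!: O.mult_in O.power_in)
  show "0 \<in> {r * x ^ n | r x. r \<in> \<O> \<and> x \<in> I}"
    using O_idealD(2)[OF I] O.zero_in by force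
  show "r * x \<in> {r * x ^ n | r x. r \<in> \<O> \<and> x \<in> I}" if "r \<in> \<O>" "x \<in> {r * x ^ n | r x. r \<in> \<O> \<and> x \<in> I}" for r x
  proof -
    obtain s y where "s \<in> \<O>" "y \<in> I" "x = s * y ^ n" using \<open>x \<in> _\<close> by auto
    then show ?thesis using that(1)
      by (intro CollectI exI[of _ "r * s"] exI[of _ y]) (auto simp: O.mult_in mult.assoc)
  qed
qed

text \<open>The factor \<open>r\<close> is essential: pure \<open>n\<close>-th powers are not closed
  under multiples, and for \<open>n = 0\<close> it is \<open>r\<close> that yields the whole ring.
  Sums are absorbed by a dominating element.\<close>

lemma O_power_eq:
  assumes I: "O_ideal I"
  shows "OL_power v I n = {r * x ^ n | r x. r \<in> \<O> \<and> x \<in> I}"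
proof (induction n)
  case 0
  show ?case using O_idealD(2)[OF I] by (auto simp: ideals_set_def nat_pow_def)
next
  case (Suc n)
  have "OL_power v I (Suc n) = OL_prod v (OL_power v I n) I"
    by (simp add: nat_pow_def)
  also have "\<dots> = {x * y | x y. x \<in> {r * x ^ n | r x. r \<in> \<O> \<and> x \<in> I} \<and> y \<in> I}"
    unfolding Suc by (rule O_prod_eq[OF O_ideal_powers[OF I] I])
  also have "\<dots> = {r * x ^ Suc n | r x. r \<in> \<O> \<and> x \<in> I}"
  proof (intro equalityI subsetI)
    fix u assume "u \<in> {x * y | x y. x \<in> {r * x ^ n | r x. r \<in> \<O> \<and> x \<in> I} \<and> y \<in> I}"
    then obtain r x y where *: "u = r * x ^ n * y" "r \<in> \<O>" "x \<in> I" "y \<in> I" by auto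
    obtain z a b where z: "z \<in> {x, y}" "a \<in> \<O>" "b \<in> \<O>" "x = a * z" "y = b * z" using dominating .
    then have "u = (r * a ^ n * b) * z ^ Suc n" using * by (simp add: power_mult_distrib algebra_simps)
    moreover have "r * a ^ n * b \<in> \<O>" "z \<in> I" using * z by (auto intro: O.mult_in O.power_in)
    ultimately show "u \<in> {r * x ^ Suc n | r x. r \<in> \<O> \<and> x \<in> I}" by blast
  next
    fix u assume "u \<in> {r * x ^ Suc n | r x. r \<in> \<O> \<and> x \<in> I}"
    then obtain r x where "u = (r * x ^ n) * x" "r \<in> \<O>" "x \<in> I" by (auto simp: algebra_simps)
    then show "u \<in> {x * y | x y. x \<in> {r * x ^ n | r x. r \<in> \<O> \<and> x \<in> I} \<and> y \<in> I}" by blast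
  qed
  finally show ?case .
qed

lemma O_ideal_power: "O_ideal I \<Longrightarrow> O_ideal (OL_power v I n)"
  by (simp add: O_power_eq O_ideal_powers)

lemma scale_power:
  assumes "a \<in> \<O>" "O_ideal I"
  shows "OL_power v (scale_ideal a I) n = scale_ideal (a ^ n) (OL_power v I n)"
  unfolding O_power_eq[OF assms(2)] O_power_eq[OF O_ideal_scale[OF assms]]
proof (intro equalityI subsetI)
  fix y assume "y \<in> {r * x ^ n | r x. r \<in> \<O> \<and> x \<in> scale_ideal a I}"
  then obtain r x where "r \<in> \<O>" "x \<in> I" "y = r * (a * x) ^ n" by auto
  then show "y \<in> scale_ideal (a ^ n) {r * x ^ n | r x. r \<in> \<O> \<and> x \<in> I}"
    by (intro image_eqI[of _ _ "r * x ^ n"]) (auto simp: power_mult_distrib)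
next
  fix y assume "y \<in> scale_ideal (a ^ n) {r * x ^ n | r x. r \<in> \<O> \<and> x \<in> I}"
  then obtain r x where "r \<in> \<O>" "x \<in> I" "y = a ^ n * (r * x ^ n)" by auto
  then show "y \<in> {r * x ^ n | r x. r \<in> \<O> \<and> x \<in> scale_ideal a I}"
    by (intro CollectI exI[of _ r] exI[of _ "a * x"]) (auto simp: power_mult_distrib)
qed

lemma scale_eq:
  assumes "O_ideal I" "a \<noteq> 0" "b \<noteq> 0" "v a = v b"
  shows "scale_ideal a I = scale_ideal b I"
proof -
  have "a * x \<in> scale_ideal b I" if "x \<in> I" "a \<noteq> 0" "b \<noteq> 0" "v a = v b" for a b x
    using O_idealD(4)[OF assms(1), of "a / b" x] that
    by (intro image_eqI[of _ _ "a / b * x"]) (auto simp: divide_in_O_iff)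
  from this[of _ a b] this[of _ b a] show ?thesis using assms by auto
qed

lemma scale_O_prod:
  assumes "a \<in> \<O>" "O_ideal I"
  shows "OL_prod v (scale_ideal a \<O>) I = scale_ideal a I"
  unfolding O_prod_eq[OF O_ideal_scale[OF assms(1) O_ideal_O] assms(2)]
proof (intro equalityI subsetI)
  fix z assume "z \<in> {x * y | x y. x \<in> scale_ideal a \<O> \<and> y \<in> I}"
  then show "z \<in> scale_ideal a I" using O_idealD(4)[OF assms(2)] by (auto simp: mult.assoc)
next
  fix z assume "z \<in> scale_ideal a I"
  then obtain y where "y \<in> I" "z = a * 1 * y" by auto
  then show "z \<in> {x * y | x y. x \<in> scale_ideal a \<O> \<and> y \<in> I}" using O.one_in by blast
qed

text \<open>All generators are multiples of \<open>a\<close>, and the generator \<open>b\<close> has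
  the value of \<open>a\<close>, hence is associated to it.\<close>

lemma genideal_scale:
  assumes S: "S \<subseteq> scale_ideal a \<O>" and b: "b \<in> S" "b \<noteq> 0" "v b = v a" and a: "a \<in> \<O>" "a \<noteq> 0"
  shows "Idl\<^bsub>OL v\<^esub> S = scale_ideal a \<O>"
proof (rule equalityI)
  interpret R: cring "OL v" by (rule cring_set_ring[OF O_subring])
  have SO: "S \<subseteq> carrier (OL v)" using S O_ideal_scale[OF a(1) O_ideal_O] by (auto dest: O_idealD(1))
  show "Idl\<^bsub>OL v\<^esub> S \<subseteq> scale_ideal a \<O>"
    by (rule R.genideal_minimal[OF ideal_if_O_ideal[OF O_ideal_scale[OF a(1) O_ideal_O]] S])
  have I: "O_ideal (Idl\<^bsub>OL v\<^esub> S)" using R.genideal_ideal[OF SO] by (simp add: O_ideal_iff)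
  have "b \<in> Idl\<^bsub>OL v\<^esub> S" using R.genideal_self[OF SO] b(1) by auto
  then have "a * x \<in> Idl\<^bsub>OL v\<^esub> S" if "x \<in> \<O>" for x
    using O_ideal_mono[OF I _ b(2), of "a * x"] val_ge_mult[of a "v a" x 0] b(3) a(2) that
    by (auto simp: val_ring_def)
  then show "scale_ideal a \<O> \<subseteq> Idl\<^bsub>OL v\<^esub> S" by auto
qed

end


section \<open>The largest common convex subgroup\<close>

lemma convex_subgroupD:
  assumes "convex_subgroup H G"
  shows "H \<subseteq> G" "0 \<in> H" "a \<in> H \<Longrightarrow> b \<in> H \<Longrightarrow> a + b \<in> H" "a \<in> H \<Longrightarrow> - a \<in> H"
    "a \<in> H \<Longrightarrow> c \<in> H \<Longrightarrow> b \<in> G \<Longrightarrow> a \<le> b \<Longrightarrow> b \<le> c \<Longrightarrow> b \<in> H"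
proof -
  have *: "H \<subseteq> G" "0 \<in> H" "\<forall>a\<in>H. \<forall>b\<in>H. a + b \<in> H" "\<forall>a\<in>H. - a \<in> H"
    "\<forall>a\<in>H. \<forall>c\<in>H. \<forall>b\<in>G. a \<le> b \<and> b \<le> c \<longrightarrow> b \<in> H"
    using assms unfolding convex_subgroup_def by - (elim conjE; assumption)+
  show "H \<subseteq> G" "0 \<in> H" by fact+
  show "a \<in> H \<Longrightarrow> b \<in> H \<Longrightarrow> a + b \<in> H" using *(3) by blast
  show "a \<in> H \<Longrightarrow> - a \<in> H" using *(4) by blast
  show "a \<in> H \<Longrightarrow> c \<in> H \<Longrightarrow> b \<in> G \<Longrightarrow> a \<le> b \<Longrightarrow> b \<le> c \<Longrightarrow> b \<in> H" using *(5) by blast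
qed

text \<open>Otherwise each subgroup contains a nonnegative element missing from the other. The
  smaller of the two lies between 0 and the larger one, so convexity puts it into both.\<close>

lemma convex_subgroup_chain:
  assumes "convex_subgroup A G" "convex_subgroup B G"
  shows "A \<subseteq> B \<or> B \<subseteq> A"
proof (rule ccontr)
  \<comment> \<open>Passing to the negative, if necessary, makes the witness nonnegative.\<close>
  have pos: "\<exists>a\<in>A. a \<notin> B \<and> 0 \<le> a" if "convex_subgroup A G" "convex_subgroup B G" "\<not> A \<subseteq> B"
    for A B :: "'a set"
  proof -
    have neg: "- x \<in> C" if "convex_subgroup C G" "x \<in> C" for x C
      using that by (rule convex_subgroupD(4))
    obtain a where a: "a \<in> A" "a \<notin> B" using \<open>\<not> A \<subseteq> B\<close> by blast
    have "- a \<in> A" using neg[OF that(1) a(1)] .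
    moreover have "- a \<notin> B" using neg[OF that(2), of "- a"] a(2) by (metis minus_minus)
    moreover have "0 \<le> a \<or> 0 \<le> - a" by (simp add: linear)
    ultimately show ?thesis using a by blast
  qed
  assume "\<not> ?thesis"
  then obtain a b where ab: "a \<in> A" "a \<notin> B" "0 \<le> a" "b \<in> B" "b \<notin> A" "0 \<le> b"
    using pos[OF assms] pos[OF assms(2,1)] by auto
  have between: "x \<in> B" if "convex_subgroup B G" "y \<in> B" "0 \<le> x" "x \<le> y" "x \<in> G" for x y B
    using convex_subgroupD(5)[OF that(1) convex_subgroupD(2)[OF that(1)] that(2,5,3,4)] .
  have "a \<in> G" "b \<in> G" using ab assms by (auto dest: convex_subgroupD(1))
  then show False
    using between[OF assms(2) ab(4,3)] between[OF assms(1) ab(1,6)] ab(2,5) \<open>a \<in> G\<close> \<open>b \<in> G\<close> linear[of a b]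
    by blast
qed

context totally_ramified
begin

abbreviation "\<A> \<equiv> val_ring K v"
abbreviation "\<H> \<equiv> HE K v"
abbreviation "\<M> \<equiv> ME K v"
abbreviation "principal_M \<equiv> principalideal \<M> (set_ring (OE K v))"
abbreviation "\<J> s \<equiv> scale_ideal s (OL_power v \<M> q)"

lemma A_iff: "a \<in> \<A> \<longleftrightarrow> a \<in> K \<and> a \<in> \<O>"
  by (auto simp: val_ring_def)

lemma A_subring: "subring_set \<A>"
  by unfold_locales (auto simp: A_iff K.one_in O.one_in K.diff_in O.diff_in K.mult_in O.mult_in)

sublocale A: subring_set \<A> by (rule A_subring)

text \<open>Convexity in the larger group is the stronger condition, so being common to both groups
  amounts to being contained in \<Gamma>.\<close>

lemma convex_subgroup_K:
  "convex_subgroup C (value_group UNIV v) \<Longrightarrow> C \<subseteq> \<Gamma> \<Longrightarrow> convex_subgroup C \<Gamma>"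
proof -
  assume C: "convex_subgroup C (value_group UNIV v)" "C \<subseteq> \<Gamma>"
  note D = convex_subgroupD[OF C(1)]
  show "convex_subgroup C \<Gamma>"
    unfolding convex_subgroup_def
  proof (intro conjI ballI impI)
    fix a c b assume "a \<in> C" "c \<in> C" "b \<in> \<Gamma>" "a \<le> b \<and> b \<le> c"
    moreover from this have "b \<in> value_group UNIV v" by (auto simp: value_group_def)
    ultimately show "b \<in> C" using D(5) by blast
  qed (fact C(2) D(2) | rule D(3,4); assumption)+
qed

text \<open>\<open>GREATEST\<close> is meaningful only once a greatest element is exhibited. It is
  the union of all common convex subgroups; any two elements of the union lie in one member because
  the members form a chain.\<close>

lemma HE_props:
  shows "convex_subgroup \<H> (value_group UNIV v)" "\<H> \<subseteq> \<Gamma>"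
    "convex_subgroup C (value_group UNIV v) \<Longrightarrow> C \<subseteq> \<Gamma> \<Longrightarrow> C \<subseteq> \<H>"
proof -
  define P where "P = (\<lambda>C. convex_subgroup C (value_group UNIV v) \<and> convex_subgroup C \<Gamma>)"
  define U where "U = \<Union>{C. P C}"
  have P_iff: "P C \<longleftrightarrow> convex_subgroup C (value_group UNIV v) \<and> C \<subseteq> \<Gamma>" for C
    using convex_subgroup_K convex_subgroupD(1) unfolding P_def by metis
  have P0: "P {0}"
  proof -
    have "v 1 \<in> value_group UNIV v" unfolding value_group_def by (rule imageI) simp
    then have "convex_subgroup {0} (value_group UNIV v)"
      unfolding convex_subgroup_def by (simp add: eq_iff)
    then show ?thesis unfolding P_iff using Gamma_0 by simp
  qed
  have two: "\<exists>C. P C \<and> a \<in> C \<and> b \<in> C" if *: "a \<in> U" "b \<in> U" for a b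
  proof -
    obtain A B where AB: "P A" "a \<in> A" "P B" "b \<in> B" using * by (auto simp: U_def)
    then have "A \<subseteq> B \<or> B \<subseteq> A"
      by (intro convex_subgroup_chain[of A "value_group UNIV v" B]) (auto simp: P_def)
    then show ?thesis using AB by blast
  qed
  have "convex_subgroup U (value_group UNIV v)"
    unfolding convex_subgroup_def
  proof (intro conjI ballI impI)
    show "U \<subseteq> value_group UNIV v" using convex_subgroupD(1) by (auto simp: U_def P_iff)
    show "0 \<in> U" using P0 by (auto simp: U_def)
    show "a + b \<in> U" if "a \<in> U" "b \<in> U" for a b
      using two[OF that] convex_subgroupD(3) unfolding U_def P_def by blast
    show "- a \<in> U" if "a \<in> U" for a
      using that convex_subgroupD(4) unfolding U_def P_def by blast
    show "b \<in> U" if *: "a \<in> U" "c \<in> U" "b \<in> value_group UNIV v" "a \<le> b \<and> b \<le> c" for a b c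
    proof -
      obtain C where "P C" "a \<in> C" "c \<in> C" using two[OF *(1,2)] by blast
      then have "b \<in> C" using *(3,4) convex_subgroupD(5)[of C _ a c b] unfolding P_def by blast
      then show ?thesis using \<open>P C\<close> by (auto simp: U_def)
    qed
  qed
  moreover have "U \<subseteq> \<Gamma>" by (auto simp: U_def P_iff)
  ultimately have PU: "P U" by (simp add: P_iff)
  have "\<H> = U"
    unfolding HE_def using PU by (intro Greatest_equality) (auto simp: P_def U_def)
  then show "convex_subgroup \<H> (value_group UNIV v)" "\<H> \<subseteq> \<Gamma>"
    "convex_subgroup C (value_group UNIV v) \<Longrightarrow> C \<subseteq> \<Gamma> \<Longrightarrow> C \<subseteq> \<H>"
    using PU P_iff by (auto simp: U_def)
qed

lemma H_0: "0 \<in> \<H>" and H_minus: "\<gamma> \<in> \<H> \<Longrightarrow> - \<gamma> \<in> \<H>" and H_add: "\<gamma> \<in> \<H> \<Longrightarrow> \<delta> \<in> \<H> \<Longrightarrow> \<gamma> + \<delta> \<in> \<H>"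
  and H_convex: "\<gamma> \<in> \<H> \<Longrightarrow> \<delta> \<in> \<H> \<Longrightarrow> x \<noteq> 0 \<Longrightarrow> \<gamma> \<le> v x \<Longrightarrow> v x \<le> \<delta> \<Longrightarrow> v x \<in> \<H>"
proof -
  note H = convex_subgroupD[OF HE_props(1)]
  show "0 \<in> \<H>" "\<gamma> \<in> \<H> \<Longrightarrow> - \<gamma> \<in> \<H>" "\<gamma> \<in> \<H> \<Longrightarrow> \<delta> \<in> \<H> \<Longrightarrow> \<gamma> + \<delta> \<in> \<H>"
    by (fact H)+
  assume *: "\<gamma> \<in> \<H>" "\<delta> \<in> \<H>" "x \<noteq> 0" "\<gamma> \<le> v x" "v x \<le> \<delta>"
  show "v x \<in> \<H>" using *(3) by (intro H(5)[OF *(1,2) _ *(4,5)]) (simp add: value_group_def)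
qed

section \<open>The ideal of elements with values above \<open>HE K v\<close>\<close>

lemma M_iff: "x \<in> \<M> \<longleftrightarrow> x = 0 \<or> (\<forall>\<gamma>\<in>\<H>. \<gamma> < v x)"
  by (auto simp: ME_def val_gt_def)

lemma M_pos: "x \<in> \<M> \<Longrightarrow> x \<noteq> 0 \<Longrightarrow> 0 < v x"
  using H_0 by (auto simp: M_iff)

lemma M_mono: "x \<in> \<M> \<Longrightarrow> x \<noteq> 0 \<Longrightarrow> v x \<le> v y \<Longrightarrow> y \<in> \<M>"
  by (auto simp: M_iff intro: less_le_trans)

lemma not_in_M: "x \<noteq> 0 \<Longrightarrow> 0 \<le> v x \<Longrightarrow> x \<notin> \<M> \<Longrightarrow> v x \<in> \<H>"
  using H_convex[of 0] H_0 by (auto simp: M_iff not_less)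

text \<open>A nonnegative value that does not exceed all of \<H> lies in \<H> by convexity, hence in
  \<Gamma>.\<close>

lemma outside_in_M: "outside x \<Longrightarrow> 0 < v x \<Longrightarrow> x \<in> \<M>"
  using not_in_M[of x] HE_props(2) less_imp_le[of 0 "v x"] by (auto simp: outside_def)

lemma O_ideal_M: "O_ideal \<M>"
proof (rule O_idealI_dominating)
  show "\<M> \<subseteq> \<O>" using M_pos by (force simp: O_iff)
  show "r * x \<in> \<M>" if "r \<in> \<O>" "x \<in> \<M>" for r x
    using that M_mono[of x "r * x"] by (cases "r = 0"; cases "x = 0") (auto simp: O_iff M_iff v_mult)
qed (simp add: M_iff)

lemma M_subset_O: "x \<in> \<M> \<Longrightarrow> x \<in> \<O>"
  using O_idealD(1)[OF O_ideal_M] .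

lemma v_power_mono_exp:
  assumes "x \<noteq> 0" "0 \<le> v x" "m \<le> n" shows "v (x ^ m) \<le> v (x ^ n)"
proof -
  have "x ^ (n - m) \<in> \<O>" using assms by (intro O.power_in) (simp add: O_iff)
  moreover have "x ^ n = x ^ m * x ^ (n - m)" using assms(3) by (simp flip: power_add)
  ultimately show ?thesis using assms by (simp add: v_mult O_iff)
qed

text \<open>Maximality of \<H> enters here: the convex subgroup generated by \<open>v z\<close> is
  not contained in \<H>, so it contains values outside \<Gamma>. Such a value is moved below
  \<open>v z\<close> by subtracting a multiple of \<open>v z\<close>, which lies in \<Gamma> when
  \<open>z\<close> is not outside itself.\<close>

lemma M_cofinal:
  assumes z: "z \<in> \<M>" "z \<noteq> 0"
  obtains x where "outside x" "0 < v x" "v x \<le> v z"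
proof (cases "outside z")
  case True
  then show ?thesis using that M_pos z by auto
next
  case False
  then have zG: "v z \<in> \<Gamma>" using z(2) by (simp add: outside_def)
  \<comment> \<open>The convex subgroup generated by \<open>v z\<close>, with multiples expressed
    through powers of \<open>z\<close>.\<close>
  define C where "C = {v x | x. x \<noteq> 0 \<and> (\<exists>n. - v (z ^ n) \<le> v x \<and> v x \<le> v (z ^ n))}"
  have "convex_subgroup C (value_group UNIV v)"
    unfolding convex_subgroup_def
  proof (intro conjI ballI impI)
    show "C \<subseteq> value_group UNIV v" by (auto simp: C_def value_group_def)
    have "v 1 \<in> C" unfolding C_def by (intro CollectI exI[of _ 1] conjI refl exI[of _ 0]) auto
    then show "0 \<in> C" by simp
    show "a + b \<in> C" if a: "a \<in> C" and b: "b \<in> C" for a b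
    proof -
      obtain x m where x: "x \<noteq> 0" "a = v x" "- v (z ^ m) \<le> v x" "v x \<le> v (z ^ m)" using a by (auto simp: C_def)
      obtain y n where y: "y \<noteq> 0" "b = v y" "- v (z ^ n) \<le> v y" "v y \<le> v (z ^ n)" using b by (auto simp: C_def)
      have "v (z ^ (m + n)) = v (z ^ m) + v (z ^ n)" using z(2) by (simp add: power_add v_mult)
      then have "- v (z ^ (m + n)) \<le> v (x * y)" "v (x * y) \<le> v (z ^ (m + n))"
        using x y add_mono[OF x(3) y(3)] add_mono[OF x(4) y(4)] by (auto simp: v_mult)
      then show ?thesis using x y by (auto simp: C_def v_mult intro!: exI[of _ "x * y"])
    qed
    show "- a \<in> C" if a: "a \<in> C" for a
    proof -
      obtain x m where x: "x \<noteq> 0" "a = v x" "- v (z ^ m) \<le> v x" "v x \<le> v (z ^ m)" using a by (auto simp: C_def)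
      then have "- v (z ^ m) \<le> v (inverse x)" "v (inverse x) \<le> v (z ^ m)"
        by (simp_all add: v_inverse minus_le_iff)
      then show ?thesis using x by (auto simp: C_def v_inverse intro!: exI[of _ "inverse x"])
    qed
    show "b \<in> C" if a: "a \<in> C" and c: "c \<in> C" and b: "b \<in> value_group UNIV v" "a \<le> b \<and> b \<le> c" for a b c
    proof -
      obtain x m where x: "x \<noteq> 0" "a = v x" "- v (z ^ m) \<le> v x" using a by (auto simp: C_def)
      obtain y n where y: "y \<noteq> 0" "c = v y" "v y \<le> v (z ^ n)" using c by (auto simp: C_def)
      obtain u where u: "u \<noteq> 0" "b = v u" using b by (auto simp: value_group_def)
      have le: "v (z ^ m) \<le> v (z ^ max m n)" "v (z ^ n) \<le> v (z ^ max m n)"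
        using z M_pos[OF z] by (auto intro!: v_power_mono_exp)
      have "- v (z ^ max m n) \<le> v u" "v u \<le> v (z ^ max m n)"
        using x y u b(2) le by (auto intro: order_trans) (meson le(1) neg_le_iff_le order_trans)
      then show ?thesis using u by (auto simp: C_def)
    qed
  qed
  moreover have "v z \<in> C"
  proof -
    have "- v z \<le> 0" "0 \<le> v z" using M_pos[OF z] by (simp_all add: less_imp_le)
    then show ?thesis unfolding C_def using z(2) by (intro CollectI exI[of _ z] exI[of _ 1] conjI) auto
  qed
  moreover have "v z \<notin> \<H>" using z by (auto simp: M_iff)
  ultimately have "\<not> C \<subseteq> \<Gamma>" using HE_props(3) by blast
  then obtain x n where x: "x \<noteq> 0" "v x \<notin> \<Gamma>" "- v (z ^ n) \<le> v x" "v x \<le> v (z ^ n)" by (auto simp: C_def)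
  then have "v x \<noteq> 0" using Gamma_0 by auto
  obtain y where y: "outside y" "0 < v y" "v y \<le> v (z ^ n)"
  proof (cases "0 < v x")
    case True
    then show ?thesis using that[of x] x by (auto simp: outside_def)
  next
    case F: False
    have "outside (inverse x)" using x by (intro outside_inverse) (simp add: outside_def)
    moreover have "- v x \<le> v (z ^ n)" using x(3) by (simp add: minus_le_iff)
    moreover have "0 < - v x" using F \<open>v x \<noteq> 0\<close> by simp
    ultimately show ?thesis using that[of "inverse x"] x(1) by (simp add: v_inverse)
  qed
  \<comment> \<open>Minimality places \<open>v y\<close> strictly above \<open>v (z ^ m)\<close> for
    \<open>m = k - 1\<close>, so \<open>y / z ^ m\<close> has positive value not exceeding
    \<open>v z\<close>.\<close>
  define k where "k = (LEAST k. v y \<le> v (z ^ k))"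
  have k: "v y \<le> v (z ^ k)" unfolding k_def using y(3) by (rule LeastI)
  have "k \<noteq> 0" using k y(2) by (intro notI) simp
  then obtain m where m: "k = Suc m" by (cases k) auto
  have "\<not> v y \<le> v (z ^ m)" using not_less_Least[of m "\<lambda>k. v y \<le> v (z ^ k)"] m by (simp add: k_def)
  then have "0 < v (y / z ^ m)" "v (y / z ^ m) \<le> v z"
    using y(1) z k m by (auto simp: outside_def v_divide v_mult algebra_simps)
  moreover have "outside (inverse (z ^ m) * y)"
    using y(1) z(2) Gamma_power[OF z(2) zG, of m] Gamma_minus
    by (intro outside_mult) (auto simp: v_inverse)
  ultimately show ?thesis using that[of "y / z ^ m"] by (simp add: divide_inverse mult.commute)
qed

lemma ex_monomial:
  assumes t: "outside t" and x: "x \<noteq> 0"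
  obtains b i where "b \<in> K" "b \<noteq> 0" "i < q" "v x = v (b * t ^ i)"
proof -
  obtain p where p: "p \<in> polys_over K" "degree p < q" "poly p t = x" using ex_poly[OF t] .
  then have "p \<noteq> 0" using x by auto
  obtain i where "i \<le> degree p" "coeff p i \<noteq> 0" "v (poly p t) = v (coeff p i * t ^ i)"
    using v_poly[OF t p(1,2) \<open>p \<noteq> 0\<close>] by metis
  then show ?thesis using that[of "coeff p i" i] p by (auto simp: polys_over_def)
qed


section \<open>Principal and nonprincipal maximal ideals\<close>

lemma OE_iff: "x \<in> OE K v \<longleftrightarrow> x = 0 \<or> (\<exists>\<gamma>\<in>\<H>. \<gamma> \<le> v x)"
  using H_0 by (auto simp: OE_def val_ge_def)

lemma O_subset_OE: "x \<in> \<O> \<Longrightarrow> x \<in> OE K v"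
  using H_0 by (auto simp: OE_iff O_iff)

lemma OE_subring: "subring_set (OE K v)"
proof
  show "1 \<in> OE K v" by (intro O_subset_OE O.one_in)
  fix a b assume a: "a \<in> OE K v" and b: "b \<in> OE K v"
  obtain \<gamma> where \<gamma>: "\<gamma> \<in> \<H>" "val_ge v a \<gamma>" using a by (auto simp: OE_def)
  obtain \<delta> where \<delta>: "\<delta> \<in> \<H>" "val_ge v b \<delta>" using b by (auto simp: OE_def)
  have "val_ge v (a - b) (min \<gamma> \<delta>)"
    using \<gamma>(2) \<delta>(2) by (intro val_ge_diff) (auto simp: val_ge_def min_le_iff_disj)
  then show "a - b \<in> OE K v" using \<gamma> \<delta> unfolding OE_def by (auto intro!: bexI[of _ "min \<gamma> \<delta>"] simp: min_def)
  show "a * b \<in> OE K v" using val_ge_mult[OF \<gamma>(2) \<delta>(2)] H_add \<gamma> \<delta> by (auto simp: OE_def)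
qed

lemma OE_mult_M:
  assumes "r \<in> OE K v" "x \<in> \<M>" shows "r * x \<in> \<M>"
proof (cases "r = 0 \<or> x = 0")
  case False
  obtain \<gamma> where \<gamma>: "\<gamma> \<in> \<H>" "\<gamma> \<le> v r" using assms(1) False by (auto simp: OE_iff)
  have "\<delta> < v (r * x)" if "\<delta> \<in> \<H>" for \<delta>
  proof -
    have "\<delta> - \<gamma> < v x" using assms(2) False H_add[OF that H_minus[OF \<gamma>(1)]] by (auto simp: M_iff)
    from add_le_less_mono[OF \<gamma>(2) this] show ?thesis using False by (simp add: v_mult)
  qed
  then show ?thesis by (simp add: M_iff)
qed (auto simp: M_iff)

lemma OE_not_M: "y \<in> OE K v \<Longrightarrow> y \<notin> \<M> \<Longrightarrow> y \<noteq> 0 \<and> v y \<in> \<H>"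
  using H_convex by (auto simp: M_iff OE_iff not_less)

lemma inverse_M: "x \<in> \<M> \<Longrightarrow> x \<noteq> 0 \<Longrightarrow> inverse x \<notin> OE K v"
  using H_minus by (auto simp: OE_iff M_iff v_inverse) (metis le_minus_iff not_less)

lemma not_OE_inverse: "x \<notin> OE K v \<Longrightarrow> inverse x \<in> \<M>"
  using H_minus by (auto simp: OE_iff M_iff v_inverse) (metis minus_less_iff neg_less_iff_less not_le minus_minus)

text \<open>Principality in terms of quotients. A generator cannot be zero because the ideal
  contains the outside elements of positive value.\<close>

lemma principal_iff:
  "principal_M \<longleftrightarrow> (\<exists>m\<in>\<M>. m \<noteq> 0 \<and> (\<forall>x\<in>\<M>. x / m \<in> OE K v))"
proof -
  interpret E: subring_set "OE K v" by (rule OE_subring)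
  interpret R: cring "set_ring (OE K v)" by (rule cring_set_ring[OF OE_subring])
  have ideal: "ideal \<M> (set_ring (OE K v))"
    by (rule ideal_set_ring[OF OE_subring])
      (auto intro: O_subset_OE M_subset_O O_idealD[OF O_ideal_M] OE_mult_M)
  have gen: "Idl\<^bsub>set_ring (OE K v)\<^esub> {m} = {r * m | r. r \<in> OE K v}" if "m \<in> OE K v" for m
    using R.cgenideal_eq_genideal[of m] that by (simp add: cgenideal_def)
  show ?thesis
  proof
    assume "principal_M"
    then interpret P: principalideal \<M> "set_ring (OE K v)" .
    obtain m where m: "m \<in> OE K v" "\<M> = Idl\<^bsub>set_ring (OE K v)\<^esub> {m}" using P.generate by auto
    then have M: "\<M> = {r * m | r. r \<in> OE K v}" using gen by simp
    obtain t where t: "outside t" using ex_outside by blast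
    \<comment> \<open>This element, or rather its membership in \<M>, excludes the zero
      ideal.\<close>
    obtain x where x: "outside x" "0 < v x"
    proof (cases "0 < v t")
      case False
      then have "v t < 0" using t Gamma_0 by (metis less_linear outside_def)
      then show ?thesis using that[OF outside_inverse[OF t]] t by (simp add: v_inverse outside_def)
    qed (use t in auto)
    then have "x \<in> \<M>" "x \<noteq> 0" using outside_in_M by (auto simp: outside_def)
    then have "m \<noteq> 0" using M by auto
    moreover have "m \<in> \<M>" using M E.one_in by (auto intro!: exI[of _ 1])
    moreover have "x / m \<in> OE K v" if "x \<in> \<M>" for x using that M \<open>m \<noteq> 0\<close> by auto
    ultimately show "\<exists>m\<in>\<M>. m \<noteq> 0 \<and> (\<forall>x\<in>\<M>. x / m \<in> OE K v)" by blast
  next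
    assume "\<exists>m\<in>\<M>. m \<noteq> 0 \<and> (\<forall>x\<in>\<M>. x / m \<in> OE K v)"
    then obtain m where m: "m \<in> \<M>" "m \<noteq> 0" "\<And>x. x \<in> \<M> \<Longrightarrow> x / m \<in> OE K v" by blast
    have "m \<in> OE K v" using m(1) by (intro O_subset_OE M_subset_O)
    moreover have "\<M> = {r * m | r. r \<in> OE K v}"
    proof (intro equalityI subsetI)
      fix x assume "x \<in> \<M>"
      then show "x \<in> {r * m | r. r \<in> OE K v}" using m by (auto intro!: exI[of _ "x / m"])
    qed (use m OE_mult_M in auto)
    ultimately show "principal_M"
      using gen by (intro principalidealI ideal) auto
  qed
qed

text \<open>As \<open>z\<close> is not a generator, some \<open>x\<close> in the ideal has
  \<open>x / z\<close> outside \<open>OE K v\<close>; then the inverse \<open>z / x\<close> lies in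
  the ideal as well.\<close>

lemma nonprincipal_product:
  assumes "\<not> principal_M" "z \<in> \<M>" "z \<noteq> 0"
  obtains x y where "x \<in> \<M>" "y \<in> \<M>" "z = x * y"
proof -
  obtain x where x: "x \<in> \<M>" "x / z \<notin> OE K v" using assms by (auto simp: principal_iff)
  then have "x \<noteq> 0" using O_subset_OE O.zero_in by auto
  then show ?thesis using that[of x "z / x"] x not_OE_inverse[OF x(2)] by simp
qed

text \<open>This expresses that a nonprincipal maximal ideal equals all its powers. Splitting
  \<open>x\<close> into two factors and keeping the one of smaller value halves the value at
  least.\<close>

lemma nonprincipal_root:
  assumes np: "\<not> principal_M" and z: "z \<in> \<M>" "z \<noteq> 0"
  shows "\<exists>x\<in>\<M>. x \<noteq> 0 \<and> v (x ^ n) \<le> v z"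
proof (induction n)
  case 0
  then show ?case using z M_pos[OF z] by (intro bexI[of _ z]) auto
next
  case (Suc n)
  show ?case
  proof (cases "n = 0")
    case True
    then show ?thesis using z by (intro bexI[of _ z]) auto
  next
    case False
    obtain x where x: "x \<in> \<M>" "x \<noteq> 0" "v (x ^ n) \<le> v z" using Suc by blast
    obtain a b where ab: "a \<in> \<M>" "b \<in> \<M>" "x = a * b" using nonprincipal_product[OF np x(1,2)] .
    have ab0: "a \<noteq> 0" "b \<noteq> 0" using ab x(2) by auto
    obtain c where c: "c \<in> \<M>" "c \<noteq> 0" "v (c * c) \<le> v x"
    proof (cases "v a \<le> v b")
      case True
      then show ?thesis using that[of a] ab ab0 by (auto simp: v_mult)
    next
      case F: False
      then show ?thesis using that[of b] ab ab0 by (auto simp: v_mult)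
    qed
    \<comment> \<open>Here \<open>n + 1 \<le> 2 * n\<close>, since \<open>n\<close> is not
      0.\<close>
    have "v (c ^ Suc n) \<le> v (c ^ (2 * n))" using c M_pos[OF c(1,2)] False by (intro v_power_mono_exp) auto
    also have "c ^ (2 * n) = (c * c) ^ n" by (simp add: power_mult power2_eq_square)
    also have "v \<dots> \<le> v (x ^ n)" using c x by (intro v_power_mono) auto
    finally show ?thesis using c x by (intro bexI[of _ c]) auto
  qed
qed


section \<open>Generators of the valuation ring\<close>

text \<open>This is the value-theoretic content of \<open>\<O> = \<Union>\<A>[c t]\<close>: it allows all coefficients of an
  integral \<open>\<Sum>a\<^sub>i t\<^sup>i\<close> to be divided by \<open>c\<^sup>i\<close>.\<close>

definition good :: "'l \<Rightarrow> bool" where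
  "good t \<longleftrightarrow> outside t \<and> (\<forall>i a. 0 < i \<and> i < q \<and> a \<in> K \<and> a \<noteq> 0 \<and> 0 < v (a * t ^ i) \<longrightarrow>
     (\<exists>c\<in>K. c \<noteq> 0 \<and> 0 < v (c * t) \<and> v (c ^ i) \<le> v a))"

text \<open>The condition is insensitive to the factor \<open>b\<close>: it replaces
  \<open>a\<close> by \<open>a / b ^ i\<close> and the resulting \<open>c\<close> by
  \<open>c * b\<close>.\<close>

lemma good_scale:
  assumes g: "good (b * t)" and b: "b \<in> K" "b \<noteq> 0" shows "good t"
proof -
  have "outside (inverse b * (b * t))"
    using g b K_inverse by (intro outside_mult_K[of "b * t"]) (auto simp: good_def)
  then have t: "outside t" using b by (simp flip: mult.assoc)
  have "\<exists>c\<in>K. c \<noteq> 0 \<and> 0 < v (c * t) \<and> v (c ^ i) \<le> v a"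
    if a: "0 < i" "i < q" "a \<in> K" "a \<noteq> 0" "0 < v (a * t ^ i)" for a i
  proof -
    have "a / b ^ i \<in> K" "a / b ^ i \<noteq> 0" "0 < v (a / b ^ i * (b * t) ^ i)"
      using a b by (auto intro!: K_divide K.power_in simp: power_mult_distrib)
    then obtain c where c: "c \<in> K" "c \<noteq> 0" "0 < v (c * (b * t))" "v (c ^ i) \<le> v (a / b ^ i)"
      using g a unfolding good_def by blast
    then show ?thesis using a b
      by (intro bexI[of _ "c * b"]) (auto simp: K.mult_in mult.assoc power_mult_distrib v_mult v_divide algebra_simps)
  qed
  then show ?thesis using t by (auto simp: good_def)
qed

text \<open>If \<open>a\<close> is integral, \<open>c = 1\<close> serves. Otherwise
  \<open>c = a\<close> does, provided that \<open>v a\<close> lies in \<H>, that is, below the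
  positive values of \<M>; the proof consists in establishing this.\<close>

lemma good_if_principal:
  assumes x: "outside x" "x \<in> \<M>" and gen: "\<And>y. y \<in> \<M> \<Longrightarrow> y / x \<in> OE K v"
  shows "good x"
  unfolding good_def
proof (intro conjI allI impI x(1))
  fix i a assume *: "0 < i \<and> i < q \<and> a \<in> K \<and> a \<noteq> 0 \<and> 0 < v (a * x ^ i)"
  have x0: "x \<noteq> 0" using x by (simp add: outside_def)
  have M: "a * x ^ i \<in> \<M>" using * x by (intro outside_in_M outside_monomial) auto
  show "\<exists>c\<in>K. c \<noteq> 0 \<and> 0 < v (c * x) \<and> v (c ^ i) \<le> v a"
  proof (cases "0 \<le> v a")
    case True
    then show ?thesis using K.one_in M_pos[OF x(2) x0] by (intro bexI[of _ 1]) auto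
  next
    case False
    define b where "b = inverse a"
    have b: "b \<noteq> 0" "v b = - v a" using * by (auto simp: b_def v_inverse)
    have bound: "m < i" if "b / x ^ m \<in> OE K v" for m
    proof (rule ccontr)
      assume "\<not> m < i"
      then have "x ^ m = x ^ (m - i) * x ^ i" by (simp flip: power_add)
      then have "b / x ^ m = inverse (x ^ (m - i) * (a * x ^ i))"
        by (simp add: b_def divide_inverse mult_ac)
      moreover have "x ^ (m - i) * (a * x ^ i) \<in> \<M>"
        by (intro O_idealD(4)[OF O_ideal_M] M O.power_in M_subset_O x)
      ultimately show False using inverse_M[of "x ^ (m - i) * (a * x ^ i)"] that * x0 by simp
    qed
    \<comment> \<open>The order of \<open>b\<close> with respect to the generator \<open>x\<close>:
      after division by \<open>x ^ m\<close>, a unit of \<open>OE K v\<close> remains, with value in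
      \<H>.\<close>
    define m where "m = Max {m. b / x ^ m \<in> OE K v}"
    have fin: "finite {m. b / x ^ m \<in> OE K v}"
      by (rule finite_subset[of _ "{..<i}"]) (auto dest: bound)
    have "0 \<in> {m. b / x ^ m \<in> OE K v}" using b False by (auto intro!: O_subset_OE simp: O_iff)
    then have "m \<in> {m. b / x ^ m \<in> OE K v}" unfolding m_def by (intro Max_in fin) blast
    then have m: "b / x ^ m \<in> OE K v" by simp
    have "b / x ^ m \<notin> \<M>"
    proof
      assume "b / x ^ m \<in> \<M>"
      from gen[OF this] have "Suc m \<in> {m. b / x ^ m \<in> OE K v}" by (simp add: field_simps)
      then have "Suc m \<le> m" unfolding m_def by (rule Max_ge[OF fin])
      then show False by simp
    qed
    then have H: "v (b / x ^ m) \<in> \<H>" using OE_not_M[OF m] by simp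
    then have "v (b / x ^ m) \<in> \<Gamma>" using HE_props(2) by blast
    then have "v b - v (x ^ m) \<in> \<Gamma>" using b x0 by (simp add: v_divide)
    moreover have "v b \<in> \<Gamma>" using * K_inverse by (intro Gamma_v) (auto simp: b_def)
    ultimately have "v (x ^ m) \<in> \<Gamma>" using Gamma_diff[of "v b" "v b - v (x ^ m)"] by simp
    \<comment> \<open>\<open>v b\<close> and the value of the unit lie in \<Gamma>, so
      \<open>v (x ^ m)\<close> does too. Since \<open>m < i < q\<close>, a positive \<open>m\<close>
      would contradict that \<open>x\<close> is outside.\<close>
    then have "m = 0"
      using outside_power[OF x(1) not_dvd_less, of m] bound[OF m] * by (auto simp: outside_def)
    then have Hb: "v b \<in> \<H>" using H by simp
    then have "v b < v x" using x x0 by (auto simp: M_iff)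
    then have "0 < v x - v b" by simp
    then have "0 < v (a * x)" using * b x0 by (simp add: v_mult add.commute)
    moreover have "v (a ^ i) \<le> v a"
    proof -
      have "b ^ (i - 1) \<in> \<O>" using b False by (intro O.power_in) (simp add: O_iff)
      then have "0 \<le> v (b ^ (i - 1))" using b by (simp add: O_iff)
      then have "v (a ^ (i - 1)) \<le> 0" using * by (simp add: b_def power_inverse v_inverse)
      moreover have "a ^ i = a * a ^ (i - 1)" using * by (simp flip: power_Suc)
      ultimately show ?thesis using * by (simp add: v_mult)
    qed
    ultimately show ?thesis using * by blast
  qed
qed

text \<open>There are outside elements of arbitrarily small positive value relative to a given
  member of \<M>, but their class need not be that of \<open>t\<close>. A suitable power below
  \<open>q\<close> moves such an element into the class of \<open>t\<close>, and the exponent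
  \<open>q * i\<close> leaves room for this.\<close>

lemma good_if_nonprincipal:
  assumes np: "\<not> principal_M" and t: "outside t"
  shows "good t"
  unfolding good_def
proof (intro conjI allI impI t)
  fix i a assume *: "0 < i \<and> i < q \<and> a \<in> K \<and> a \<noteq> 0 \<and> 0 < v (a * t ^ i)"
  have t0: "t \<noteq> 0" using t by (simp add: outside_def)
  have M: "a * t ^ i \<in> \<M>" using * t by (intro outside_in_M outside_monomial) auto
  \<comment> \<open>The factor \<open>i\<close> in the exponent pays for the power of
    \<open>c\<close>, the factor \<open>q\<close> for the exponent \<open>l < q\<close> chosen
    below.\<close>
  obtain z where z: "z \<in> \<M>" "z \<noteq> 0" "v (z ^ (q * i)) \<le> v (a * t ^ i)"
    using nonprincipal_root[OF np M] * t0 by auto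
  obtain x where x: "outside x" "0 < v x" "v x \<le> v z" using M_cofinal[OF z(1,2)] .
  have x0: "x \<noteq> 0" using x by (simp add: outside_def)
  obtain b k where b: "b \<in> K" "b \<noteq> 0" "k < q" "v x = v (b * t ^ k)" using ex_monomial[OF t x0] .
  have "0 < k" using b x(1) Gamma_v[of b] by (intro gr0I) (auto simp: outside_def)
  obtain l' m' where "k * l' = q * m' + 1" using bezout_q[OF not_dvd_less[OF \<open>0 < k\<close> b(3)]] .
  then have "k * l' mod q = (1 + q * m') mod q" by (simp only: add.commute)
  also have "\<dots> = 1 mod q" by (rule mod_mult_self2)
  finally have "k * l' mod q = 1" using q_ge_2 by simp
  then have "k * (l' mod q) mod q = 1" by (simp add: mod_mult_right_eq)
  \<comment> \<open>Reducing the Bezout coefficient modulo \<open>q\<close> keeps the exponent below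
    \<open>q\<close>; \<open>m\<close> is the resulting carry.\<close>
  define l where "l = l' mod q"
  define m where "m = k * l div q"
  have l: "l < q" "k * l = q * m + 1"
    using \<open>k * (l' mod q) mod q = 1\<close> q_pos mult_div_mod_eq[of q "k * l"] by (auto simp: l_def m_def)
  obtain e where e: "e \<in> K" "e \<noteq> 0" "v (t ^ q) = v e" using power_q_Gamma[OF t0] by (auto simp: Gamma_iff)
  \<comment> \<open>Up to elements of value 0, \<open>x ^ l\<close> is
    \<open>b ^ l * (t ^ q) ^ m * t\<close>, and \<open>e\<close> replaces \<open>t ^ q\<close> by an
    element of \<open>K\<close>.\<close>
  define c where "c = b ^ l * e ^ m"
  have c: "c \<in> K" "c \<noteq> 0" using b e by (auto simp: c_def intro: K.mult_in K.power_in)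
  have pow: "v ((x ^ l) ^ j) = v ((c * t) ^ j)" for j
  proof -
    have "v (x ^ l) = v ((b * t ^ k) ^ l)" using x0 b t0 by (intro antisym v_power_mono) auto
    also have "(b * t ^ k) ^ l = b ^ l * (t ^ q) ^ m * t"
      using l(2) by (simp add: power_mult_distrib flip: power_mult) 
    also have "v \<dots> = v (c * t)"
    proof -
      have "v ((t ^ q) ^ m) = v (e ^ m)" using t0 e by (intro antisym v_power_mono) auto
      then show ?thesis using b e t0 unfolding c_def by (simp add: v_mult del: power_mult)
    qed
    finally show ?thesis using x0 c t0 by (intro antisym v_power_mono) auto
  qed
  have "0 < l" using l(2) by (intro gr0I) simp
  then have "0 < v (c * t)" using pow[of 1] x0 x(2) by (simp add: v_power_pos_iff[symmetric])
  moreover have "v (c ^ i) \<le> v a"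
  proof -
    have "v ((c * t) ^ i) = v (x ^ (l * i))" using pow[of i] by (simp add: power_mult)
    also have "\<dots> \<le> v (x ^ (q * i))" using x0 x(2) l(1) by (intro v_power_mono_exp) auto
    also have "\<dots> \<le> v (z ^ (q * i))" using x0 z x by (intro v_power_mono) auto
    also have "\<dots> \<le> v (a * t ^ i)" by (rule z(3))
    finally show ?thesis using c t0 * by (simp add: v_mult power_mult_distrib)
  qed
  ultimately show "\<exists>c\<in>K. c \<noteq> 0 \<and> 0 < v (c * t) \<and> v (c ^ i) \<le> v a" using c by blast
qed

text \<open>In the nonprincipal case every class is good and \<open>j = 1\<close> serves. In the
  principal case an outside element below a generator is itself a generator, and its class dictates
  \<open>j\<close>.\<close>

lemma ex_good:
  assumes t: "outside t"
  obtains j where "0 < j" "j < q" "good (t ^ j)"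
proof (cases "principal_M")
  case False
  then show ?thesis using that[of 1] good_if_nonprincipal[OF False t] q_ge_2 by simp
next
  case True
  then obtain m where m: "m \<in> \<M>" "m \<noteq> 0" "\<And>x. x \<in> \<M> \<Longrightarrow> x / m \<in> OE K v" unfolding principal_iff by blast
  obtain x where x: "outside x" "0 < v x" "v x \<le> v m" using M_cofinal[OF m(1,2)] .
  have x0: "x \<noteq> 0" using x by (simp add: outside_def)
  obtain b j where b: "b \<in> K" "b \<noteq> 0" "j < q" "v x = v (b * t ^ j)" using ex_monomial[OF t x0] .
  have t0: "t \<noteq> 0" using t by (simp add: outside_def)
  have "0 < j" using b x(1) Gamma_v[of b] by (intro gr0I) (auto simp: outside_def)
  have "good (b * t ^ j)"
  proof (rule good_if_principal)
    show "outside (b * t ^ j)" using b x t0 by (simp add: outside_def)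
    then show "b * t ^ j \<in> \<M>" using b x by (intro outside_in_M) auto
    fix y assume "y \<in> \<M>"
    interpret E: subring_set "OE K v" by (rule OE_subring)
    have "m / (b * t ^ j) \<in> OE K v"
      using b x t0 m(2) by (intro O_subset_OE) (simp add: divide_in_O_iff)
    from E.mult_in[OF m(3)[OF \<open>y \<in> \<M>\<close>] this] show "y / (b * t ^ j) \<in> OE K v"
      using m(2) by simp
  qed
  from good_scale[OF this b(1,2)] show ?thesis using that \<open>0 < j\<close> b(3) by blast
qed

section \<open>From values to unions of simple ring extensions\<close>

definition generates_O :: "'l \<Rightarrow> bool" where
  "generates_O t \<longleftrightarrow> \<O> = (\<Union>c\<in>{c\<in>K. val_gt v (c * t) 0}. adjoin \<A> (c * t))"

lemma adjoin_A: "adjoin \<A> x = {poly p x | p. p \<in> polys_over \<A>}"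
  by (rule adjoin_eq[OF A_subring])

text \<open>Substituting \<open>c' / c\<close> times the variable stays over \<A>. So the rings grow
  as the value of the scaling factor decreases, and the union in \<open>generates_O\<close> is
  directed.\<close>

lemma adjoin_mono:
  assumes "c \<in> K" "c \<noteq> 0" "c' \<in> K" "val_ge v c' (v c)" "y \<in> adjoin \<A> (c' * t)"
  shows "y \<in> adjoin \<A> (c * t)"
proof -
  obtain p where p: "p \<in> polys_over \<A>" "y = poly p (c' * t)" using assms(5) by (auto simp: adjoin_A)
  have "c' / c \<in> \<A>" using assms by (auto simp: A_iff K_divide divide_in_O_iff)
  then have "p \<circ>\<^sub>p [:0, c' / c:] \<in> polys_over \<A>" using p by (intro A.scale_polys_over)
  moreover have "y = poly (p \<circ>\<^sub>p [:0, c' / c:]) (c * t)" using p assms by (simp add: poly_pcompose mult.commute)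
  ultimately show ?thesis by (auto simp: adjoin_A)
qed

lemma ex_small_multiple:
  assumes t: "outside t" obtains c where "c \<in> K" "c \<noteq> 0" "0 < v (c * t)"
proof (cases "0 < v t")
  case True
  then show ?thesis using that[of 1] K.one_in by auto
next
  case False
  have t0: "t \<noteq> 0" using t by (simp add: outside_def)
  have neg: "v t < 0" using False t Gamma_0 by (metis less_linear outside_def)
  obtain e where e: "e \<in> K" "e \<noteq> 0" "v (t ^ q) = v e" using power_q_Gamma[OF t0] by (auto simp: Gamma_iff)
  have "t ^ q = t * t ^ (q - 1)" using q_pos by (simp flip: power_Suc)
  then have "v e = v t + v (t ^ (q - 1))" using e t0 by (simp add: v_mult)
  \<comment> \<open>For negative \<open>v t\<close>, dividing by \<open>e\<close>, which has the
    value of \<open>t ^ q\<close>, turns \<open>v t\<close> into \<open>- (q - 1)\<close> times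
    \<open>v t\<close>.\<close>
  then have "v (inverse e * t) = v (inverse t ^ (q - 1))"
    using e(2) t0 by (simp add: v_mult v_inverse power_inverse)
  moreover have "0 < v (inverse t ^ (q - 1))"
    using neg t0 q_ge_2 by (subst v_power_pos_iff) (auto simp: v_inverse)
  ultimately show ?thesis using that[of "inverse e"] e K_inverse by simp
qed

lemma good_generates:
  assumes g: "good t" shows "generates_O t"
  unfolding generates_O_def
proof (intro equalityI subsetI)
  fix y assume "y \<in> (\<Union>c\<in>{c\<in>K. val_gt v (c * t) 0}. adjoin \<A> (c * t))"
  then obtain c p where c: "val_gt v (c * t) 0" "p \<in> polys_over \<A>" "y = poly p (c * t)"
    by (auto simp: adjoin_A)
  then have "c * t \<in> \<O>" by (auto simp: O_iff val_gt_def)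
  moreover have "p \<in> polys_over \<O>" using c(2) by (auto simp: polys_over_def A_iff)
  ultimately show "y \<in> \<O>" using O.poly_in c(3) by auto
next
  fix y assume y: "y \<in> \<O>"
  have t: "outside t" using g by (simp add: good_def)
  then have t0: "t \<noteq> 0" by (simp add: outside_def)
  obtain p where p: "p \<in> polys_over K" "degree p < q" "poly p t = y" using ex_poly[OF t] .
  have ge: "val_ge v (coeff p i * t ^ i) 0" for i
    using val_ge_poly_iff[OF t p(1,2), of 0] y p(3) by (auto simp: val_ring_def)
  have pK: "coeff p i \<in> K" for i using p(1) by (simp add: polys_over_def)
  \<comment> \<open>Goodness treats one coefficient at a time; the induction on \<open>n\<close>
    merges the scaling factors of the first \<open>n\<close> coefficients into one.\<close>
  have "\<exists>c\<in>K. c \<noteq> 0 \<and> 0 < v (c * t) \<and> (\<forall>i<n. coeff p i / c ^ i \<in> \<A>)" for n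
  proof (induction n)
    case 0
    then show ?case using ex_small_multiple[OF t] by (metis less_nat_zero_code)
  next
    case (Suc n)
    then obtain c where c: "c \<in> K" "c \<noteq> 0" "0 < v (c * t)" "\<And>i. i < n \<Longrightarrow> coeff p i / c ^ i \<in> \<A>" by blast
    show ?case
    proof (cases "coeff p n / c ^ n \<in> \<A>")
      case True
      then show ?thesis using c by (auto simp: less_Suc_eq)
    next
      case False
      have p0: "coeff p n \<noteq> 0" using False A.zero_in by auto
      have "n \<noteq> 0" using False ge[of 0] pK[of 0] by (intro notI) (auto simp: A_iff val_ring_def)
      have "n < q" using p0 p(2) le_degree[of p n] by simp
      have "outside (coeff p n * t ^ n)" using \<open>n \<noteq> 0\<close> \<open>n < q\<close> p0 pK t by (intro outside_monomial) auto
      \<comment> \<open>Integrality gives only a nonnegative value; 0 is excluded because the term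
        is outside while 0 lies in \<Gamma>.\<close>
      then have "v (coeff p n * t ^ n) \<noteq> 0" using Gamma_0 by (auto simp: outside_def)
      then have "0 < v (coeff p n * t ^ n)" using ge[of n] p0 t0 by simp
      then obtain c' where c': "c' \<in> K" "c' \<noteq> 0" "0 < v (c' * t)" "v (c' ^ n) \<le> v (coeff p n)"
        using g \<open>n \<noteq> 0\<close> \<open>n < q\<close> p0 pK unfolding good_def by blast
      have in_A: "coeff p n / c' ^ n \<in> \<A>"
        using c' p0 pK by (auto simp: A_iff divide_in_O_iff intro: K_divide K.power_in)
      have "v (c ^ n) \<le> v (coeff p n) \<Longrightarrow> False"
        using False c p0 pK by (auto simp: A_iff divide_in_O_iff intro: K_divide K.power_in)
      \<comment> \<open>The new factor has smaller value than the old one, so the earlier quotients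
        remain integral when \<open>c\<close> is replaced by it.\<close>
      then have "\<not> v c \<le> v c'" using v_power_mono[of c c' n] c c' by (meson order_trans)
      then have "c / c' \<in> \<A>" using c c' by (auto simp: A_iff divide_in_O_iff K_divide)
      have "coeff p i / c' ^ i \<in> \<A>" if "i < n" for i
        using A.mult_in[OF c(4)[OF that] A.power_in[OF \<open>c / c' \<in> \<A>\<close>, of i]] c(2)
        by (simp add: power_divide)
      then show ?thesis using c' in_A by (auto simp: less_Suc_eq)
    qed
  qed
  then obtain c where c: "c \<in> K" "c \<noteq> 0" "0 < v (c * t)" "\<And>i. i < q \<Longrightarrow> coeff p i / c ^ i \<in> \<A>" by blast
  have "coeff p i / c ^ i \<in> \<A>" for i
    using c(4)[of i] p(2) A.zero_in by (cases "i < q") (auto simp: coeff_eq_0)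
  then have "p \<circ>\<^sub>p [:0, inverse c:] \<in> polys_over \<A>"
    by (simp add: polys_over_def coeff_pcompose_linear divide_inverse power_inverse mult.commute)
  moreover have "y = poly (p \<circ>\<^sub>p [:0, inverse c:]) (c * t)"
    using c(2) p(3) by (simp add: poly_pcompose field_simps)
  ultimately have "y \<in> adjoin \<A> (c * t)" by (auto simp: adjoin_A)
  moreover have "val_gt v (c * t) 0" using c by (simp add: val_gt_def)
  ultimately show "y \<in> (\<Union>c\<in>{c\<in>K. val_gt v (c * t) 0}. adjoin \<A> (c * t))" using c(1) by blast
qed

text \<open>Write an outside \<open>x\<close> below \<open>m\<close> as a polynomial in
  \<open>c * t\<close>. Its constant coefficient lies in \<open>K\<close> and cannot account for the
  value of \<open>x\<close>, so \<open>x\<close> has at least the value of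
  \<open>c * t\<close>.\<close>

lemma generates_O_cofinal:
  assumes t: "outside t" "generates_O t" and m: "m \<in> \<M>" "m \<noteq> 0"
  obtains c where "c \<in> K" "c \<noteq> 0" "0 < v (c * t)" "v (c * t) \<le> v m"
proof -
  obtain x where x: "outside x" "0 < v x" "v x \<le> v m" using M_cofinal[OF m] .
  have x0: "x \<noteq> 0" "v x \<notin> \<Gamma>" using x by (auto simp: outside_def)
  have "x \<in> \<O>" using x by (simp add: O_iff less_imp_le)
  then obtain c p where c: "c \<in> K" "val_gt v (c * t) 0" "p \<in> polys_over \<A>" "x = poly p (c * t)"
    using t(2) unfolding generates_O_def by (auto simp: adjoin_A)
  have p0: "coeff p 0 \<in> K" using c(3) by (auto simp: polys_over_def A_iff)
  have t0: "t \<noteq> 0" using t by (simp add: outside_def)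
  obtain a p' where p': "p = pCons a p'" by (cases p)
  have a: "a \<in> K" using p0 p' by simp
  have x_eq: "x = a + c * t * poly p' (c * t)" using c(4) p' by simp
  have "c \<noteq> 0"
  proof
    assume "c = 0"
    then have "x = a" using x_eq by simp
    then show False using x0 a Gamma_v by auto
  qed
  then have pos: "0 < v (c * t)" using c(2) t0 by simp
  have "poly p' (c * t) \<in> \<O>"
    using c(3) p' pos by (intro O.poly_in) (auto simp: polys_over_def A_iff O_iff coeff_pCons split: nat.splits)
  then have ge: "val_ge v (c * t * poly p' (c * t)) (v (c * t))"
    using val_ge_mult[of "c * t" "v (c * t)" "poly p' (c * t)" 0] \<open>c \<noteq> 0\<close> t0 by (simp add: val_ring_def)
  have "v (c * t) \<le> v x"
  proof (rule ccontr)
    assume "\<not> ?thesis"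
    then have "val_gt v (- (c * t * poly p' (c * t))) (v x)"
      using ge by (auto simp: val_ge_def val_gt_def)
    from v_add_eq[OF x0(1) this] have "a \<noteq> 0" "v a = v x" using x_eq by auto
    then show False using x0 a Gamma_v by metis
  qed
  then show ?thesis using that[of c] c \<open>c \<noteq> 0\<close> pos x(3) by auto
qed

text \<open>This permits computing with finitely many elements in a single \<open>\<A>[u]\<close>,
  with \<open>u\<close> as small in \<M> as desired.\<close>

lemma generates_O_directed:
  assumes t: "outside t" "generates_O t" and Y: "finite Y" "Y \<subseteq> \<O>" and m: "m \<in> \<M>" "m \<noteq> 0"
  obtains c where "c \<in> K" "c \<noteq> 0" "0 < v (c * t)" "v (c * t) \<le> v m" "Y \<subseteq> adjoin \<A> (c * t)"
proof -
  have t0: "t \<noteq> 0" using t by (simp add: outside_def)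
  have "\<exists>c\<in>K. c \<noteq> 0 \<and> 0 < v (c * t) \<and> v (c * t) \<le> v m \<and> Y \<subseteq> adjoin \<A> (c * t)"
    using Y
  proof (induction Y rule: finite_induct)
    case empty
    then show ?case using generates_O_cofinal[OF t m] by (metis empty_subsetI)
  next
    case (insert y Y)
    then obtain c where c: "c \<in> K" "c \<noteq> 0" "0 < v (c * t)" "v (c * t) \<le> v m" "Y \<subseteq> adjoin \<A> (c * t)" by auto
    have "y \<in> \<O>" using insert by simp
    then obtain c' where c': "c' \<in> K" "val_gt v (c' * t) 0" "y \<in> adjoin \<A> (c' * t)"
      using t(2) unfolding generates_O_def by auto
    show ?case
    proof (cases "val_ge v c' (v c)")
      case True
      then show ?thesis using adjoin_mono[OF c(1,2) c'(1) True c'(3)] c by auto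
    next
      case False
      then have c'0: "c' \<noteq> 0" and less: "v c' < v c" by (auto simp: val_ge_def)
      have "Y \<subseteq> adjoin \<A> (c' * t)"
        using adjoin_mono[OF c'(1) c'0 c(1), of _ t] c(2,5) less_imp_le[OF less] by auto
      moreover have "v (c' * t) \<le> v m" using less c c'0 t0 by (simp add: v_mult) (meson add_right_mono less_imp_le order_trans)
      ultimately show ?thesis using c' c'0 t0 by auto
    qed
  qed
  then show ?thesis using that by blast
qed

end

section \<open>Isomorphisms of quotient modules\<close>

lemma quot_module_facts:
  fixes R (structure) and M (structure)
  assumes M: "Module.module R M" and N: "submodule N R M"
  shows quot_smult: "a \<in> carrier R \<Longrightarrow> x \<in> carrier M \<Longrightarrow>
      a \<odot>\<^bsub>quot_module M N\<^esub> (N +>\<^bsub>M\<^esub> x) = N +>\<^bsub>M\<^esub> (a \<odot>\<^bsub>M\<^esub> x)"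
    and quot_add: "x \<in> carrier M \<Longrightarrow> y \<in> carrier M \<Longrightarrow>
      (N +>\<^bsub>M\<^esub> x) \<oplus>\<^bsub>quot_module M N\<^esub> (N +>\<^bsub>M\<^esub> y) = N +>\<^bsub>M\<^esub> (x \<oplus>\<^bsub>M\<^esub> y)"
    and quot_carrier: "carrier (quot_module M N) = (\<lambda>x. N +>\<^bsub>M\<^esub> x) ` carrier M"
    and quot_zero: "\<zero>\<^bsub>quot_module M N\<^esub> = N"
    and quot_eq_iff: "x \<in> carrier M \<Longrightarrow> y \<in> carrier M \<Longrightarrow>
      N +>\<^bsub>M\<^esub> x = N +>\<^bsub>M\<^esub> y \<longleftrightarrow> (\<exists>h\<in>N. x = h \<oplus>\<^bsub>M\<^esub> y)"
    and quot_eq_zero_iff: "x \<in> carrier M \<Longrightarrow> N +>\<^bsub>M\<^esub> x = N \<longleftrightarrow> x \<in> N"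
proof -
  interpret Module.module R M by fact
  interpret N: submodule N R M by fact
  note E = submoduleE[OF N]
  interpret A: abelian_subgroup N M
    by (rule abelian_subgroupI3) (auto intro: additive_subgroup.intro submodule.axioms(1) N M.abelian_group_axioms)
  show eq: "N +>\<^bsub>M\<^esub> x = N +>\<^bsub>M\<^esub> y \<longleftrightarrow> (\<exists>h\<in>N. x = h \<oplus>\<^bsub>M\<^esub> y)"
    if "x \<in> carrier M" "y \<in> carrier M" for x y
  proof
    assume "N +>\<^bsub>M\<^esub> x = N +>\<^bsub>M\<^esub> y"
    then have "x \<in> N +>\<^bsub>M\<^esub> y" using A.a_rcos_self[OF that(1)] by simp
    then show "\<exists>h\<in>N. x = h \<oplus>\<^bsub>M\<^esub> y" by (auto simp: a_r_coset_def')
  next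
    assume "\<exists>h\<in>N. x = h \<oplus>\<^bsub>M\<^esub> y"
    then have "x \<in> N +>\<^bsub>M\<^esub> y" by (auto simp: a_r_coset_def')
    then show "N +>\<^bsub>M\<^esub> x = N +>\<^bsub>M\<^esub> y"
      by (intro a_repr_independence[symmetric] that A.a_subgroup)
  qed
  show "a \<odot>\<^bsub>quot_module M N\<^esub> (N +>\<^bsub>M\<^esub> x) = N +>\<^bsub>M\<^esub> (a \<odot>\<^bsub>M\<^esub> x)"
    if a: "a \<in> carrier R" and x: "x \<in> carrier M" for a x
  proof -
    have "N +>\<^bsub>M\<^esub> (a \<odot>\<^bsub>M\<^esub> y) = N +>\<^bsub>M\<^esub> (a \<odot>\<^bsub>M\<^esub> x)" if y: "y \<in> N +>\<^bsub>M\<^esub> x" for y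
    proof -
      obtain h where h: "h \<in> N" "y = h \<oplus>\<^bsub>M\<^esub> x" using y by (auto simp: a_r_coset_def')
      have hc: "h \<in> carrier M" using h E(1) by auto
      have yc: "y \<in> carrier M" using h hc x by simp
      have "a \<odot>\<^bsub>M\<^esub> y = a \<odot>\<^bsub>M\<^esub> h \<oplus>\<^bsub>M\<^esub> a \<odot>\<^bsub>M\<^esub> x"
        using h hc a x by (simp add: smult_r_distr)
      moreover have "a \<odot>\<^bsub>M\<^esub> h \<in> N" using h a by (intro N.smult_closed)
      ultimately show ?thesis using eq[of "a \<odot>\<^bsub>M\<^esub> y" "a \<odot>\<^bsub>M\<^esub> x"] a x yc by auto
    qed
    then have "(\<Union>y\<in>N +>\<^bsub>M\<^esub> x. N +>\<^bsub>M\<^esub> (a \<odot>\<^bsub>M\<^esub> y)) = (\<Union>y\<in>N +>\<^bsub>M\<^esub> x. N +>\<^bsub>M\<^esub> (a \<odot>\<^bsub>M\<^esub> x))"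
      by (rule SUP_cong[OF refl])
    also have "\<dots> = N +>\<^bsub>M\<^esub> (a \<odot>\<^bsub>M\<^esub> x)"
      using A.a_rcos_self[OF x] by blast
    finally show ?thesis by (simp add: quot_module_def)
  qed
  show "(N +>\<^bsub>M\<^esub> x) \<oplus>\<^bsub>quot_module M N\<^esub> (N +>\<^bsub>M\<^esub> y) = N +>\<^bsub>M\<^esub> (x \<oplus>\<^bsub>M\<^esub> y)"
    if "x \<in> carrier M" "y \<in> carrier M"
    using that by (simp add: quot_module_def A.a_rcos_sum)
  show "carrier (quot_module M N) = (\<lambda>x. N +>\<^bsub>M\<^esub> x) ` carrier M"
    by (auto simp: quot_module_def A_RCOSETS_def' a_r_coset_def')
  show "\<zero>\<^bsub>quot_module M N\<^esub> = N" by (simp add: quot_module_def)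
  have z: "N +>\<^bsub>M\<^esub> \<zero>\<^bsub>M\<^esub> = N" using M.a_coset_add_zero[OF E(1)] .
  show "N +>\<^bsub>M\<^esub> x = N \<longleftrightarrow> x \<in> N" if "x \<in> carrier M"
    using eq[OF that M.zero_closed] that E(1) by (auto simp: z)
qed

text \<open>Requiring \<open>N1\<close> to be the full preimage of \<open>N2\<close> makes
  well-definedness and injectivity the two directions of one equivalence.\<close>

lemma quot_module_iso:
  fixes R (structure) and M1 (structure) and M2 (structure)
  assumes M1: "Module.module R M1" and M2: "Module.module R M2"
    and N1: "submodule N1 R M1" and N2: "submodule N2 R M2"
    and closed: "\<And>x. x \<in> carrier M1 \<Longrightarrow> \<phi> x \<in> carrier M2"
    and add: "\<And>x y. x \<in> carrier M1 \<Longrightarrow> y \<in> carrier M1 \<Longrightarrow> \<phi> (x \<oplus>\<^bsub>M1\<^esub> y) = \<phi> x \<oplus>\<^bsub>M2\<^esub> \<phi> y"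
    and smult: "\<And>a x. a \<in> carrier R \<Longrightarrow> x \<in> carrier M1 \<Longrightarrow> \<phi> (a \<odot>\<^bsub>M1\<^esub> x) = a \<odot>\<^bsub>M2\<^esub> \<phi> x"
    and ker: "\<And>x. x \<in> carrier M1 \<Longrightarrow> \<phi> x \<in> N2 \<longleftrightarrow> x \<in> N1"
    and surj: "\<And>y. y \<in> carrier M2 \<Longrightarrow> \<exists>x\<in>carrier M1. \<phi> x = y"
  shows "module_isomorphic R (quot_module M1 N1) (quot_module M2 N2)"
proof -
  interpret M1: Module.module R M1 by fact
  interpret M2: Module.module R M2 by fact
  note S1 = M1.submoduleE(1)[OF N1] and S2 = M2.submoduleE(1)[OF N2]
  note Q1 = quot_module_facts[OF M1 N1] and Q2 = quot_module_facts[OF M2 N2]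
  have eq: "N2 +>\<^bsub>M2\<^esub> \<phi> x = N2 +>\<^bsub>M2\<^esub> \<phi> y \<longleftrightarrow> N1 +>\<^bsub>M1\<^esub> x = N1 +>\<^bsub>M1\<^esub> y"
    if x: "x \<in> carrier M1" and y: "y \<in> carrier M1" for x y
  proof
    assume "N1 +>\<^bsub>M1\<^esub> x = N1 +>\<^bsub>M1\<^esub> y"
    then obtain h where h: "h \<in> N1" "x = h \<oplus>\<^bsub>M1\<^esub> y" using Q1(5)[OF x y] by auto
    then have "\<phi> x = \<phi> h \<oplus>\<^bsub>M2\<^esub> \<phi> y" "\<phi> h \<in> N2" using add[of h y] ker[of h] S1 y by auto
    then show "N2 +>\<^bsub>M2\<^esub> \<phi> x = N2 +>\<^bsub>M2\<^esub> \<phi> y" using Q2(5)[OF closed[OF x] closed[OF y]] by auto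
  next
    assume "N2 +>\<^bsub>M2\<^esub> \<phi> x = N2 +>\<^bsub>M2\<^esub> \<phi> y"
    then obtain h where h: "h \<in> N2" "\<phi> x = h \<oplus>\<^bsub>M2\<^esub> \<phi> y"
      using Q2(5)[OF closed[OF x] closed[OF y]] by auto
    define z where "z = x \<oplus>\<^bsub>M1\<^esub> (\<ominus>\<^bsub>M1\<^esub> y)"
    have z: "z \<in> carrier M1" using x y by (simp add: z_def)
    have xz: "x = z \<oplus>\<^bsub>M1\<^esub> y" using x y by (simp add: z_def M1.a_assoc M1.l_neg)
    then have "\<phi> z \<oplus>\<^bsub>M2\<^esub> \<phi> y = h \<oplus>\<^bsub>M2\<^esub> \<phi> y" using h add[OF z y] by simp
    then have "\<phi> z = h" using M2.add.r_cancel closed[OF z] closed[OF y] h S2 by auto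
    then have "z \<in> N1" using ker[OF z] h by simp
    then show "N1 +>\<^bsub>M1\<^esub> x = N1 +>\<^bsub>M1\<^esub> y" using Q1(5)[OF x y] xz by blast
  qed
  \<comment> \<open>A representative is chosen in each coset; by \<open>eq\<close> the image coset
    does not depend on it.\<close>
  define f where "f = (\<lambda>C. N2 +>\<^bsub>M2\<^esub> \<phi> (SOME x. x \<in> carrier M1 \<and> C = N1 +>\<^bsub>M1\<^esub> x))"
  have f: "f (N1 +>\<^bsub>M1\<^esub> x) = N2 +>\<^bsub>M2\<^esub> \<phi> x" if x: "x \<in> carrier M1" for x
  proof -
    have "\<exists>y. y \<in> carrier M1 \<and> N1 +>\<^bsub>M1\<^esub> x = N1 +>\<^bsub>M1\<^esub> y" using x by blast
    from someI_ex[OF this] show ?thesis unfolding f_def using eq[OF x] by blast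
  qed
  have inj: "inj_on f (carrier (quot_module M1 N1))"
    unfolding Q1(3) by (rule inj_onI) (auto simp: f eq)
  have img: "f ` carrier (quot_module M1 N1) = carrier (quot_module M2 N2)"
    unfolding Q1(3) Q2(3) image_image using surj closed
    by (auto simp: f image_iff)
  show ?thesis
    unfolding module_isomorphic_def
  proof (intro exI[of _ f] conjI ballI)
    show "bij_betw f (carrier (quot_module M1 N1)) (carrier (quot_module M2 N2))"
      using inj img by (simp add: bij_betw_def)
    fix C assume "C \<in> carrier (quot_module M1 N1)"
    then obtain x where x: "x \<in> carrier M1" "C = N1 +>\<^bsub>M1\<^esub> x" by (auto simp: Q1(3))
    show "f (C \<oplus>\<^bsub>quot_module M1 N1\<^esub> D) = f C \<oplus>\<^bsub>quot_module M2 N2\<^esub> f D"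
      if D: "D \<in> carrier (quot_module M1 N1)" for D
    proof -
      obtain y where y: "y \<in> carrier M1" "D = N1 +>\<^bsub>M1\<^esub> y" using D by (auto simp: Q1(3))
      show ?thesis
        unfolding x(2) y(2) Q1(2)[OF x(1) y(1)] f[OF x(1)] f[OF y(1)] f[OF M1.a_closed[OF x(1) y(1)]]
          add[OF x(1) y(1)] Q2(2)[OF closed[OF x(1)] closed[OF y(1)]] ..
    qed
    show "f (a \<odot>\<^bsub>quot_module M1 N1\<^esub> C) = a \<odot>\<^bsub>quot_module M2 N2\<^esub> f C" if a: "a \<in> carrier R" for a
      unfolding x(2) Q1(1)[OF a x(1)] f[OF x(1)] f[OF M1.smult_closed[OF a x(1)]]
        smult[OF a x(1)] Q2(1)[OF a closed[OF x(1)]] ..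
  qed
qed

lemma module_isomorphic_trans:
  assumes "module_isomorphic R M N" "module_isomorphic R N P"
  shows "module_isomorphic R M P"
proof -
  obtain f where f: "bij_betw f (carrier M) (carrier N)"
      "\<forall>x\<in>carrier M. \<forall>y\<in>carrier M. f (x \<oplus>\<^bsub>M\<^esub> y) = f x \<oplus>\<^bsub>N\<^esub> f y"
      "\<forall>r\<in>carrier R. \<forall>x\<in>carrier M. f (r \<odot>\<^bsub>M\<^esub> x) = r \<odot>\<^bsub>N\<^esub> f x"
    using assms(1) unfolding module_isomorphic_def by blast
  obtain g where g: "bij_betw g (carrier N) (carrier P)"
      "\<forall>x\<in>carrier N. \<forall>y\<in>carrier N. g (x \<oplus>\<^bsub>N\<^esub> y) = g x \<oplus>\<^bsub>P\<^esub> g y"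
      "\<forall>r\<in>carrier R. \<forall>x\<in>carrier N. g (r \<odot>\<^bsub>N\<^esub> x) = r \<odot>\<^bsub>P\<^esub> g x"
    using assms(2) unfolding module_isomorphic_def by blast
  have "f x \<in> carrier N" if "x \<in> carrier M" for x using f(1) that by (auto simp: bij_betw_def)
  then show ?thesis
    unfolding module_isomorphic_def using bij_betw_trans[OF f(1) g(1)] f(2,3) g(2,3)
    by (intro exI[of _ "g \<circ> f"]) auto
qed

lemma module_isomorphic_zero:
  assumes "module_isomorphic R M N" "\<zero>\<^bsub>M\<^esub> \<in> carrier M" "\<zero>\<^bsub>N\<^esub> \<in> carrier N"
  shows "carrier M = {\<zero>\<^bsub>M\<^esub>} \<longleftrightarrow> carrier N = {\<zero>\<^bsub>N\<^esub>}"
proof -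
  obtain f where f: "bij_betw f (carrier M) (carrier N)"
    using assms(1) unfolding module_isomorphic_def by blast
  then have inj: "inj_on f (carrier M)" and img: "f ` carrier M = carrier N"
    by (auto simp: bij_betw_def)
  show ?thesis
  proof
    assume "carrier M = {\<zero>\<^bsub>M\<^esub>}"
    then have "carrier N = {f \<zero>\<^bsub>M\<^esub>}" using img by auto
    then show "carrier N = {\<zero>\<^bsub>N\<^esub>}" using assms(3) by auto
  next
    assume N: "carrier N = {\<zero>\<^bsub>N\<^esub>}"
    have "x = \<zero>\<^bsub>M\<^esub>" if "x \<in> carrier M" for x
    proof (rule inj_onD[OF inj _ that assms(2)])
      have "f y = \<zero>\<^bsub>N\<^esub>" if "y \<in> carrier M" for y
      proof -
        have "f y \<in> f ` carrier M" using that by (rule imageI)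
        then show ?thesis unfolding img N by simp
      qed
      then show "f x = f \<zero>\<^bsub>M\<^esub>" using that assms(2) by simp
    qed
    then show "carrier M = {\<zero>\<^bsub>M\<^esub>}" using assms(2) by blast
  qed
qed

lemma quot_module_trivial_iff:
  assumes "Module.module R M" "submodule N R M"
  shows "carrier (quot_module M N) = {\<zero>\<^bsub>quot_module M N\<^esub>} \<longleftrightarrow> carrier M = N"
    and "\<zero>\<^bsub>quot_module M N\<^esub> \<in> carrier (quot_module M N)"
proof -
  interpret Module.module R M by fact
  note Q = quot_module_facts[OF assms]
  note E = submoduleE[OF assms(2)]
  have zero: "\<zero>\<^bsub>M\<^esub> \<in> N" using submodule.axioms(1)[OF assms(2)] by (auto dest: subgroup.one_closed)
  have "N +>\<^bsub>M\<^esub> \<zero>\<^bsub>M\<^esub> = N" using Q(6)[of "\<zero>\<^bsub>M\<^esub>"] zero by simp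
  then show c: "\<zero>\<^bsub>quot_module M N\<^esub> \<in> carrier (quot_module M N)"
    unfolding Q(3,4) by (metis M.zero_closed image_eqI)
  have "carrier (quot_module M N) = {N} \<longleftrightarrow> (\<forall>x\<in>carrier M. N +>\<^bsub>M\<^esub> x = N)"
    using c unfolding Q(3,4) by auto
  also have "\<dots> \<longleftrightarrow> carrier M = N" using Q(6) E(1) by blast
  finally show "carrier (quot_module M N) = {\<zero>\<^bsub>quot_module M N\<^esub>} \<longleftrightarrow> carrier M = N"
    by (simp add: Q(4))
qed

lemma ideal_module_simps [simp]:
  "carrier (ideal_module R I) = I" "x \<oplus>\<^bsub>ideal_module R I\<^esub> y = x \<oplus>\<^bsub>R\<^esub> y"
  "a \<odot>\<^bsub>ideal_module R I\<^esub> x = a \<otimes>\<^bsub>R\<^esub> x" "\<zero>\<^bsub>ideal_module R I\<^esub> = \<zero>\<^bsub>R\<^esub>"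
  by (simp_all add: ideal_module_def)

context valued_field
begin

lemma ideal_module_is_module:
  assumes I: "O_ideal I" shows "Module.module (OL v) (ideal_module (OL v) I)"
proof (rule moduleI[OF cring_set_ring[OF O_subring]])
  show "abelian_group (ideal_module (OL v) I)"
  proof (rule abelian_groupI)
    fix x assume "x \<in> carrier (ideal_module (OL v) I)"
    then show "\<exists>y\<in>carrier (ideal_module (OL v) I). y \<oplus>\<^bsub>ideal_module (OL v) I\<^esub> x = \<zero>\<^bsub>ideal_module (OL v) I\<^esub>"
      using O_idealD(5)[OF I] by (intro bexI[of _ "- x"]) auto
  qed (use O_idealD[OF I] in auto)
qed (use O_idealD[OF I] in \<open>auto simp: algebra_simps\<close>)

lemma ideal_submodule:
  assumes I: "O_ideal I" and J: "O_ideal J" "J \<subseteq> I"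
  shows "submodule J (OL v) (ideal_module (OL v) I)"
proof -
  interpret Module.module "OL v" "ideal_module (OL v) I" by (rule ideal_module_is_module[OF I])
  have "\<ominus>\<^bsub>ideal_module (OL v) I\<^esub> x = - x" if "x \<in> J" for x
    using M.l_neg[of x] that J(2) by (auto simp: eq_neg_iff_add_eq_0)
  then show ?thesis
    using J O_idealD[OF J(1)] by (intro submoduleI) auto
qed

lemma ideal_quot_scale_iso:
  assumes I: "O_ideal I" and J: "O_ideal J" "J \<subseteq> I" and a: "a \<in> \<O>" "a \<noteq> 0"
  shows "module_isomorphic (OL v) (ideal_quot (OL v) I J)
    (ideal_quot (OL v) (scale_ideal a I) (scale_ideal a J))"
  using a
  by (intro quot_module_iso[where \<phi> = "(*) a"] ideal_module_is_module ideal_submodule O_ideal_scale I J)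
    (use J in \<open>auto simp: algebra_simps\<close>)

end


section \<open>The module of differentials as a quotient of ideals\<close>

lemma free_module_simps [simp]:
  "f \<oplus>\<^bsub>free_module R V\<^esub> g = (\<lambda>x. f x \<oplus>\<^bsub>R\<^esub> g x)"
  "a \<odot>\<^bsub>free_module R V\<^esub> f = (\<lambda>x. a \<otimes>\<^bsub>R\<^esub> f x)"
  by (simp_all add: free_module_def)

context valued_field
begin

abbreviation "F \<equiv> free_module (OL v) \<O>"

lemma F_iff: "f \<in> carrier F \<longleftrightarrow> (\<forall>x. f x \<in> \<O>) \<and> (\<forall>x. x \<notin> \<O> \<longrightarrow> f x = 0) \<and> finite {x. f x \<noteq> 0}"
  using O.zero_in by (auto simp: free_module_def)

lemma F_module: "Module.module (OL v) F"
  by (rule free_module_is_module[OF cring_set_ring[OF O_subring]])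

lemma free_gen_F: "x \<in> \<O> \<Longrightarrow> free_gen (OL v) x \<in> carrier F"
proof -
  assume x: "x \<in> \<O>"
  have "finite {y. free_gen (OL v) x y \<noteq> 0}"
    by (rule finite_subset[of _ "{x}"]) (auto simp: free_gen_def)
  then show ?thesis using x O.zero_in O.one_in by (auto simp: F_iff free_gen_def)
qed

text \<open>The linear map on the free module that sends the symbol \<open>dx\<close> to
  \<open>D x\<close>.\<close>

definition evaluate :: "('l \<Rightarrow> 'l) \<Rightarrow> ('l \<Rightarrow> 'l) \<Rightarrow> 'l" where
  "evaluate D f = (\<Sum>x\<in>{x. f x \<noteq> 0}. f x * D x)"

lemma evaluate_eq: "finite S \<Longrightarrow> {x. f x \<noteq> 0} \<subseteq> S \<Longrightarrow> evaluate D f = (\<Sum>x\<in>S. f x * D x)"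
  unfolding evaluate_def by (rule sum.mono_neutral_left) auto

lemma evaluate_add:
  assumes "f \<in> carrier F" "g \<in> carrier F"
  shows "evaluate D (f \<oplus>\<^bsub>F\<^esub> g) = evaluate D f + evaluate D g"
proof -
  define S where "S = {x. f x \<noteq> 0} \<union> {x. g x \<noteq> 0}"
  have S: "finite S" using assms by (auto simp: S_def F_iff)
  have "{x. (f \<oplus>\<^bsub>F\<^esub> g) x \<noteq> 0} \<subseteq> S" by (auto simp: S_def)
  from evaluate_eq[OF S this] have "evaluate D (f \<oplus>\<^bsub>F\<^esub> g) = (\<Sum>x\<in>S. (f x + g x) * D x)"
    by simp
  also have "\<dots> = evaluate D f + evaluate D g"
    using evaluate_eq[OF S, of f D] evaluate_eq[OF S, of g D]
    by (auto simp: S_def distrib_right sum.distrib)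
  finally show ?thesis .
qed

lemma evaluate_smult:
  assumes "f \<in> carrier F" shows "evaluate D (a \<odot>\<^bsub>F\<^esub> f) = a * evaluate D f"
proof -
  have S: "finite {x. f x \<noteq> 0}" using assms by (auto simp: F_iff)
  have "evaluate D (a \<odot>\<^bsub>F\<^esub> f) = (\<Sum>x\<in>{x. f x \<noteq> 0}. a * f x * D x)"
    using evaluate_eq[OF S, of "a \<odot>\<^bsub>F\<^esub> f" D] by auto
  then show ?thesis by (simp add: evaluate_def sum_distrib_left mult.assoc)
qed

lemma evaluate_free_gen: "evaluate D (free_gen (OL v) x) = D x"
  using evaluate_eq[of "{x}" "free_gen (OL v) x" D] by (auto simp: free_gen_def)

lemma evaluate_zero: "evaluate D \<zero>\<^bsub>F\<^esub> = 0"
  by (simp add: evaluate_def free_module_def)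

lemma evaluate_uminus:
  assumes "f \<in> carrier F" shows "evaluate D (\<ominus>\<^bsub>F\<^esub> f) = - evaluate D f"
proof -
  interpret Module.module "OL v" F by (rule F_module)
  have "evaluate D (\<ominus>\<^bsub>F\<^esub> f \<oplus>\<^bsub>F\<^esub> f) = evaluate D (\<ominus>\<^bsub>F\<^esub> f) + evaluate D f"
    using assms by (intro evaluate_add) auto
  moreover have "\<ominus>\<^bsub>F\<^esub> f \<oplus>\<^bsub>F\<^esub> f = \<zero>\<^bsub>F\<^esub>" using assms by (rule M.l_neg)
  ultimately show ?thesis by (simp add: evaluate_zero eq_neg_iff_add_eq_0 del: free_module_simps)
qed

lemma evaluate_minus:
  assumes "f \<in> carrier F" "g \<in> carrier F"
  shows "evaluate D (f \<ominus>\<^bsub>F\<^esub> g) = evaluate D f - evaluate D g"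
proof -
  interpret Module.module "OL v" F by (rule F_module)
  have "evaluate D (f \<oplus>\<^bsub>F\<^esub> (\<ominus>\<^bsub>F\<^esub> g)) = evaluate D f + evaluate D (\<ominus>\<^bsub>F\<^esub> g)"
    using assms by (intro evaluate_add) auto
  then show "evaluate D (f \<ominus>\<^bsub>F\<^esub> g) = evaluate D f - evaluate D g"
    using evaluate_uminus[OF assms(2)] by (simp add: a_minus_def)
qed

lemma evaluate_in:
  assumes "O_ideal I" "f \<in> carrier F" "\<And>x. x \<in> \<O> \<Longrightarrow> D x \<in> I"
  shows "evaluate D f \<in> I"
proof -
  have "(\<Sum>x\<in>S. f x * D x) \<in> I" if "finite S" "S \<subseteq> \<O>" for S
    using that
  proof (induction S rule: finite_induct)
    case (insert x S)
    then show ?case using assms O_idealD(3,4)[OF assms(1)] by (auto simp: F_iff)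
  qed (simp add: O_idealD(2)[OF assms(1)])
  moreover have "finite {x. f x \<noteq> 0}" "{x. f x \<noteq> 0} \<subseteq> \<O>" using assms(2) by (auto simp: F_iff)
  ultimately show ?thesis unfolding evaluate_def by blast
qed

end

context totally_ramified
begin

abbreviation "Rel \<equiv> gen_submodule (OL v) F (kaehler_relations (OL v) \<A>)"
abbreviation "\<Omega> \<equiv> kaehler (OL v) \<A>"

lemma A_subset_O: "\<A> \<subseteq> carrier (OL v)"
  by (auto simp: A_iff)

lemma Rel_submodule: "submodule Rel (OL v) F"
  using gen_submodule_is_submodule[OF F_module, of "kaehler_relations (OL v) \<A>"]
    kaehler_relations_closed[OF cring_set_ring[OF O_subring] A_subset_O] by simp

lemma Omega_module: "Module.module (OL v) \<Omega>"
  by (rule kaehler_is_module[OF cring_set_ring[OF O_subring] A_subset_O])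

lemma Omega_eq: "\<Omega> = quot_module F Rel"
  by (simp add: kaehler_def)

lemmas Omega_facts = quot_module_facts[OF F_module Rel_submodule, folded Omega_eq]

text \<open>The universal derivation of \<O> over \<A>.\<close>

definition d :: "'l \<Rightarrow> ('l \<Rightarrow> 'l) set" where
  "d x = Rel +>\<^bsub>F\<^esub> free_gen (OL v) x"

lemma relation_in_Rel: "f \<in> kaehler_relations (OL v) \<A> \<Longrightarrow> f \<in> Rel"
  by (auto simp: gen_submodule_def)

lemma coset_eqI:
  assumes "f \<in> carrier F" "g \<in> carrier F" "f \<ominus>\<^bsub>F\<^esub> g \<in> Rel"
  shows "Rel +>\<^bsub>F\<^esub> f = Rel +>\<^bsub>F\<^esub> g"
proof -
  interpret Module.module "OL v" F by (rule F_module)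
  have "f = (f \<ominus>\<^bsub>F\<^esub> g) \<oplus>\<^bsub>F\<^esub> g"
    using assms unfolding a_minus_def by (subst M.a_assoc) (auto simp: M.l_neg simp del: free_module_simps)
  then show ?thesis using Omega_facts(5)[OF assms(1,2)] assms(3) by blast
qed

lemma d_closed: "x \<in> \<O> \<Longrightarrow> d x \<in> carrier \<Omega>"
  by (simp add: d_def Omega_facts(3) free_gen_F)

lemma d_add:
  assumes "x \<in> \<O>" "y \<in> \<O>" shows "d (x + y) = d x \<oplus>\<^bsub>\<Omega>\<^esub> d y"
proof -
  interpret Module.module "OL v" F by (rule F_module)
  have "free_gen (OL v) (x + y) \<ominus>\<^bsub>F\<^esub> (free_gen (OL v) x \<oplus>\<^bsub>F\<^esub> free_gen (OL v) y) \<in> Rel"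
    by (rule relation_in_Rel) (use assms in \<open>auto simp: kaehler_relations_def Let_def simp del: free_module_simps\<close>)
  then have "d (x + y) = Rel +>\<^bsub>F\<^esub> (free_gen (OL v) x \<oplus>\<^bsub>F\<^esub> free_gen (OL v) y)"
    unfolding d_def using assms by (intro coset_eqI free_gen_F M.a_closed O.add_in)
  also have "\<dots> = d x \<oplus>\<^bsub>\<Omega>\<^esub> d y"
    using Omega_facts(2)[OF free_gen_F[OF assms(1)] free_gen_F[OF assms(2)]] by (simp only: d_def)
  finally show ?thesis .
qed

lemma d_mult:
  assumes "x \<in> \<O>" "y \<in> \<O>" shows "d (x * y) = x \<odot>\<^bsub>\<Omega>\<^esub> d y \<oplus>\<^bsub>\<Omega>\<^esub> y \<odot>\<^bsub>\<Omega>\<^esub> d x"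
proof -
  interpret Module.module "OL v" F by (rule F_module)
  let ?g = "free_gen (OL v)"
  have c: "x \<odot>\<^bsub>F\<^esub> ?g y \<in> carrier F" "y \<odot>\<^bsub>F\<^esub> ?g x \<in> carrier F"
    using assms by (intro smult_closed free_gen_F; simp)+
  have "?g (x * y) \<ominus>\<^bsub>F\<^esub> (x \<odot>\<^bsub>F\<^esub> ?g y \<oplus>\<^bsub>F\<^esub> y \<odot>\<^bsub>F\<^esub> ?g x) \<in> Rel"
    by (rule relation_in_Rel) (use assms in \<open>auto simp: kaehler_relations_def Let_def simp del: free_module_simps\<close>)
  then have "d (x * y) = Rel +>\<^bsub>F\<^esub> (x \<odot>\<^bsub>F\<^esub> ?g y \<oplus>\<^bsub>F\<^esub> y \<odot>\<^bsub>F\<^esub> ?g x)"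
    unfolding d_def using assms c by (intro coset_eqI free_gen_F M.a_closed O.mult_in)
  also have "\<dots> = (Rel +>\<^bsub>F\<^esub> (x \<odot>\<^bsub>F\<^esub> ?g y)) \<oplus>\<^bsub>\<Omega>\<^esub> (Rel +>\<^bsub>F\<^esub> (y \<odot>\<^bsub>F\<^esub> ?g x))"
    using Omega_facts(2)[OF c] by (simp only:)
  also have "\<dots> = x \<odot>\<^bsub>\<Omega>\<^esub> d y \<oplus>\<^bsub>\<Omega>\<^esub> y \<odot>\<^bsub>\<Omega>\<^esub> d x"
    using Omega_facts(1)[OF _ free_gen_F[OF assms(1)], of y] Omega_facts(1)[OF _ free_gen_F[OF assms(2)], of x] assms
    by (simp add: d_def del: free_module_simps)
  finally show ?thesis .
qed

lemma d_const:
  assumes "a \<in> \<A>" shows "d a = \<zero>\<^bsub>\<Omega>\<^esub>"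
proof -
  have "free_gen (OL v) a \<in> Rel"
    by (rule relation_in_Rel) (use assms in \<open>auto simp: kaehler_relations_def Let_def simp del: free_module_simps\<close>)
  then show ?thesis
    using Omega_facts(6)[OF free_gen_F, of a] assms by (simp add: d_def Omega_facts(4) A_iff)
qed

lemma d_poly:
  assumes p: "p \<in> polys_over \<A>" and u: "u \<in> \<O>"
  shows "d (poly p u) = poly (pderiv p) u \<odot>\<^bsub>\<Omega>\<^esub> d u"
  using p
proof (induction p)
  case 0
  interpret Module.module "OL v" \<Omega> by (rule Omega_module)
  show ?case using d_const[OF A.zero_in] smult_l_null[OF d_closed[OF u]] by simp
next
  case (pCons a p)
  interpret Module.module "OL v" \<Omega> by (rule Omega_module)
  have p: "p \<in> polys_over \<A>" "a \<in> \<A>" using pCons.prems by (auto simp: A.pCons_polys_over)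
  have pO: "poly p u \<in> \<O>" "poly (pderiv p) u \<in> \<O>" "a \<in> \<O>"
    using O.poly_in[OF _ u, of p] O.poly_in[OF _ u, of "pderiv p"] p A.pderiv_polys_over[OF p(1)]
    by (auto simp: polys_over_def A_iff)
  note du = d_closed[OF u]
  have "d (poly (pCons a p) u) = d a \<oplus>\<^bsub>\<Omega>\<^esub> d (u * poly p u)"
    using d_add[of a "u * poly p u"] pO u by (simp add: O.mult_in)
  also have "d (u * poly p u) = u \<odot>\<^bsub>\<Omega>\<^esub> (poly (pderiv p) u \<odot>\<^bsub>\<Omega>\<^esub> d u) \<oplus>\<^bsub>\<Omega>\<^esub> poly p u \<odot>\<^bsub>\<Omega>\<^esub> d u"
    using d_mult[OF u pO(1)] pCons.IH[OF p(1)] by simp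
  also have "\<dots> = (u * poly (pderiv p) u + poly p u) \<odot>\<^bsub>\<Omega>\<^esub> d u"
    using smult_assoc1[of u "poly (pderiv p) u" "d u"]
      smult_l_distr[of "u * poly (pderiv p) u" "poly p u" "d u"] du u pO by (simp add: O.mult_in)
  also have "d a \<oplus>\<^bsub>\<Omega>\<^esub> \<dots> = (u * poly (pderiv p) u + poly p u) \<odot>\<^bsub>\<Omega>\<^esub> d u"
    using d_const[OF p(2)] M.l_zero smult_closed[OF _ du] u pO by (simp add: O.mult_in O.add_in)
  also have "u * poly (pderiv p) u + poly p u = poly (pderiv (pCons a p)) u" by (simp add: pderiv_pCons)
  finally show ?case .
qed

text \<open>The Euler operator: \<open>\<Sum>a\<^sub>i t\<^sup>i \<mapsto> \<Sum>i a\<^sub>i t\<^sup>i\<close> (\<open>i < q\<close>). It is unchanged when \<open>t\<close> is replaced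
  by \<open>c t\<close>, and it is a derivation only modulo the ideal generated by the \<open>u h'(u)\<close>, where
  \<open>h\<close> is the minimal polynomial of \<open>u = c t\<close>.\<close>

definition Euler :: "'l \<Rightarrow> 'l \<Rightarrow> 'l" where
  "Euler t y = t * poly (pderiv (THE p. p \<in> polys_over K \<and> degree p < q \<and> poly p t = y)) t"

lemma Euler_poly:
  assumes t: "outside t" and p: "p \<in> polys_over K" "degree p < q"
  shows "Euler t (poly p t) = t * poly (pderiv p) t"
proof -
  have "(THE r. r \<in> polys_over K \<and> degree r < q \<and> poly r t = poly p t) = p"
  proof (rule the_equality)
    fix r assume r: "r \<in> polys_over K \<and> degree r < q \<and> poly r t = poly p t"
    have "r - p = 0"
    proof (rule poly_eq_0_imp[OF t])
      show "r - p \<in> polys_over K" using r p by (intro K.diff_polys_over) auto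
      show "degree (r - p) < q" using r p by (intro degree_diff_less) auto
    qed (use r in simp)
    then show "r = p" by simp
  qed (use p in auto)
  then show ?thesis by (simp add: Euler_def)
qed

lemma Euler_scale:
  assumes t: "outside t" and p: "p \<in> polys_over K" "degree p < q" and c: "c \<in> K"
  shows "Euler t (poly p (c * t)) = c * t * poly (pderiv p) (c * t)"
proof -
  have "degree (p \<circ>\<^sub>p [:0, c:]) \<le> degree p"
    using degree_pcompose_le[of p "[:0, c:]"] degree_pCons_le[of 0 "[:c:]"]
    by (auto split: if_splits)
  then have "Euler t (poly (p \<circ>\<^sub>p [:0, c:]) t) = t * poly (pderiv (p \<circ>\<^sub>p [:0, c:])) t"
    using p c by (intro Euler_poly t K.scale_polys_over) auto
  then show ?thesis by (simp add: poly_pcompose pderiv_pcompose pderiv_pCons mult_ac)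
qed

lemma Euler_add:
  assumes t: "outside t" shows "Euler t (x + y) = Euler t x + Euler t y"
proof -
  obtain p where p: "p \<in> polys_over K" "degree p < q" "poly p t = x" using ex_poly[OF t] .
  obtain r where r: "r \<in> polys_over K" "degree r < q" "poly r t = y" using ex_poly[OF t] .
  have "Euler t (poly (p + r) t) = t * poly (pderiv (p + r)) t"
    using p r by (intro Euler_poly t K.add_polys_over degree_add_less)
  then show ?thesis
    using Euler_poly[OF t p(1,2)] Euler_poly[OF t r(1,2)] p r by (simp add: pderiv_add algebra_simps)
qed

lemma Euler_const: "outside t \<Longrightarrow> a \<in> K \<Longrightarrow> Euler t a = 0"
  using Euler_poly[of t "[:a:]"] q_pos by (simp add: K.pCons_polys_over K.zero_polys_over)

text \<open>The isomorphism is induced by \<open>evaluate D\<close> with \<open>D\<close> the Euler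
  operator, and the work lies in identifying \<open>Rel\<close> with the preimage of
  \<open>J\<close>. That \<open>Rel\<close> maps into \<open>J\<close> says that \<open>D\<close> is
  a derivation modulo \<open>J\<close>; the converse rests on \<open>h'(u) du = 0\<close> for a
  \<open>u\<close> adapted to the element in question.\<close>

theorem kaehler_iso:
  assumes t: "outside t" "generates_O t" and s: "s \<in> \<O>" "s \<noteq> 0"
    and h: "\<And>c. c \<in> K \<Longrightarrow> c \<noteq> 0 \<Longrightarrow> 0 < v (c * t) \<Longrightarrow>
      \<exists>h\<in>polys_over \<A>. lead_coeff h = 1 \<and> degree h = q \<and> poly h (c * t) = 0 \<and>
        poly (pderiv h) (c * t) \<noteq> 0 \<and> v (poly (pderiv h) (c * t)) = v (s * (c * t) ^ (q - 1))"
  shows "module_isomorphic (OL v) \<Omega> (ideal_quot (OL v) \<M> (\<J> s))"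
proof -
  define D where "D = Euler t"
  define J where "J = \<J> s"
  \<comment> \<open>The admissible generators \<open>u\<close>; by \<open>directed\<close> they can
    be taken arbitrarily small in \<M>, with \<open>\<A>[u]\<close> containing any finite
    set.\<close>
  define C where "C = {u. \<exists>c\<in>K. c \<noteq> 0 \<and> u = c * t \<and> 0 < v u}"
  have t0: "t \<noteq> 0" using t by (simp add: outside_def)
  have C: "u \<noteq> 0" "u \<in> \<M>" "u \<in> \<O>" if uC: "u \<in> C" for u
  proof -
    obtain c where c: "c \<in> K" "c \<noteq> 0" "u = c * t" "0 < v u" using uC by (auto simp: C_def)
    have "outside u" unfolding c(3) by (rule outside_mult_K[OF t(1) c(1,2)])
    then show "u \<in> \<M>" using c(4) by (rule outside_in_M)
    then show "u \<in> \<O>" by (rule M_subset_O)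
    show "u \<noteq> 0" unfolding c(3) using c(2) t0 by (rule no_zero_divisors)
  qed
  have directed: "\<exists>u\<in>C. v u \<le> v m \<and> Y \<subseteq> adjoin \<A> u" if Y: "finite Y" "Y \<subseteq> \<O>" "m \<in> \<M>" "m \<noteq> 0" for Y m
  proof -
    obtain c where "c \<in> K" "c \<noteq> 0" "0 < v (c * t)" "v (c * t) \<le> v m" "Y \<subseteq> adjoin \<A> (c * t)"
      using generates_O_directed[OF t Y] .
    then show ?thesis unfolding C_def by (intro bexI[of _ "c * t"]) auto
  qed
  have ex_C: "\<exists>u\<in>C. Y \<subseteq> adjoin \<A> u" if "finite Y" "Y \<subseteq> \<O>" for Y
  proof -
    obtain c where "c \<in> K" "c \<noteq> 0" "0 < v (c * t)" using ex_small_multiple[OF t(1)] .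
    then have "c * t \<in> C" by (auto simp: C_def)
    from directed[OF that C(2)[OF this] C(1)[OF this]] show ?thesis by blast
  qed
  have AO: "p \<in> polys_over \<O>" if "p \<in> polys_over \<A>" for p using that by (auto simp: polys_over_def A_iff)
  have AK: "p \<in> polys_over K" if "p \<in> polys_over \<A>" for p using that by (auto simp: polys_over_def A_iff)
  have JI: "O_ideal J" unfolding J_def by (intro O_ideal_scale s O_ideal_power O_ideal_M)
  have J_iff: "x \<in> J \<longleftrightarrow> (\<exists>r\<in>\<O>. \<exists>m\<in>\<M>. x = s * (r * m ^ q))" for x
    unfolding J_def O_power_eq[OF O_ideal_M] by auto
  have J_M: "J \<subseteq> \<M>"
  proof
    fix x assume "x \<in> J"
    then obtain r m where *: "r \<in> \<O>" "m \<in> \<M>" "x = s * (r * m ^ q)" by (auto simp: J_iff)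
    have "m ^ q = m ^ (q - 1) * m" using q_pos by (simp flip: power_Suc2)
    then have "x = (s * (r * m ^ (q - 1))) * m" using * by (simp add: mult.assoc)
    moreover have "s * (r * m ^ (q - 1)) \<in> \<O>" using * s M_subset_O by (intro O.mult_in O.power_in)
    ultimately show "x \<in> \<M>" using O_idealD(4)[OF O_ideal_M] *(2) by blast
  qed
  have su_J: "s * u ^ q * n \<in> J" if "u \<in> C" "n \<in> \<O>" for u n
    unfolding J_iff using C(2)[OF that(1)] that(2) by (intro bexI[of _ n] bexI[of _ u]) (simp_all add: mult_ac)
  \<comment> \<open>Equality of values is turned into divisibility in both directions:
    \<open>o1\<close> bounds the error of \<open>D\<close>, \<open>o2\<close> serves in the
    computation of the kernel.\<close>
  have min_poly: "\<exists>h\<in>polys_over \<A>. lead_coeff h = 1 \<and> degree h = q \<and> poly h u = 0 \<and>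
      (\<exists>o1\<in>\<O>. \<exists>o2\<in>\<O>. poly (pderiv h) u = o1 * (s * u ^ (q - 1)) \<and> s * u ^ (q - 1) = o2 * poly (pderiv h) u)"
    if u: "u \<in> C" for u
  proof -
    obtain c where c: "c \<in> K" "c \<noteq> 0" "u = c * t" "0 < v u" using u by (auto simp: C_def)
    have u0: "u \<noteq> 0" using C(1)[OF u] .
    obtain h where h: "h \<in> polys_over \<A>" "lead_coeff h = 1" "degree h = q" "poly h u = 0"
        "poly (pderiv h) u \<noteq> 0" "v (poly (pderiv h) u) = v (s * u ^ (q - 1))"
      using h[of c] c by auto
    have "poly (pderiv h) u / (s * u ^ (q - 1)) \<in> \<O>" "s * u ^ (q - 1) / poly (pderiv h) u \<in> \<O>"
      using h s u0 by (simp_all add: divide_in_O_iff del: times_divide_eq_left)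
    then show ?thesis using h s u0
      by (intro bexI[of _ h] conjI bexI[of _ "poly (pderiv h) u / (s * u ^ (q - 1))"]
          bexI[of _ "s * u ^ (q - 1) / poly (pderiv h) u"]) simp_all
  qed
  \<comment> \<open>Division by \<open>h\<close> alters the derivative at \<open>u\<close> only by
    \<open>h'(u) * n(u)\<close>, because \<open>h\<close> vanishes at \<open>u\<close>. Times
    \<open>u\<close>, this is a multiple of \<open>s * u ^ q\<close>.\<close>
  have reduce: "\<exists>r\<in>polys_over \<A>. degree r < q \<and> poly r u = poly p u \<and>
      (\<exists>n\<in>\<O>. u * poly (pderiv p) u = u * poly (pderiv r) u + s * u ^ q * n)"
    if u: "u \<in> C" and p: "p \<in> polys_over \<A>" for u p
  proof -
    obtain h o1 where h: "h \<in> polys_over \<A>" "lead_coeff h = 1" "degree h = q" "poly h u = 0"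
        "o1 \<in> \<O>" "poly (pderiv h) u = o1 * (s * u ^ (q - 1))"
      using min_poly[OF u] by blast
    obtain n r where nr: "n \<in> polys_over \<A>" "r \<in> polys_over \<A>" "p = h * n + r" "degree r < q"
      using A.monic_division[OF h(1,2) _ p] h(3) q_pos by auto
    have "u * u ^ (q - 1) = u ^ q" using q_pos by (simp flip: power_Suc)
    then have "u * poly (pderiv h) u = s * u ^ q * o1" unfolding h(6) by (simp add: mult_ac)
    then have "u * poly (pderiv p) u = u * poly (pderiv r) u + s * u ^ q * (o1 * poly n u)"
      using nr(3) h(4) by (simp add: pderiv_add pderiv_mult algebra_simps)
    moreover have "o1 * poly n u \<in> \<O>" using h(5) O.poly_in[OF AO[OF nr(1)] C(3)[OF u]] by (rule O.mult_in)
    ultimately show ?thesis using nr h(4) by (intro bexI[of _ r]) auto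
  qed
  have D_red: "D (poly r u) = u * poly (pderiv r) u" if "u \<in> C" "r \<in> polys_over \<A>" "degree r < q" for u r
    using that Euler_scale[OF t(1) AK[OF that(2)] that(3)] by (auto simp: C_def D_def)
  have D_poly: "\<exists>n\<in>\<O>. u * poly (pderiv p) u = D (poly p u) + s * u ^ q * n"
    if "u \<in> C" "p \<in> polys_over \<A>" for u p
    using reduce[OF that] D_red[OF that(1)] by metis
  have adj: "\<exists>p\<in>polys_over \<A>. degree p < q \<and> x = poly p u" if u: "u \<in> C" and x: "x \<in> adjoin \<A> u" for x u
  proof -
    obtain p where "p \<in> polys_over \<A>" "x = poly p u" using x by (auto simp: adjoin_A)
    then show ?thesis using reduce[OF u] by metis
  qed
  have pO: "poly p u \<in> \<O>" if "p \<in> polys_over \<A>" "u \<in> C" for p u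
    using O.poly_in[OF AO[OF that(1)] C(3)[OF that(2)]] .
  have D_M: "D x \<in> \<M>" if x: "x \<in> \<O>" for x
  proof -
    obtain u where u: "u \<in> C" "x \<in> adjoin \<A> u" using ex_C[of "{x}"] x by auto
    obtain p where p: "p \<in> polys_over \<A>" "degree p < q" "x = poly p u" using adj[OF u] by blast
    have "D x = poly (pderiv p) u * u" using D_red[OF u(1) p(1,2)] p(3) by (simp add: mult.commute)
    then show ?thesis
      using O_idealD(4)[OF O_ideal_M pO[OF A.pderiv_polys_over[OF p(1)] u(1)] C(2)[OF u(1)]] by simp
  qed
  \<comment> \<open>With both factors in one \<open>\<A>[u]\<close>, formal differentiation obeys
    the product rule; the only error comes from reducing the product polynomial to degree below
    \<open>q\<close>.\<close>
  have Leibniz: "D (x * y) - (x * D y + y * D x) \<in> J" if x: "x \<in> \<O>" and y: "y \<in> \<O>" for x y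
  proof -
    obtain u where u: "u \<in> C" "x \<in> adjoin \<A> u" "y \<in> adjoin \<A> u" using ex_C[of "{x, y}"] x y by auto
    obtain p where p: "p \<in> polys_over \<A>" "degree p < q" "x = poly p u" using adj[OF u(1,2)] by blast
    obtain r where r: "r \<in> polys_over \<A>" "degree r < q" "y = poly r u" using adj[OF u(1,3)] by blast
    obtain n where n: "n \<in> \<O>" "u * poly (pderiv (p * r)) u = D (poly (p * r) u) + s * u ^ q * n"
      using D_poly[OF u(1) A.mult_polys_over[OF p(1) r(1)]] by blast
    have "D (x * y) - (x * D y + y * D x) = s * u ^ q * (- n)"
      using n(2) D_red[OF u(1) p(1,2)] D_red[OF u(1) r(1,2)] p(3) r(3)
      by (simp add: pderiv_mult algebra_simps)
    then show ?thesis using su_J[OF u(1) O.minus_in[OF n(1)]] by simp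
  qed
  note ev = evaluate_add evaluate_smult evaluate_minus evaluate_free_gen
  let ?g = "free_gen (OL v)"
  interpret F: Module.module "OL v" F by (rule F_module)
  \<comment> \<open>\<open>Rel\<close> is the least submodule containing the relations, so it
    suffices that the preimage of \<open>J\<close> is a submodule containing them.\<close>
  have rel_J: "evaluate D f \<in> J" if f: "f \<in> Rel" for f
  proof -
    have "submodule {f \<in> carrier F. evaluate D f \<in> J} (OL v) F"
    proof (rule F.submoduleI)
      show "\<zero>\<^bsub>F\<^esub> \<in> {f \<in> carrier F. evaluate D f \<in> J}"
        using O_idealD(2)[OF JI] by (simp add: evaluate_zero)
      show "\<ominus>\<^bsub>F\<^esub> f \<in> {f \<in> carrier F. evaluate D f \<in> J}" if "f \<in> {f \<in> carrier F. evaluate D f \<in> J}" for f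
        using that O_idealD(5)[OF JI] by (simp add: evaluate_uminus)
      show "f \<oplus>\<^bsub>F\<^esub> g \<in> {f \<in> carrier F. evaluate D f \<in> J}"
        if "f \<in> {f \<in> carrier F. evaluate D f \<in> J}" "g \<in> {f \<in> carrier F. evaluate D f \<in> J}" for f g
        using that O_idealD(3)[OF JI] F.M.a_closed[of f g] evaluate_add[of f g D] by (simp del: free_module_simps)
      show "a \<odot>\<^bsub>F\<^esub> f \<in> {f \<in> carrier F. evaluate D f \<in> J}"
        if "a \<in> carrier (OL v)" "f \<in> {f \<in> carrier F. evaluate D f \<in> J}" for a f
        using that O_idealD(4)[OF JI] F.smult_closed[of a f] evaluate_smult[of f D a] by (simp del: free_module_simps)
    qed auto
    moreover have "kaehler_relations (OL v) \<A> \<subseteq> {f \<in> carrier F. evaluate D f \<in> J}"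
    proof
      fix f assume f: "f \<in> kaehler_relations (OL v) \<A>"
      then have fF: "f \<in> carrier F"
        using kaehler_relations_closed[OF cring_set_ring[OF O_subring] A_subset_O] by auto
      consider x y where "x \<in> \<O>" "y \<in> \<O>" "f = ?g (x + y) \<ominus>\<^bsub>F\<^esub> (?g x \<oplus>\<^bsub>F\<^esub> ?g y)"
        | x y where "x \<in> \<O>" "y \<in> \<O>" "f = ?g (x * y) \<ominus>\<^bsub>F\<^esub> (x \<odot>\<^bsub>F\<^esub> ?g y \<oplus>\<^bsub>F\<^esub> y \<odot>\<^bsub>F\<^esub> ?g x)"
        | a where "a \<in> \<A>" "f = ?g a"
        using f unfolding kaehler_relations_def Let_def set_ring_simps by blast
      then have "evaluate D f \<in> J"
      proof cases
        case (1 x y)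
        then have "evaluate D f = D (x + y) - (D x + D y)"
          using free_gen_F[of x] free_gen_F[of y] free_gen_F[of "x + y"] O.add_in[of x y]
          by (simp only: ev F.M.a_closed)
        then show ?thesis using Euler_add[OF t(1), of x y] O_idealD(2)[OF JI] by (simp add: D_def)
      next
        case (2 x y)
        then have "evaluate D f = D (x * y) - (x * D y + y * D x)"
          using free_gen_F[of x] free_gen_F[of y] free_gen_F[of "x * y"] O.mult_in[of x y]
            F.smult_closed[of x "?g y"] F.smult_closed[of y "?g x"]
          by (simp only: ev F.M.a_closed set_ring_simps)
        then show ?thesis using Leibniz[OF 2(1,2)] by simp
      next
        case (3 a)
        then show ?thesis using Euler_const[OF t(1), of a] O_idealD(2)[OF JI]
          by (simp add: D_def evaluate_free_gen A_iff)
      qed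
      then show "f \<in> {f \<in> carrier F. evaluate D f \<in> J}" using fF by simp
    qed
    ultimately show ?thesis using f by (auto simp: gen_submodule_def)
  qed
  interpret \<Omega>: Module.module "OL v" \<Omega> by (rule Omega_module)
  \<comment> \<open>For \<open>f\<close> supported in \<open>\<A>[u]\<close>, the same coefficient
    \<open>r\<close> describes its class as a multiple of \<open>d u\<close> and its image as a
    multiple of \<open>u\<close>. This links the kernel to the annihilator of
    \<open>d u\<close>.\<close>
  have single: "\<exists>r\<in>\<O>. Rel +>\<^bsub>F\<^esub> f = r \<odot>\<^bsub>\<Omega>\<^esub> d u \<and> evaluate D f = r * u"
    if u: "u \<in> C" and S: "finite S" "S \<subseteq> adjoin \<A> u" "S \<subseteq> \<O>" and f: "f \<in> carrier F" "{x. f x \<noteq> 0} \<subseteq> S" for u S f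
    using S f
  proof (induction S arbitrary: f rule: finite_induct)
    case empty
    then have "f = \<zero>\<^bsub>F\<^esub>" by (auto simp: free_module_def)
    moreover have "Rel +>\<^bsub>F\<^esub> \<zero>\<^bsub>F\<^esub> = \<zero>\<^bsub>\<Omega>\<^esub>"
      using Omega_facts(6)[OF F.M.zero_closed] submodule.axioms(1)[OF Rel_submodule]
      by (auto simp: Omega_facts(4) dest: subgroup.one_closed)
    moreover have "0 \<odot>\<^bsub>\<Omega>\<^esub> d u = \<zero>\<^bsub>\<Omega>\<^esub>" using \<Omega>.smult_l_null[OF d_closed[OF C(3)[OF u]]] by simp
    ultimately show ?case using O.zero_in by (auto simp: evaluate_zero intro!: bexI[of _ 0])
  next
    case (insert x S)
    have x: "x \<in> \<O>" "x \<in> adjoin \<A> u" using insert.prems by auto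
    define f' where "f' = (\<lambda>y. if y = x then 0 else f y)"
    have "finite {y. f' y \<noteq> 0}"
      by (rule finite_subset[of _ "{y. f y \<noteq> 0}"]) (use insert.prems in \<open>auto simp: f'_def F_iff\<close>)
    then have f': "f' \<in> carrier F" using insert.prems O.zero_in by (auto simp: F_iff f'_def)
    moreover have "{x. f' x \<noteq> 0} \<subseteq> S" using insert.prems by (auto simp: f'_def)
    ultimately obtain r' where r': "r' \<in> \<O>" "Rel +>\<^bsub>F\<^esub> f' = r' \<odot>\<^bsub>\<Omega>\<^esub> d u" "evaluate D f' = r' * u"
      using insert.IH[of f'] insert.prems by blast
    have fx: "f x \<in> \<O>" using insert.prems by (auto simp: F_iff)
    then have fxF: "f x \<odot>\<^bsub>F\<^esub> ?g x \<in> carrier F" using free_gen_F[OF x(1)] by (intro F.smult_closed) simp_all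
    have f_eq: "f = f' \<oplus>\<^bsub>F\<^esub> (f x \<odot>\<^bsub>F\<^esub> ?g x)" by (auto simp: f'_def free_gen_def)
    obtain p where p: "p \<in> polys_over \<A>" "degree p < q" "x = poly p u" using adj[OF u x(2)] by blast
    define b where "b = poly (pderiv p) u"
    have b: "b \<in> \<O>" unfolding b_def using pO[OF A.pderiv_polys_over[OF p(1)] u] .
    note du = d_closed[OF C(3)[OF u]]
    have dx: "d x = b \<odot>\<^bsub>\<Omega>\<^esub> d u" unfolding b_def p(3) by (rule d_poly[OF p(1) C(3)[OF u]])
    have Dx: "D x = b * u" using D_red[OF u p(1,2)] by (simp add: b_def p(3) mult.commute)
    have "Rel +>\<^bsub>F\<^esub> f = (Rel +>\<^bsub>F\<^esub> f') \<oplus>\<^bsub>\<Omega>\<^esub> (Rel +>\<^bsub>F\<^esub> (f x \<odot>\<^bsub>F\<^esub> ?g x))"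
      using Omega_facts(2)[OF f' fxF] f_eq by simp
    also have "Rel +>\<^bsub>F\<^esub> (f x \<odot>\<^bsub>F\<^esub> ?g x) = f x \<odot>\<^bsub>\<Omega>\<^esub> d x"
      using Omega_facts(1)[OF _ free_gen_F[OF x(1)], of "f x"] fx by (simp add: d_def del: free_module_simps)
    also have "f x \<odot>\<^bsub>\<Omega>\<^esub> d x = (f x * b) \<odot>\<^bsub>\<Omega>\<^esub> d u"
      using \<Omega>.smult_assoc1[of "f x" b "d u"] fx b du dx by simp
    also have "(Rel +>\<^bsub>F\<^esub> f') \<oplus>\<^bsub>\<Omega>\<^esub> \<dots> = (r' + f x * b) \<odot>\<^bsub>\<Omega>\<^esub> d u"
      using \<Omega>.smult_l_distr[of r' "f x * b" "d u"] r' fx b du by (simp add: O.mult_in)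
    finally have 1: "Rel +>\<^bsub>F\<^esub> f = (r' + f x * b) \<odot>\<^bsub>\<Omega>\<^esub> d u" .
    have "evaluate D f = evaluate D f' + f x * D x"
      using evaluate_add[OF f' fxF, of D] evaluate_smult[OF free_gen_F[OF x(1)], of D "f x"] f_eq
      by (simp add: evaluate_free_gen)
    then have "evaluate D f = (r' + f x * b) * u" using r' Dx by (simp add: algebra_simps)
    with 1 show ?case using r' fx b by (auto intro!: bexI[of _ "r' + f x * b"] O.add_in O.mult_in)
  qed
  have ker: "f \<in> Rel" if f: "f \<in> carrier F" and fJ: "evaluate D f \<in> J" for f
  proof -
    obtain r m where rm: "r \<in> \<O>" "m \<in> \<M>" "evaluate D f = s * (r * m ^ q)" using fJ by (auto simp: J_iff)
    have S: "finite {x. f x \<noteq> 0}" "{x. f x \<noteq> 0} \<subseteq> \<O>" using f by (auto simp: F_iff)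
    \<comment> \<open>Taking \<open>u\<close> below \<open>m\<close> lets \<open>m\<close> be
      absorbed into a multiple of \<open>u\<close>. A zero \<open>m\<close> gives no bound, but then
      any \<open>u\<close> whose ring contains the support will do.\<close>
    have "\<exists>u\<in>C. {x. f x \<noteq> 0} \<subseteq> adjoin \<A> u \<and> (\<exists>r\<in>\<O>. evaluate D f = s * (r * u ^ q))"
    proof (cases "m = 0")
      case True
      then have "evaluate D f = s * (0 * u ^ q)" for u using rm q_pos by simp
      then show ?thesis using ex_C[OF S] O.zero_in by blast
    next
      case False
      obtain u where u: "u \<in> C" "v u \<le> v m" "{x. f x \<noteq> 0} \<subseteq> adjoin \<A> u" using directed[OF S rm(2) False] by blast
      have "m / u \<in> \<O>" using u False C(1)[OF u(1)] by (simp add: divide_in_O_iff)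
      moreover have "evaluate D f = s * (r * (m / u) ^ q * u ^ q)" using rm C(1)[OF u(1)] by (simp add: power_divide)
      moreover have "r * (m / u) ^ q \<in> \<O>" using rm(1) \<open>m / u \<in> \<O>\<close> by (intro O.mult_in O.power_in)
      ultimately show ?thesis using u by blast
    qed
    then obtain u r where u: "u \<in> C" "{x. f x \<noteq> 0} \<subseteq> adjoin \<A> u" "r \<in> \<O>" "evaluate D f = s * (r * u ^ q)" by blast
    obtain a where a: "a \<in> \<O>" "Rel +>\<^bsub>F\<^esub> f = a \<odot>\<^bsub>\<Omega>\<^esub> d u" "evaluate D f = a * u"
      using single[OF u(1) S(1) u(2) S(2) f order_refl] by blast
    obtain h o2 where h: "h \<in> polys_over \<A>" "poly h u = 0" "o2 \<in> \<O>" "s * u ^ (q - 1) = o2 * poly (pderiv h) u"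
      using min_poly[OF u(1)] by blast
    have uq: "u ^ q = u ^ (q - 1) * u" using q_pos by (simp flip: power_Suc2)
    have "a * u = s * (r * (u ^ (q - 1) * u))" using a(3) u(4) uq by metis
    also have "\<dots> = r * (s * u ^ (q - 1)) * u" by (simp only: mult_ac)
    also have "\<dots> = (r * o2 * poly (pderiv h) u) * u" unfolding h(4) by (simp add: mult_ac)
    finally have "a * u = (r * o2 * poly (pderiv h) u) * u" .
    \<comment> \<open>So \<open>a\<close> is a multiple of \<open>h'(u)\<close>, and
      \<open>h'(u) du = d (h(u)) = d 0 = 0\<close>.\<close>
    then have a_eq: "a = (r * o2) * poly (pderiv h) u" using mult_right_cancel[OF C(1)[OF u(1)]] by blast
    have hO: "poly (pderiv h) u \<in> \<O>" using pO[OF A.pderiv_polys_over[OF h(1)] u(1)] .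
    have "a \<odot>\<^bsub>\<Omega>\<^esub> d u = (r * o2) \<odot>\<^bsub>\<Omega>\<^esub> (poly (pderiv h) u \<odot>\<^bsub>\<Omega>\<^esub> d u)"
      using \<Omega>.smult_assoc1[of "r * o2" "poly (pderiv h) u" "d u"] a_eq u(3) h(3) hO d_closed[OF C(3)[OF u(1)]]
      by (simp add: O.mult_in)
    also have "poly (pderiv h) u \<odot>\<^bsub>\<Omega>\<^esub> d u = \<zero>\<^bsub>\<Omega>\<^esub>"
      using d_poly[OF h(1) C(3)[OF u(1)]] h(2) d_const[OF A.zero_in] by simp
    also have "(r * o2) \<odot>\<^bsub>\<Omega>\<^esub> \<zero>\<^bsub>\<Omega>\<^esub> = \<zero>\<^bsub>\<Omega>\<^esub>"
      using u(3) h(3) by (intro \<Omega>.smult_r_null) (simp add: O.mult_in)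
    finally have "Rel +>\<^bsub>F\<^esub> f = Rel" using a(2) Omega_facts(4) by simp
    then show ?thesis using Omega_facts(6)[OF f] by simp
  qed
  have "module_isomorphic (OL v) (quot_module F Rel) (ideal_quot (OL v) \<M> J)"
  proof (rule quot_module_iso[where \<phi> = "evaluate D"])
    show "Module.module (OL v) F" by (rule F_module)
    show "Module.module (OL v) (ideal_module (OL v) \<M>)" by (rule ideal_module_is_module[OF O_ideal_M])
    show "submodule Rel (OL v) F" by (rule Rel_submodule)
    show "submodule J (OL v) (ideal_module (OL v) \<M>)" by (rule ideal_submodule[OF O_ideal_M JI J_M])
    show "evaluate D f \<in> carrier (ideal_module (OL v) \<M>)" if "f \<in> carrier F" for f
      using evaluate_in[OF O_ideal_M that] D_M by simp
    show "evaluate D (f \<oplus>\<^bsub>F\<^esub> g) = evaluate D f \<oplus>\<^bsub>ideal_module (OL v) \<M>\<^esub> evaluate D g"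
      if "f \<in> carrier F" "g \<in> carrier F" for f g
      using evaluate_add[OF that] by (simp del: free_module_simps)
    show "evaluate D (a \<odot>\<^bsub>F\<^esub> f) = a \<odot>\<^bsub>ideal_module (OL v) \<M>\<^esub> evaluate D f"
      if "a \<in> carrier (OL v)" "f \<in> carrier F" for a f
      using evaluate_smult[OF that(2)] by (simp del: free_module_simps)
    show "evaluate D f \<in> J \<longleftrightarrow> f \<in> Rel" if "f \<in> carrier F" for f
      using rel_J ker[OF that] by blast
    show "\<exists>f\<in>carrier F. evaluate D f = y" if "y \<in> carrier (ideal_module (OL v) \<M>)" for y
    proof (cases "y = 0")
      case True
      then show ?thesis using evaluate_zero F.M.zero_closed by metis
    next
      case False
      have y: "y \<in> \<M>" using that by simp
      obtain u where u: "u \<in> C" "v u \<le> v y" using directed[of "{}" y] y False by auto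
      have "y / u \<in> \<O>" using u False C(1)[OF u(1)] by (simp add: divide_in_O_iff)
      \<comment> \<open>The polynomial representing \<open>u\<close> is the variable itself, whose
        degree 1 is below \<open>q\<close>.\<close>
      moreover have "D u = u"
        using D_red[OF u(1), of "[:0, 1:]"] q_ge_2
        by (simp add: A.pCons_polys_over A.zero_polys_over A.zero_in A.one_in pderiv_pCons)
      ultimately show ?thesis
        using evaluate_smult[OF free_gen_F[OF C(3)[OF u(1)]], of D "y / u"] C(1)[OF u(1)]
          F.smult_closed[of "y / u" "?g u"] free_gen_F[OF C(3)[OF u(1)]]
        by (intro bexI[of _ "(y / u) \<odot>\<^bsub>F\<^esub> ?g u"]) (simp_all add: evaluate_free_gen del: free_module_simps)
    qed
  qed
  then show ?thesis by (simp add: J_def Omega_eq)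
qed

end

context totally_ramified
begin

section \<open>Residue characteristic\<close>

text \<open>\<open>ring_char\<close> is the gcd of the set \<open>S\<close> of natural numbers
  vanishing in the residue field. If \<open>q\<close> is in \<open>S\<close>, an element of
  \<open>S\<close> prime to \<open>q\<close> would put 1 there by Bezout; conversely, a nonzero gcd
  of \<open>S\<close> is itself a member.\<close>

lemma residue_char_iff:
  "q = ring_char (residue_field K v) \<longleftrightarrow> val_gt v (of_nat q) 0"
proof -
  define I where "I = val_ideal K v"
  have I_iff: "x \<in> I \<longleftrightarrow> x \<in> K \<and> val_gt v x 0" for x by (auto simp: I_def val_ideal_def)
  have I_A: "I \<subseteq> \<A>" by (auto simp: I_iff A_iff O_iff val_gt_def)
  have I_add: "x + y \<in> I" if "x \<in> I" "y \<in> I" for x y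
    using that by (auto simp: I_iff intro: K.add_in val_gt_add)
  have I_mult: "r * x \<in> I" if "r \<in> \<A>" "x \<in> I" for r x
  proof (cases "r = 0 \<or> x = 0")
    case False
    then have "0 < v (r * x)"
      using that by (auto simp: I_iff A_iff O_iff v_mult intro: add_nonneg_pos)
    then show ?thesis using that False by (auto simp: I_iff A_iff intro: K.mult_in)
  qed (auto simp: I_iff K.zero_in)
  have ideal: "ideal I (set_ring \<A>)"
    by (rule ideal_set_ring[OF A_subring I_A _ I_add I_mult]) (simp add: I_iff K.zero_in)
  then interpret ideal I "set_ring \<A>" .
  interpret Q: ring "set_ring \<A> Quot I" by (rule quotient_is_ring)
  have coset: "I +>\<^bsub>set_ring \<A>\<^esub> x = I \<longleftrightarrow> x \<in> I" if "x \<in> \<A>" for x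
    using a_rcos_const[of x] a_rcos_self[of x] that by auto
  have quot: "\<zero>\<^bsub>set_ring \<A> Quot I\<^esub> = I" "\<one>\<^bsub>set_ring \<A> Quot I\<^esub> = I +>\<^bsub>set_ring \<A>\<^esub> 1"
    "a \<oplus>\<^bsub>set_ring \<A> Quot I\<^esub> b = a <+>\<^bsub>set_ring \<A>\<^esub> b" for a b
    by (simp_all add: FactRing_def)
  have mult: "[n] \<cdot>\<^bsub>set_ring \<A> Quot I\<^esub> \<one>\<^bsub>set_ring \<A> Quot I\<^esub> = I +>\<^bsub>set_ring \<A>\<^esub> (of_nat n :: 'l)" for n
  proof (induction n)
    case 0
    have "I +>\<^bsub>set_ring \<A>\<^esub> 0 = I" using coset[OF A.zero_in] by (simp add: I_iff K.zero_in)
    then show ?case unfolding Q.add.nat_pow_0 quot by simp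
  next
    case (Suc n)
    have "[Suc n] \<cdot>\<^bsub>set_ring \<A> Quot I\<^esub> \<one>\<^bsub>set_ring \<A> Quot I\<^esub> =
      (I +>\<^bsub>set_ring \<A>\<^esub> (of_nat n :: 'l)) <+>\<^bsub>set_ring \<A>\<^esub> (I +>\<^bsub>set_ring \<A>\<^esub> 1)"
      unfolding Q.add.nat_pow_Suc Suc unfolding quot(2,3) ..
    also have "\<dots> = I +>\<^bsub>set_ring \<A>\<^esub> (of_nat n + 1)"
      using a_rcos_sum[of "of_nat n" 1] A.of_nat_in A.one_in by simp
    finally show ?case by (simp add: add.commute)
  qed
  define S where "S = {n. of_nat n \<in> I}"
  have char: "ring_char (residue_field K v) = Gcd S"
  proof -
    have "{n. [n] \<cdot>\<^bsub>set_ring \<A> Quot I\<^esub> \<one>\<^bsub>set_ring \<A> Quot I\<^esub> = \<zero>\<^bsub>set_ring \<A> Quot I\<^esub>} = S"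
      unfolding mult S_def using coset A.of_nat_in by (auto simp: FactRing_def)
    then show ?thesis by (simp add: ring_char_def residue_field_def I_def)
  qed
  have one: "1 \<notin> I" by (simp add: I_iff)
  have S_diff: "m - n \<in> S" if "m \<in> S" "n \<in> S" "n \<le> m" for m n
    using that I_add[of "of_nat m" "- 1 * of_nat n"] I_mult[of "- 1" "of_nat n"] A.minus_in[OF A.one_in]
    by (simp add: S_def of_nat_diff)
  have S_mult: "k * n \<in> S" if "n \<in> S" for k n
    using that I_mult[OF A.of_nat_in] by (simp add: S_def)
  have q_in: "q \<in> S \<longleftrightarrow> val_gt v (of_nat q) 0"
    by (simp add: S_def I_iff K.of_nat_in)
  show ?thesis
  proof
    assume "val_gt v (of_nat q) 0"
    then have qS: "q \<in> S" using q_in by simp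
    have "q dvd n" if n: "n \<in> S" for n
    proof (rule ccontr)
      assume nd: "\<not> q dvd n"
      obtain a b where "n * a = q * b + 1" using bezout_q[OF nd] .
      then have "1 = a * n - b * q" by (simp add: mult.commute)
      moreover have "b * q \<le> a * n" using \<open>n * a = q * b + 1\<close> by (simp add: mult.commute)
      ultimately have "1 \<in> S" using S_diff[OF S_mult[OF n, of a] S_mult[OF qS, of b]] by simp
      then show False using one by (simp add: S_def)
    qed
    then have "q dvd Gcd S" by (rule Gcd_greatest)
    moreover have "Gcd S dvd q" by (rule Gcd_dvd[OF qS])
    ultimately show "q = ring_char (residue_field K v)" unfolding char by (rule dvd_antisym)
  next
    assume "q = ring_char (residue_field K v)"
    then have q: "q = Gcd S" using char by simp
    \<comment> \<open>If only 0 belonged to \<open>S\<close>, the gcd would be 0 and not the prime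
      \<open>q\<close>.\<close>
    have "\<exists>n\<in>S. 0 < n"
    proof (rule ccontr)
      assume "\<not> ?thesis"
      then have "S \<subseteq> {0}" by auto
      then have "Gcd S = 0" by (rule Gcd_0_iff[THEN iffD2])
      then show False using q q_pos by (metis less_irrefl)
    qed
    then obtain n where n: "n \<in> S" "0 < n" by blast
    \<comment> \<open>Division with remainder makes the least positive member divide all others, so
      it is the gcd.\<close>
    define m where "m = (LEAST m. m \<in> S \<and> 0 < m)"
    have m: "m \<in> S" "0 < m" using LeastI[of "\<lambda>m. m \<in> S \<and> 0 < m" n] n by (auto simp: m_def)
    have "m dvd k" if k: "k \<in> S" for k
    proof -
      have "k - (k div m) * m \<in> S" by (intro S_diff k S_mult m) simp
      then have "k mod m \<in> S" by (simp add: minus_div_mult_eq_mod)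
      moreover have "k mod m < m" using m(2) by simp
      ultimately have "k mod m = 0"
        using not_less_Least[of "k mod m" "\<lambda>m. m \<in> S \<and> 0 < m"] by (auto simp: m_def)
      then show ?thesis by auto
    qed
    then have "m dvd Gcd S" by (rule Gcd_greatest)
    moreover have "Gcd S dvd m" by (rule Gcd_dvd[OF m(1)])
    ultimately have "Gcd S = m" by (metis dvd_antisym)
    then show "val_gt v (of_nat q) 0" using q m q_in by simp
  qed
qed

section \<open>Value groups\<close>

lemma int_multiple_v:
  assumes "t \<noteq> 0"
  shows "int_multiple (int n) (v t) = v (t ^ n)" and "int_multiple (- int n) (v t) = - v (t ^ n)"
proof -
  have "(\<Sum>i<n. v t) = v (t ^ n)" for n
    using v_prod[of "{..<n}" "\<lambda>_. t"] assms by simp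
  then show "int_multiple (int n) (v t) = v (t ^ n)" "int_multiple (- int n) (v t) = - v (t ^ n)"
    by (cases "n = 0"; simp add: int_multiple_def)+
qed

text \<open>If \<open>v t\<close> lies in \<Gamma>, its multiples add nothing, though
  \<open>vL\<close> is larger. If not, every value is that of a monomial in
  \<open>t\<close>.\<close>

lemma value_group_eq_iff:
  assumes t0: "t \<noteq> 0"
  shows "value_group UNIV v = add_multiples \<Gamma> (v t) \<longleftrightarrow> outside t"
proof
  assume eq: "value_group UNIV v = add_multiples \<Gamma> (v t)"
  show "outside t"
  proof (rule ccontr)
    assume "\<not> outside t"
    then have G: "v t \<in> \<Gamma>" using t0 by (simp add: outside_def)
    have "int_multiple n (v t) \<in> \<Gamma>" for n
      using Gamma_power[OF t0 G] Gamma_minus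
      by (cases n rule: int_cases2) (auto simp: int_multiple_v[OF t0])
    then have "value_group UNIV v \<subseteq> \<Gamma>" unfolding eq by (auto simp: add_multiples_def Gamma_add)
    then show False using ex_outside by (auto simp: outside_def value_group_def)
  qed
next
  assume t: "outside t"
  show "value_group UNIV v = add_multiples \<Gamma> (v t)"
  proof (intro equalityI subsetI)
    fix \<gamma> assume "\<gamma> \<in> value_group UNIV v"
    then obtain x where x: "x \<noteq> 0" "\<gamma> = v x" by (auto simp: value_group_def)
    obtain b i where "b \<in> K" "b \<noteq> 0" "v x = v (b * t ^ i)" using ex_monomial[OF t x(1)] by metis
    then have "\<gamma> = v b + int_multiple (int i) (v t)" "v b \<in> \<Gamma>"
      using x t0 Gamma_v by (auto simp: int_multiple_v v_mult)
    then show "\<gamma> \<in> add_multiples \<Gamma> (v t)" unfolding add_multiples_def by blast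
  next
    fix \<gamma> assume "\<gamma> \<in> add_multiples \<Gamma> (v t)"
    then obtain b n where b: "b \<in> K" "b \<noteq> 0" "\<gamma> = v b + int_multiple n (v t)"
      by (auto simp: add_multiples_def Gamma_iff)
    have "\<exists>x. x \<noteq> 0 \<and> int_multiple n (v t) = v x"
    proof (cases n rule: int_cases2)
      case (nonneg m)
      then show ?thesis using t0 by (intro exI[of _ "t ^ m"]) (simp add: int_multiple_v)
    next
      case (nonpos m)
      then show ?thesis using t0 by (intro exI[of _ "inverse (t ^ m)"]) (simp add: int_multiple_v v_inverse)
    qed
    then obtain x where "x \<noteq> 0" "int_multiple n (v t) = v x" by blast
    then have "\<gamma> = v (b * x)" "b * x \<noteq> 0" using b by (auto simp: v_mult)
    then show "\<gamma> \<in> value_group UNIV v" by (auto simp: value_group_def)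
  qed
qed

section \<open>The ramification ideal\<close>

text \<open>Expanding \<open>b\<close> in powers of \<open>t\<close>, the value of \<open>b\<close>
  is the minimum over its terms. So bounds on the powers of \<open>t\<close> suffice for all
  \<open>b\<close>, and equality for one \<sigma> at \<open>t\<close> shows that the bound is
  attained.\<close>

lemma ramification_ideal_eq:
  assumes t: "outside t" and w: "w \<in> \<O>" "w \<noteq> 0"
    and ge: "\<And>\<tau> i. \<tau> \<in> gal K \<Longrightarrow> val_ge v (\<tau> (t ^ i) - t ^ i) (v (t ^ i * w))"
    and \<sigma>: "\<sigma> \<in> gal K" "\<sigma> t \<noteq> t" "v (\<sigma> t - t) = v (t * w)"
  shows "ramification_ideal K v = scale_ideal w \<O>"
  unfolding ramification_ideal_def
proof (rule genideal_scale)
  have t0: "t \<noteq> 0" using t by (simp add: outside_def)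
  show "{(\<sigma> b - b) / b |\<sigma> b. \<sigma> \<in> gal K \<and> b \<noteq> 0} \<subseteq> scale_ideal w \<O>"
  proof
    fix z assume "z \<in> {(\<sigma> b - b) / b |\<sigma> b. \<sigma> \<in> gal K \<and> b \<noteq> 0}"
    then obtain \<tau> b where \<tau>: "\<tau> \<in> gal K" "b \<noteq> 0" "z = (\<tau> b - b) / b" by auto
    obtain p where p: "p \<in> polys_over K" "degree p < q" "poly p t = b" using ex_poly[OF t] .
    have "\<tau> b - b = (\<Sum>i\<le>degree p. coeff p i * (\<tau> (t ^ i) - t ^ i))"
      using gal_poly[OF \<tau>(1) p(1), of t] p(3) gal_power[OF \<tau>(1)]
      by (simp add: poly_altdef sum_subtractf algebra_simps)
    moreover have "val_ge v (coeff p i * (\<tau> (t ^ i) - t ^ i)) (v (b * w))" for i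
    proof (cases "coeff p i = 0")
      case False
      have "val_ge v (poly p t) (v b)" using p(3) by (simp add: val_ge_def)
      then have "val_ge v (coeff p i * t ^ i) (v b)" using val_ge_poly_iff[OF t p(1,2)] by blast
      then have "v b \<le> v (coeff p i) + v (t ^ i)" using False t0 by (simp add: v_mult)
      then have "v (b * w) \<le> v (coeff p i) + v (t ^ i * w)" using w \<tau>(2) t0 by (simp add: v_mult add.assoc[symmetric])
      moreover have "val_ge v (coeff p i * (\<tau> (t ^ i) - t ^ i)) (v (coeff p i) + v (t ^ i * w))"
        using False by (intro val_ge_mult ge \<tau>(1)) simp
      ultimately show ?thesis by (auto simp: val_ge_def)
    qed simp
    ultimately have "val_ge v (\<tau> b - b) (v (b * w))" by (simp add: val_ge_sum)
    then have "(\<tau> b - b) / (b * w) \<in> \<O>" using \<tau>(2) w(2) by (subst divide_in_O_iff) auto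
    moreover have "z = w * ((\<tau> b - b) / (b * w))" using \<tau> w(2) by simp
    ultimately show "z \<in> scale_ideal w \<O>" by blast
  qed
  show "(\<sigma> t - t) / t \<in> {(\<sigma> b - b) / b |\<sigma> b. \<sigma> \<in> gal K \<and> b \<noteq> 0}" using \<sigma>(1) t0 by blast
  show "(\<sigma> t - t) / t \<noteq> 0" using \<sigma>(2) t0 by simp
  show "v ((\<sigma> t - t) / t) = v w" using \<sigma>(2,3) t0 w(2) by (simp add: v_divide v_mult)
qed (rule w)+

section \<open>Vanishing of the quotient\<close>

lemma one_not_in_M: "1 \<notin> \<M>"
  using H_0 by (auto simp: M_iff)

lemma scale_M_power_eq: "\<J> s = {s * (r * m ^ q) | r m. r \<in> \<O> \<and> m \<in> \<M>}"
  unfolding O_power_eq[OF O_ideal_M] by auto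

lemma M_power_mult: "r \<in> \<O> \<Longrightarrow> m \<in> \<M> \<Longrightarrow> 0 < n \<Longrightarrow> r * m ^ n \<in> \<M>"
  using O_idealD(4)[OF O_ideal_M, of "r * m ^ (n - 1)" m] O.mult_in[of r "m ^ (n - 1)"]
    O.power_in[OF M_subset_O, of m "n - 1"]
  by (simp add: mult.assoc flip: power_Suc2)

lemma scale_M_power_subset: "s \<in> \<O> \<Longrightarrow> \<J> s \<subseteq> \<M>"
  unfolding scale_M_power_eq using M_power_mult[OF _ _ q_pos] O_idealD(4)[OF O_ideal_M] by auto

lemma scale_M_power_neq:
  assumes s: "s \<in> \<M>" "s \<noteq> 0"
  shows "\<M> \<noteq> \<J> s"
proof
  assume "\<M> = \<J> s"
  then obtain r m where rm: "r \<in> \<O>" "m \<in> \<M>" "s = s * (r * m ^ q)" using s unfolding scale_M_power_eq by blast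
  then have "r * m ^ q = 1" using s(2) by simp
  then show False using M_power_mult[OF rm(1,2) q_pos] one_not_in_M by simp
qed

text \<open>If \<open>m\<close> generated the ideal, equality would give \<open>m\<close> as a
  multiple of \<open>m ^ q\<close>, and cancelling \<open>m\<close> would put 1 into \<M>.
  Conversely, \<open>s\<close> is a unit of \<open>OE K v\<close> and a nonprincipal ideal equals
  its \<open>q\<close>-th power.\<close>

lemma scale_M_power_eq_iff:
  assumes s: "s \<in> \<O>" "s \<noteq> 0"
  shows "\<M> = \<J> s \<longleftrightarrow> s \<notin> \<M> \<and> \<not> principal_M"
proof (intro iffI conjI)
  assume eq: "\<M> = \<J> s"
  show "s \<notin> \<M>" using scale_M_power_neq[OF _ s(2)] eq by blast
  show "\<not> principal_M"
  proof
    interpret E: subring_set "OE K v" by (rule OE_subring)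
    assume "principal_M"
    then obtain m where m: "m \<in> \<M>" "m \<noteq> 0" "\<And>x. x \<in> \<M> \<Longrightarrow> x / m \<in> OE K v" unfolding principal_iff by blast
    obtain r x where x: "r \<in> \<O>" "x \<in> \<M>" "m = s * (r * x ^ q)" using m(1) eq unfolding scale_M_power_eq by blast
    define e where "e = x / m"
    have e: "e \<in> OE K v" "x = e * m" using m x by (auto simp: e_def)
    have "m ^ q = m ^ (q - 1) * m" using q_pos by (simp flip: power_Suc2)
    then have "m = (s * r * e ^ q * m ^ (q - 1)) * m" using x(3) unfolding e(2) by (simp add: power_mult_distrib mult_ac)
    then have "s * r * e ^ q * m ^ (q - 1) = 1" using m(2) by (metis mult_cancel_right1)
    \<comment> \<open>At least one factor \<open>m\<close> remains after cancellation because
      \<open>q\<close> is at least 2.\<close>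
    moreover have "m ^ (q - 1) \<in> \<M>" using M_power_mult[OF O.one_in m(1), of "q - 1"] q_ge_2 by simp
    moreover have "s * r * e ^ q \<in> OE K v" 
      by (rule E.mult_in[OF E.mult_in[OF O_subset_OE[OF s(1)] O_subset_OE[OF x(1)]] E.power_in[OF e(1)]])
    ultimately show False using OE_mult_M one_not_in_M by metis
  qed
next
  assume *: "s \<notin> \<M> \<and> \<not> principal_M"
  show "\<M> = \<J> s"
  proof (rule equalityI)
    show "\<J> s \<subseteq> \<M>" by (rule scale_M_power_subset[OF s(1)])
    show "\<M> \<subseteq> \<J> s"
    proof
      fix x assume x: "x \<in> \<M>"
      show "x \<in> \<J> s"
      proof (cases "x = 0")
        case True
        then have "x = s * (0 * x ^ q)" by simp
        then show ?thesis using x O.zero_in unfolding scale_M_power_eq by blast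
      next
        case False
        \<comment> \<open>With its value in \<H>, \<open>s\<close> is invertible in
          \<open>OE K v\<close>, so dividing by it does not leave \<M>.\<close>
        have "v s \<in> \<H>" using * s not_in_M[of s] by (auto simp: O_iff)
        then have "inverse s \<in> OE K v" using s(2) H_minus by (auto simp: OE_iff v_inverse)
        then have y: "inverse s * x \<in> \<M>" by (rule OE_mult_M[OF _ x])
        obtain z where z: "z \<in> \<M>" "z \<noteq> 0" "v (z ^ q) \<le> v (inverse s * x)"
          using nonprincipal_root[of "inverse s * x" q] * y False s(2) by auto
        have "inverse s * x / z ^ q \<in> \<O>" using z False s(2) by (subst divide_in_O_iff) auto
        moreover have "x = s * (inverse s * x / z ^ q * z ^ q)" using z(2) s(2) by simp
        ultimately show ?thesis using z(1) unfolding scale_M_power_eq by blast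
      qed
    qed
  qed
qed

lemma zero_quot_carrier:
  assumes "s \<in> \<O>"
  shows "\<zero>\<^bsub>ideal_quot (OL v) \<M> (\<J> s)\<^esub> \<in>
      carrier (ideal_quot (OL v) \<M> (\<J> s))"
    "carrier (ideal_quot (OL v) \<M> (\<J> s)) =
      {\<zero>\<^bsub>ideal_quot (OL v) \<M> (\<J> s)\<^esub>} \<longleftrightarrow>
      \<M> = \<J> s"
proof -
  have "O_ideal (\<J> s)"
    by (intro O_ideal_scale assms O_ideal_power O_ideal_M)
  note * = quot_module_trivial_iff[OF ideal_module_is_module[OF O_ideal_M]
      ideal_submodule[OF O_ideal_M this scale_M_power_subset[OF assms]]]
  from * show "\<zero>\<^bsub>ideal_quot (OL v) \<M> (\<J> s)\<^esub> \<in>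
      carrier (ideal_quot (OL v) \<M> (\<J> s))"
    "carrier (ideal_quot (OL v) \<M> (\<J> s)) =
      {\<zero>\<^bsub>ideal_quot (OL v) \<M> (\<J> s)\<^esub>} \<longleftrightarrow>
      \<M> = \<J> s" by simp_all
qed

lemma Omega_trivial_iff:
  assumes iso: "module_isomorphic (OL v) \<Omega> (ideal_quot (OL v) \<M> (\<J> s))"
    and s: "s \<in> \<O>"
  shows "carrier \<Omega> = {\<zero>\<^bsub>\<Omega>\<^esub>} \<longleftrightarrow> \<M> = \<J> s"
proof -
  have "\<zero>\<^bsub>\<Omega>\<^esub> \<in> carrier \<Omega>"
    unfolding Omega_eq by (rule quot_module_trivial_iff(2)[OF F_module Rel_submodule])
  from module_isomorphic_zero[OF iso this zero_quot_carrier(1)[OF s]] zero_quot_carrier(2)[OF s]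
  show ?thesis by simp
qed

lemma scale_scale: "scale_ideal a (scale_ideal b I) = scale_ideal (a * b) (I :: 'l set)"
  by (simp add: image_image mult.assoc)

text \<open>Multiplication by \<open>w\<close> is the isomorphism. By \<open>eq\<close>,
  \<open>w * s\<close> and \<open>w ^ q\<close> have the same value, so the denominator becomes a
  genuine \<open>q\<close>-th power.\<close>

lemma M_quot_scale_iso:
  assumes s: "s \<in> \<O>" "s \<noteq> 0" and w: "w \<in> \<O>" "w \<noteq> 0" and eq: "v s = v (w ^ (q - 1))"
  shows "module_isomorphic (OL v) (ideal_quot (OL v) \<M> (\<J> s))
    (ideal_quot (OL v) (scale_ideal w \<M>) (OL_power v (scale_ideal w \<M>) q))"
proof -
  have J: "O_ideal (\<J> s)"
    by (intro O_ideal_scale s O_ideal_power O_ideal_M)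
  have "w ^ q = w * w ^ (q - 1)" using q_pos by (simp flip: power_Suc)
  then have "v (w * s) = v (w ^ q)" using s w eq by (simp add: v_mult)
  then have "scale_ideal w (\<J> s) = OL_power v (scale_ideal w \<M>) q"
    unfolding scale_scale scale_power[OF w(1) O_ideal_M]
    using s w by (intro scale_eq O_ideal_power O_ideal_M) auto
  then show ?thesis
    using ideal_quot_scale_iso[OF O_ideal_M J scale_M_power_subset[OF s(1)] w] by simp
qed

end


section \<open>Kummer extensions\<close>

locale kummer_valued = totally_ramified v K q
  for v :: "'l::field \<Rightarrow> 'g::linordered_ab_group_add" and K q +
  fixes \<zeta> :: 'l
  assumes kummer: "kummer_extension K q"
    and zeta_K: "\<zeta> \<in> K" and primitive: "primitive_root_of_unity q \<zeta>"
begin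

section \<open>Roots of unity and Kummer generators\<close>

lemma zeta_power_q: "\<zeta> ^ q = 1" and zeta_nz: "\<zeta> \<noteq> 0"
  using primitive q_pos by (auto simp: primitive_root_of_unity_def power_0_left)

lemma zeta_power_eq_1_iff: "\<zeta> ^ n = 1 \<longleftrightarrow> q dvd n"
proof -
  have "\<zeta> ^ n = \<zeta> ^ (q * (n div q) + n mod q)" by simp
  also have "\<dots> = \<zeta> ^ (n mod q)" unfolding power_add power_mult zeta_power_q by simp
  finally have "\<zeta> ^ n = 1 \<longleftrightarrow> \<zeta> ^ (n mod q) = 1" by simp
  also have "\<dots> \<longleftrightarrow> n mod q = 0"
    using primitive q_pos unfolding primitive_root_of_unity_def by (metis gr0I mod_less_divisor power_0)
  finally show ?thesis by auto
qed

lemma zeta_inj: "inj_on (\<lambda>i. \<zeta> ^ i) {..<q}"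
proof -
  have "\<not> i < j" if "j < q" "\<zeta> ^ i = \<zeta> ^ j" for i j
  proof
    assume "i < j"
    then have "\<zeta> ^ j = \<zeta> ^ i * \<zeta> ^ (j - i)" by (simp flip: power_add)
    then have "\<zeta> ^ (j - i) = 1" using that(2) zeta_nz by simp
    then have "q dvd j - i" by (simp add: zeta_power_eq_1_iff)
    then show False using that(1) \<open>i < j\<close> by (auto dest: dvd_imp_le)
  qed
  then show ?thesis unfolding inj_on_def by (metis lessThan_iff linorder_neqE_nat)
qed

lemma of_nat_q_nz: "of_nat q \<noteq> (0 :: 'l)"
proof
  assume "of_nat q = (0 :: 'l)"
  then have "CHAR('l) dvd q" by (simp add: of_nat_eq_0_iff_char_dvd)
  then have "CHAR('l) = 1 \<or> CHAR('l) = q" using prime_q unfolding prime_nat_iff by blast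
  then show False using kummer CHAR_not_1 by (auto simp: kummer_extension_def)
qed

lemma roots_of_unity: "(\<Prod>i<q. [:- (\<zeta> ^ i), 1:]) = monom 1 q - 1"
proof (rule poly_prod_roots[symmetric])
  have "degree (monom 1 q - 1 :: 'l poly) \<le> q" by (intro degree_diff_le) (auto simp: degree_monom_le)
  moreover have c: "coeff (monom 1 q - 1 :: 'l poly) q = 1" using q_pos by (auto simp: coeff_1)
  moreover have "q \<le> degree (monom 1 q - 1 :: 'l poly)" by (rule le_degree, subst c) simp
  ultimately show d: "degree (monom 1 q - 1 :: 'l poly) = q" by simp
  show "lead_coeff (monom 1 q - 1 :: 'l poly) = 1" unfolding d by (rule c)
  show "poly (monom 1 q - 1) (\<zeta> ^ i) = 0" for i
    by (simp add: poly_monom zeta_power_q flip: power_mult) (simp add: mult.commute[of i] power_mult zeta_power_q)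
qed (rule zeta_inj)

lemma root_of_unity: "x ^ q = 1 \<Longrightarrow> \<exists>k<q. x = \<zeta> ^ k"
  using arg_cong[OF roots_of_unity, of "\<lambda>p. poly p x"] by (auto simp: poly_monom poly_prod)

text \<open>Both sides are the derivative of \<open>X ^ q - 1\<close> at 1.\<close>

lemma q_eq_prod: "of_nat q = (\<Prod>i=1..q-1. 1 - \<zeta> ^ i)"
proof -
  have q: "q = Suc (q - 1)" using q_pos by simp
  have "poly (pderiv (\<Prod>i<Suc (q - 1). [:- (\<zeta> ^ i), 1:])) (\<zeta> ^ 0) = (\<Prod>i=1..q-1. \<zeta> ^ 0 - \<zeta> ^ i)"
    by (rule pderiv_prod_root)
  then show ?thesis
    unfolding q[symmetric] roots_of_unity by (simp add: pderiv_diff pderiv_monom poly_monom)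
qed

lemma zeta_O: "\<zeta> \<in> \<O>"
  using v_power_0_iff[OF zeta_nz q_pos] zeta_power_q by (auto simp: O_iff)

lemma zeta_1_nz: "\<zeta> - 1 \<noteq> 0" and zeta_1_O: "\<zeta> - 1 \<in> \<O>" and zeta_1_K: "\<zeta> - 1 \<in> K"
  using zeta_power_eq_1_iff[of 1] q_ge_2 O.diff_in[OF zeta_O O.one_in] K.diff_in[OF zeta_K K.one_in] by auto

text \<open>\<open>\<zeta> ^ k\<close> is again a primitive root, so \<zeta> is a power of it; thus
  \<open>\<zeta> ^ k - 1\<close> and \<open>\<zeta> - 1\<close> divide each other in \<O>.\<close>

lemma v_zeta_power:
  assumes "\<not> q dvd k" shows "\<zeta> ^ k - 1 \<noteq> 0" "v (\<zeta> ^ k - 1) = v (\<zeta> - 1)"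
proof -
  show nz: "\<zeta> ^ k - 1 \<noteq> 0" using assms by (simp add: zeta_power_eq_1_iff)
  obtain r where r: "r \<in> \<O>" "\<zeta> ^ k - 1 = (\<zeta> - 1) * r" using O.power_diff_one[OF zeta_O] by blast
  obtain a b where "k * a = q * b + 1" using bezout_q[OF assms] .
  then have "(\<zeta> ^ k) ^ a = \<zeta>" by (simp add: power_mult zeta_power_q flip: power_mult[of _ k])
  then obtain s where s: "s \<in> \<O>" "\<zeta> - 1 = (\<zeta> ^ k - 1) * s"
    using O.power_diff_one[OF O.power_in[OF zeta_O, of k], of a] by auto
  have nz': "r \<noteq> 0" "s \<noteq> 0" using r s nz zeta_1_nz by auto
  then have ge: "0 \<le> v r" "0 \<le> v s" using r(1) s(1) by (simp_all add: O_iff)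
  have "v (\<zeta> ^ k - 1) = v (\<zeta> - 1) + v r" unfolding r(2) by (rule v_mult[OF zeta_1_nz nz'(1)])
  then have "v (\<zeta> - 1) \<le> v (\<zeta> ^ k - 1)" using ge(1) by simp
  moreover have "v (\<zeta> - 1) = v (\<zeta> ^ k - 1) + v s" unfolding s(2) by (rule v_mult[OF nz nz'(2)])
  then have "v (\<zeta> ^ k - 1) \<le> v (\<zeta> - 1)" using ge(2) by simp
  ultimately show "v (\<zeta> ^ k - 1) = v (\<zeta> - 1)" by simp
qed

lemma v_q: "v (of_nat q) = v ((\<zeta> - 1) ^ (q - 1))"
proof -
  have nz: "1 - \<zeta> ^ i \<noteq> 0 \<and> v (1 - \<zeta> ^ i) = v (\<zeta> - 1)" if "i \<in> {1..q-1}" for i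
  proof -
    have "\<not> q dvd i" using that q_ge_2 by (intro not_dvd_less) auto
    from v_zeta_power[OF this] show ?thesis using v_minus[of "1 - \<zeta> ^ i"] by auto
  qed
  have "v (of_nat q) = (\<Sum>i=1..q-1. v (1 - \<zeta> ^ i))" unfolding q_eq_prod using nz by (intro v_prod) auto
  also have "\<dots> = (\<Sum>i=1..q-1. v (\<zeta> - 1))" using nz by (intro sum.cong) auto
  also have "\<dots> = v ((\<zeta> - 1) ^ (q - 1))" using v_prod[of "{1..q-1}" "\<lambda>_. \<zeta> - 1"] zeta_1_nz by simp
  finally show ?thesis .
qed

lemma ex_gal: "\<exists>\<sigma>\<in>gal K. \<sigma> \<noteq> id"
proof (rule ccontr)
  assume "\<not> ?thesis"
  then have "{x. \<forall>\<sigma>\<in>gal K. \<sigma> x = x} = UNIV" by auto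
  moreover have "{x. \<forall>\<sigma>\<in>gal K. \<sigma> x = x} = K"
    using kummer by (simp add: kummer_extension_def galois_extension_def)
  moreover obtain t where "outside t" using ex_outside by blast
  then have "t \<notin> K" using Gamma_v[of t] by (auto simp: outside_def)
  ultimately show False by blast
qed

text \<open>Kummer theory: some Lagrange resolvent of an element outside of \<open>K\<close> does not vanish.\<close>

lemma ex_kummer_element: "\<exists>\<eta>. \<eta> \<notin> K \<and> \<eta> ^ q \<in> K"
proof -
  obtain \<sigma> where \<sigma>: "\<sigma> \<in> gal K" "\<sigma> \<noteq> id" using ex_gal by blast
  obtain y where y: "\<sigma> y \<noteq> y" using \<sigma>(2) by (auto simp: fun_eq_iff)
  define e where "e = (\<lambda>k. \<Sum>i<q. \<zeta> ^ (k * i) * (\<sigma> ^^ i) y)"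
  have zf: "\<sigma> (\<zeta> ^ k) = \<zeta> ^ k" for k by (intro gal_fix[OF \<sigma>(1)] K.power_in zeta_K)
  have e: "\<zeta> ^ k * \<sigma> (e k) = e k" for k
  proof -
    define g where "g = (\<lambda>i. \<zeta> ^ (k * i) * (\<sigma> ^^ i) y)"
    have "\<zeta> ^ k * \<sigma> (e k) = (\<Sum>i<q. g (Suc i))"
      unfolding e_def gal_sum[OF \<sigma>(1)] g_def
      by (simp add: gal_mult[OF \<sigma>(1)] zf sum_distrib_left power_add mult.assoc)
    moreover have "g 0 + (\<Sum>i<q. g (Suc i)) = (\<Sum>i<q. g i) + g q"
      using sum.lessThan_Suc_shift[of g q] by simp
    moreover have "g q = g 0"
      using gal_order[OF \<sigma>] zeta_power_eq_1_iff[of "k * q"] by (simp add: g_def)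
    ultimately show ?thesis by (simp add: g_def e_def)
  qed
  \<comment> \<open>Summing over all resolvents kills every conjugate except \<open>y\<close>, by
    the vanishing of the geometric sums.\<close>
  have sum_e: "(\<Sum>k<q. e k) = of_nat q * y"
  proof -
    have geo: "(\<Sum>k<q. \<zeta> ^ (k * i)) = (if i = 0 then of_nat q else 0)" if "i < q" for i
    proof (cases "i = 0")
      case False
      have "(\<zeta> ^ i - 1) * (\<Sum>k<q. (\<zeta> ^ i) ^ k) = (\<zeta> ^ i) ^ q - 1" by (simp add: power_diff_1_eq)
      also have "(\<zeta> ^ i) ^ q = 1" using zeta_power_eq_1_iff[of "i * q"] by (simp add: power_mult)
      finally have "(\<Sum>k<q. (\<zeta> ^ i) ^ k) = 0"
        using v_zeta_power(1)[OF not_dvd_less[of i]] False that by simp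
      then show ?thesis using False by (simp add: mult.commute flip: power_mult)
    qed simp
    have "(\<Sum>k<q. e k) = (\<Sum>i<q. (\<Sum>k<q. \<zeta> ^ (k * i)) * (\<sigma> ^^ i) y)"
      unfolding e_def sum_distrib_right by (rule sum.swap)
    also have "\<dots> = (\<Sum>i<q. if i = 0 then of_nat q * y else 0)"
      by (intro sum.cong refl) (simp add: geo)
    also have "\<dots> = of_nat q * y" using q_pos by simp
    finally show ?thesis .
  qed
  \<comment> \<open>If only the resolvent \<open>e 0\<close> survived, \<open>q * y\<close> and
    hence \<open>y\<close> would be fixed by \<sigma>, as \<open>q\<close> is not 0 in
    \<open>L\<close>.\<close>
  have "\<exists>k. 0 < k \<and> k < q \<and> e k \<noteq> 0"
  proof (rule ccontr)
    assume "\<not> ?thesis"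
    then have "(\<Sum>k<q. e k) = (\<Sum>k<q. if k = 0 then e 0 else 0)"
      by (intro sum.cong refl) auto
    then have "of_nat q * y = e 0" using sum_e q_pos by simp
    moreover have "\<sigma> (e 0) = e 0" using e[of 0] by simp
    ultimately have "\<sigma> (of_nat q * y) = of_nat q * y" by metis
    moreover have "\<sigma> (of_nat q) = of_nat q" by (intro gal_fix[OF \<sigma>(1)] K.of_nat_in)
    ultimately have "of_nat q * \<sigma> y = of_nat q * y" unfolding gal_mult[OF \<sigma>(1)] by metis
    then show False using of_nat_q_nz y by simp
  qed
  then obtain k where k: "0 < k" "k < q" "e k \<noteq> 0" by blast
  have "\<zeta> ^ k \<noteq> 1" using v_zeta_power(1)[OF not_dvd_less[OF k(1,2)]] by simp
  have "e k ^ q = (\<zeta> ^ k) ^ q * \<sigma> (e k) ^ q" using e[of k] by (metis power_mult_distrib)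
  also have "(\<zeta> ^ k) ^ q = 1" using zeta_power_eq_1_iff[of "k * q"] by (simp add: power_mult)
  finally have "\<sigma> (e k ^ q) = e k ^ q" unfolding gal_power[OF \<sigma>(1)] by simp
  then have "e k ^ q \<in> K" by (rule gal_fixed_imp[OF \<sigma>])
  moreover have "e k \<notin> K"
  proof
    assume "e k \<in> K"
    then have "\<zeta> ^ k * e k = 1 * e k" using e[of k] gal_fix[OF \<sigma>(1)] by simp
    then show False using k(3) \<open>\<zeta> ^ k \<noteq> 1\<close> by (metis mult_right_cancel)
  qed
  ultimately show ?thesis by blast
qed

lemma gal_kummer:
  assumes \<eta>: "\<eta> \<notin> K" "\<eta> ^ q \<in> K" and \<tau>: "\<tau> \<in> gal K"
  obtains k where "\<tau> \<eta> = \<zeta> ^ k * \<eta>" "q dvd k \<longleftrightarrow> \<tau> = id"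
proof -
  have \<eta>0: "\<eta> \<noteq> 0" using \<eta> K.zero_in by auto
  have "(\<tau> \<eta> / \<eta>) ^ q = \<tau> (\<eta> ^ q) / \<eta> ^ q" by (simp add: gal_power[OF \<tau>] power_divide)
  also have "\<dots> = 1" using gal_fix[OF \<tau> \<eta>(2)] \<eta>0 by simp
  finally obtain k where "\<tau> \<eta> / \<eta> = \<zeta> ^ k" using root_of_unity by blast
  then have k: "\<tau> \<eta> = \<zeta> ^ k * \<eta>" using \<eta>0 by (simp add: field_simps)
  have "q dvd k \<longleftrightarrow> \<tau> \<eta> = \<eta>" using k \<eta>0 zeta_power_eq_1_iff[of k] by simp
  also have "\<dots> \<longleftrightarrow> \<tau> = id" using gal_fixed_imp[OF \<tau>, of \<eta>] \<eta>(1) by auto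
  finally show ?thesis using that k by blast
qed

lemma kummer_generator_iff: "kummer_generator K q \<eta> \<longleftrightarrow> \<eta> \<notin> K \<and> \<eta> ^ q \<in> K"
  unfolding kummer_generator_def generate_field_iff ..

lemma kummer_case_i_iff:
  "kummer_case_i K v q \<eta> \<longleftrightarrow> \<eta> \<notin> K \<and> \<eta> ^ q \<in> K \<and> outside \<eta> \<and> generates_O \<eta>"
  using value_group_eq_iff[of \<eta>] K.zero_in
  by (auto simp: kummer_case_i_def kummer_generator_iff generates_O_def)

lemma kummer_case_ii_iff:
  "kummer_case_ii K v q \<zeta> \<eta> \<longleftrightarrow> \<eta> \<notin> K \<and> \<eta> ^ q \<in> K \<and> one_unit v \<eta> \<and> v ((\<eta> - 1) / (\<zeta> - 1)) < 0 \<and>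
     outside ((\<eta> - 1) / (\<zeta> - 1)) \<and> (\<exists>j\<in>{1..q-1}. generates_O (((\<eta> - 1) / (\<zeta> - 1)) ^ j))"
proof -
  have "(\<eta> - 1) / (\<zeta> - 1) \<noteq> 0" if "\<eta> \<notin> K" using that K.one_in zeta_1_nz by auto
  from value_group_eq_iff[OF this] show ?thesis
    by (auto simp: kummer_case_ii_def kummer_generator_iff generates_O_def Let_def)
qed

text \<open>For nontrivial \<sigma>, \<open>\<sigma> (\<eta> - 1) - (\<eta> - 1)\<close> is
  \<open>(\<zeta> ^ k - 1) * \<eta>\<close>, of value \<open>v (\<zeta> - 1)\<close>. Since \<sigma>
  preserves values, this is at least \<open>v (\<eta> - 1)\<close>.\<close>

lemma v_eta_diff_le:
  assumes \<eta>: "\<eta> \<notin> K" "\<eta> ^ q \<in> K" "v \<eta> = 0"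
  shows "v (\<eta> - 1) \<le> v (\<zeta> - 1)"
proof -
  obtain \<sigma> where \<sigma>: "\<sigma> \<in> gal K" "\<sigma> \<noteq> id" using ex_gal by blast
  obtain k where k: "\<sigma> \<eta> = \<zeta> ^ k * \<eta>" "q dvd k \<longleftrightarrow> \<sigma> = id" using gal_kummer[OF \<eta>(1,2) \<sigma>(1)] .
  have \<eta>0: "\<eta> \<noteq> 0" "\<eta> - 1 \<noteq> 0" using \<eta> K.zero_in K.one_in by auto
  have z: "\<zeta> ^ k - 1 \<noteq> 0" "v (\<zeta> ^ k - 1) = v (\<zeta> - 1)" using v_zeta_power k(2) \<sigma>(2) by auto
  have "val_ge v (\<sigma> (\<eta> - 1) - (\<eta> - 1)) (v (\<eta> - 1))"
    by (rule val_ge_diff) (simp_all only: gal_val_ge[OF \<sigma>(1)], simp_all add: val_ge_def)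
  also have "\<sigma> (\<eta> - 1) - (\<eta> - 1) = (\<zeta> ^ k - 1) * \<eta>"
    using k(1) by (simp add: gal_diff[OF \<sigma>(1)] gal_one[OF \<sigma>(1)] algebra_simps)
  finally show ?thesis using z \<eta>0 \<eta>(3) by (simp add: v_mult)
qed

lemma residue_char_iff_zeta: "val_gt v (of_nat q) 0 \<longleftrightarrow> 0 < v (\<zeta> - 1)"
  using v_power_pos_iff[OF zeta_1_nz, of "q - 1"] q_ge_2 of_nat_q_nz v_q by simp

text \<open>The second alternative is paired with residue characteristic \<open>q\<close>, so that
  any other characteristic leaves only case (i).\<close>

lemma ex_case:
  "(\<exists>\<eta>. kummer_case_i K v q \<eta>) \<or> (\<exists>\<eta>. kummer_case_ii K v q \<zeta> \<eta>) \<and> val_gt v (of_nat q) 0"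
proof -
  obtain \<eta>0 where \<eta>0: "\<eta>0 \<notin> K" "\<eta>0 ^ q \<in> K" using ex_kummer_element by blast
  have nz: "\<eta>0 \<noteq> 0" using \<eta>0 K.zero_in by auto
  show ?thesis
  proof (cases "outside \<eta>0")
    case True
    obtain j where j: "0 < j" "j < q" "good (\<eta>0 ^ j)" using ex_good[OF True] .
    have out: "outside (\<eta>0 ^ j)" using j(3) by (simp add: good_def)
    have "(\<eta>0 ^ j) ^ q = (\<eta>0 ^ q) ^ j" by (simp add: mult.commute flip: power_mult)
    then have "(\<eta>0 ^ j) ^ q \<in> K" using K.power_in[OF \<eta>0(2), of j] by simp
    moreover have "\<eta>0 ^ j \<notin> K" using out Gamma_v[of "\<eta>0 ^ j"] by (auto simp: outside_def)
    ultimately have "kummer_case_i K v q (\<eta>0 ^ j)"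
      unfolding kummer_case_i_iff using good_generates[OF j(3)] out by blast
    then show ?thesis by blast
  next
    case False
    then have "v \<eta>0 \<in> \<Gamma>" using nz by (simp add: outside_def)
    then obtain a where a: "a \<in> K" "a \<noteq> 0" "v a = v \<eta>0" "outside (\<eta>0 - a)" "v \<eta>0 < v (\<eta>0 - a)"
      using approx_Gamma[OF nz \<eta>0(1)] by blast
    \<comment> \<open>As \<open>a\<close> agrees with \<open>\<eta>0\<close> to leading order, the
      quotient is a 1-unit; \<open>\<eta> - 1\<close> is a \<open>K\<close>-multiple of the outside
      element \<open>\<eta>0 - a\<close>.\<close>
    define \<eta> where "\<eta> = \<eta>0 / a"
    define \<xi> where "\<xi> = (\<eta> - 1) / (\<zeta> - 1)"
    have \<eta>K: "\<eta> \<notin> K"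
    proof
      assume "\<eta> \<in> K"
      then have "\<eta> * a \<in> K" using a by (intro K.mult_in)
      then show False using \<eta>0 a by (simp add: \<eta>_def)
    qed
    have \<eta>q: "\<eta> ^ q \<in> K" using \<eta>0 a by (auto simp: \<eta>_def power_divide intro: K_divide K.power_in)
    have v\<eta>: "v \<eta> = 0" using a nz by (simp add: \<eta>_def v_divide)
    have d: "\<eta> - 1 = inverse a * (\<eta>0 - a)" using a by (simp add: \<eta>_def field_simps)
    have out: "outside (\<eta> - 1)" unfolding d using a K_inverse by (intro outside_mult_K[OF a(4)]) auto
    have pos: "0 < v (\<eta> - 1)" unfolding d using a by (auto simp: outside_def v_mult v_inverse)
    have le: "v (\<eta> - 1) \<le> v (\<zeta> - 1)" using v_eta_diff_le[OF \<eta>K \<eta>q v\<eta>] .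
    have one: "one_unit v \<eta>" using pos v\<eta> by (simp add: one_unit_def O_iff val_gt_def)
    have "\<xi> = inverse (\<zeta> - 1) * (\<eta> - 1)" by (simp add: \<xi>_def divide_inverse)
    then have out\<xi>: "outside \<xi>"
      using outside_mult_K[OF out, of "inverse (\<zeta> - 1)"] K_inverse[OF zeta_1_K] zeta_1_nz by simp
    have "v \<xi> \<le> 0" using out le zeta_1_nz by (simp add: \<xi>_def outside_def v_divide)
    then have v\<xi>: "v \<xi> < 0" using out\<xi> Gamma_0 by (metis le_less outside_def)
    obtain j where j: "0 < j" "j < q" "good (\<xi> ^ j)" using ex_good[OF out\<xi>] .
    have "j \<in> {1..q-1}" using j by auto
    then have "kummer_case_ii K v q \<zeta> \<eta>"
      unfolding kummer_case_ii_iff \<xi>_def[symmetric]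
      using \<eta>K \<eta>q one v\<xi> out\<xi> good_generates[OF j(3)] by blast
    \<comment> \<open>\<open>v (\<zeta> - 1)\<close> is at least \<open>v (\<eta> - 1)\<close>,
      hence positive.\<close>
    moreover have "val_gt v (of_nat q) 0" using pos le by (simp add: residue_char_iff_zeta)
    ultimately show ?thesis by blast
  qed
qed

text \<open>\<open>u = c * \<eta>\<close> is a root of \<open>X ^ q - u ^ q\<close>, whose
  derivative at \<open>u\<close> is \<open>q * u ^ (q - 1)\<close>; this explains the factor
  \<open>s = q\<close>.\<close>

lemma case_i_iso:
  assumes "kummer_case_i K v q \<eta>"
  shows "module_isomorphic (OL v) \<Omega> (ideal_quot (OL v) \<M> (\<J> (of_nat q)))"
proof (rule kaehler_iso)
  have \<eta>: "\<eta> \<notin> K" "\<eta> ^ q \<in> K" and out: "outside \<eta>" "generates_O \<eta>"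
    using assms by (auto simp: kummer_case_i_iff)
  show "outside \<eta>" "generates_O \<eta>" by fact+
  show "of_nat q \<in> \<O>" "of_nat q \<noteq> (0 :: 'l)" by (rule O.of_nat_in, rule of_nat_q_nz)
  fix c assume c: "c \<in> K" "c \<noteq> 0" "0 < v (c * \<eta>)"
  define u where "u = c * \<eta>"
  define h where "h = monom 1 q - [:u ^ q:]"
  have u0: "u \<noteq> 0" using c \<eta> K.zero_in by (auto simp: u_def)
  have "u ^ q \<in> K" using c \<eta> by (auto simp: u_def power_mult_distrib intro: K.mult_in K.power_in)
  moreover have "u ^ q \<in> \<O>" using c by (intro O.power_in) (simp add: u_def O_iff less_imp_le)
  ultimately have "u ^ q \<in> \<A>" by (simp add: A_iff)
  then have h: "h \<in> polys_over \<A>" unfolding h_def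
    by (intro A.diff_polys_over A.monom_polys_over A.one_in) (simp add: A.pCons_polys_over A.zero_polys_over)
  have "degree h \<le> q" unfolding h_def by (intro degree_diff_le) (auto simp: degree_monom_le)
  moreover have c1: "coeff h q = 1" using q_pos by (simp add: h_def coeff_pCons split: nat.splits)
  moreover have "q \<le> degree h" by (rule le_degree) (simp add: c1)
  ultimately have deg: "degree h = q" "lead_coeff h = 1" by auto
  have "poly h u = 0" by (simp add: h_def poly_monom)
  moreover have "poly (pderiv h) u = of_nat q * u ^ (q - 1)"
    by (simp add: h_def pderiv_diff pderiv_monom poly_monom pderiv_pCons)
  ultimately show "\<exists>h\<in>polys_over \<A>. lead_coeff h = 1 \<and> degree h = q \<and> poly h (c * \<eta>) = 0 \<and>
        poly (pderiv h) (c * \<eta>) \<noteq> 0 \<and> v (poly (pderiv h) (c * \<eta>)) = v (of_nat q * (c * \<eta>) ^ (q - 1))"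
    using h deg u0 of_nat_q_nz unfolding u_def[symmetric] by (intro bexI[of _ h]) auto
qed

text \<open>Automorphisms multiply \<eta> by powers of \<zeta>, so each power of \<eta> changes by a
  multiple of \<open>\<zeta> - 1\<close>. A nontrivial automorphism attains this value at \<eta>
  itself.\<close>

lemma case_i_ramification:
  assumes "kummer_case_i K v q \<eta>"
  shows "ramification_ideal K v = scale_ideal (\<zeta> - 1) \<O>"
proof -
  have \<eta>: "\<eta> \<notin> K" "\<eta> ^ q \<in> K" and out: "outside \<eta>"
    using assms by (auto simp: kummer_case_i_iff)
  have \<eta>0: "\<eta> \<noteq> 0" using \<eta> K.zero_in by auto
  obtain \<sigma> where \<sigma>: "\<sigma> \<in> gal K" "\<sigma> \<noteq> id" using ex_gal by blast
  obtain k where k: "\<sigma> \<eta> = \<zeta> ^ k * \<eta>" "q dvd k \<longleftrightarrow> \<sigma> = id" using gal_kummer[OF \<eta> \<sigma>(1)] .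
  have z: "\<zeta> ^ k - 1 \<noteq> 0" "v (\<zeta> ^ k - 1) = v (\<zeta> - 1)" using v_zeta_power k(2) \<sigma>(2) by auto
  have d: "\<sigma> \<eta> - \<eta> = \<eta> * (\<zeta> ^ k - 1)" using k(1) by (simp add: algebra_simps)
  show ?thesis
  proof (rule ramification_ideal_eq[OF out zeta_1_O zeta_1_nz _ \<sigma>(1)])
    show "\<sigma> \<eta> \<noteq> \<eta>" using d z \<eta>0 by auto
    show "v (\<sigma> \<eta> - \<eta>) = v (\<eta> * (\<zeta> - 1))" unfolding d using z \<eta>0 zeta_1_nz by (simp add: v_mult)
    fix \<tau> i assume \<tau>: "\<tau> \<in> gal K"
    obtain l where l: "\<tau> \<eta> = \<zeta> ^ l * \<eta>" using gal_kummer[OF \<eta> \<tau>] by metis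
    obtain r where r: "r \<in> \<O>" "\<zeta> ^ (l * i) - 1 = (\<zeta> - 1) * r" using O.power_diff_one[OF zeta_O] by blast
    have "\<tau> (\<eta> ^ i) - \<eta> ^ i = \<eta> ^ i * (\<zeta> ^ (l * i) - 1)"
      by (simp add: gal_power[OF \<tau>] l power_mult_distrib algebra_simps flip: power_mult)
    also have "\<dots> = \<eta> ^ i * (\<zeta> - 1) * r" by (simp add: r(2) mult.assoc)
    finally show "val_ge v (\<tau> (\<eta> ^ i) - \<eta> ^ i) (v (\<eta> ^ i * (\<zeta> - 1)))"
      using val_ge_mult[of "\<eta> ^ i * (\<zeta> - 1)" "v (\<eta> ^ i * (\<zeta> - 1))" r 0] r(1) \<eta>0 zeta_1_nz
      by (simp add: val_ring_def)
  qed
qed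

text \<open>By Bezout 1 is a difference of multiples of \<open>j\<close> and \<open>q\<close>; they
  cannot both have positive value.\<close>

lemma v_of_nat_less:
  assumes "val_gt v (of_nat q) 0" "0 < j" "j < q"
  shows "of_nat j \<noteq> (0 :: 'l)" "v (of_nat j) = 0"
proof -
  have not: "\<not> val_gt v (of_nat j) 0"
  proof
    assume j: "val_gt v (of_nat j) 0"
    obtain a b where ab: "j * a = q * b + 1" using bezout_q[OF not_dvd_less[OF assms(2,3)]] .
    have mult: "val_gt v (x * of_nat n) 0" if "val_gt v x 0" for x and n :: nat
    proof (cases "x = 0 \<or> of_nat n = (0 :: 'l)")
      case False
      then show ?thesis using that O.of_nat_in[of n] by (auto simp: v_mult O_iff intro: add_pos_nonneg)
    qed auto
    have "val_gt v (of_nat j * of_nat a - of_nat q * of_nat b) 0"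
      by (intro val_gt_diff mult j assms(1))
    also have "of_nat j * of_nat a - of_nat q * of_nat b = (1 :: 'l)"
      using arg_cong[OF ab, of "of_nat :: nat \<Rightarrow> 'l"] by simp
    finally show False by simp
  qed
  then show "of_nat j \<noteq> (0 :: 'l)" by auto
  then show "v (of_nat j) = 0" using not O.of_nat_in[of j] by (auto simp: O_iff)
qed

section \<open>Galois action and differentials in case (ii)\<close>

context
  fixes \<eta> \<xi> :: 'l
  assumes case_ii: "kummer_case_ii K v q \<zeta> \<eta>" and xi_def: "\<xi> = (\<eta> - 1) / (\<zeta> - 1)"
begin

lemma eta: "\<eta> \<notin> K" "\<eta> ^ q \<in> K" "\<eta> \<noteq> 0" "v \<eta> = 0" and xi: "v \<xi> < 0" "outside \<xi>" "\<xi> \<noteq> 0"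
  and char_q: "val_gt v (of_nat q) 0" and inverse_xi: "inverse \<xi> \<in> \<M>" "inverse \<xi> \<noteq> 0"
proof -
  show eta: "\<eta> \<notin> K" "\<eta> ^ q \<in> K" and xi: "v \<xi> < 0" "outside \<xi>"
    using case_ii by (simp_all add: kummer_case_ii_iff xi_def)
  show \<eta>0: "\<eta> \<noteq> 0" and \<xi>0: "\<xi> \<noteq> 0" using eta xi K.zero_in by (auto simp: outside_def)
  have "one_unit v \<eta>" using case_ii by (simp add: kummer_case_ii_iff)
  then have pos: "val_gt v (\<eta> - 1) 0" by (simp add: one_unit_def)
  then show "v \<eta> = 0" using v_add_eq[of 1 "\<eta> - 1"] by simp
  have "\<eta> - 1 \<noteq> 0" using eta K.one_in by auto
  then have "0 < v (\<eta> - 1)" "v (\<eta> - 1) < v (\<zeta> - 1)" using pos xi(1) zeta_1_nz by (auto simp: xi_def v_divide)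
  then show "val_gt v (of_nat q) 0" unfolding residue_char_iff_zeta by simp
  show "inverse \<xi> \<in> \<M>" using xi \<xi>0 by (intro outside_in_M outside_inverse) (auto simp: v_inverse)
  show "inverse \<xi> \<noteq> 0" using \<xi>0 by simp
qed

text \<open>\<open>\<tau> \<xi> - \<xi>\<close> is \<eta> times
  \<open>(\<zeta> ^ k - 1) / (\<zeta> - 1)\<close>, which is integral and, for nontrivial \<tau>, a
  unit. Dividing by \<open>\<zeta> - 1\<close> in the definition of \<xi> is what makes this
  difference have value 0.\<close>

lemma gal_xi:
  assumes \<tau>: "\<tau> \<in> gal K"
  obtains \<epsilon> where "\<tau> \<xi> = \<xi> * (1 + \<epsilon>)" "val_ge v \<epsilon> (v (inverse \<xi>))"
    "\<tau> \<noteq> id \<Longrightarrow> \<epsilon> \<noteq> 0 \<and> v \<epsilon> = v (inverse \<xi>)"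
proof -
  obtain k where k: "\<tau> \<eta> = \<zeta> ^ k * \<eta>" "q dvd k \<longleftrightarrow> \<tau> = id" using gal_kummer[OF eta(1,2) \<tau>] .
  have zf: "\<tau> (\<zeta> - 1) = \<zeta> - 1" by (rule gal_fix[OF \<tau> zeta_1_K])
  have d: "\<tau> \<xi> - \<xi> = \<eta> * ((\<zeta> ^ k - 1) / (\<zeta> - 1))"
    unfolding xi_def gal_divide[OF \<tau>] zf unfolding gal_diff[OF \<tau>] gal_one[OF \<tau>] k(1)
    by (simp add: algebra_simps flip: diff_divide_distrib)
  define \<epsilon> where "\<epsilon> = inverse \<xi> * (\<eta> * ((\<zeta> ^ k - 1) / (\<zeta> - 1)))"
  have "\<tau> \<xi> = \<xi> * (1 + \<epsilon>)" using d xi(3) by (simp add: \<epsilon>_def algebra_simps)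
  moreover have "val_ge v \<epsilon> (v (inverse \<xi>))"
  proof -
    obtain r where r: "r \<in> \<O>" "\<zeta> ^ k - 1 = (\<zeta> - 1) * r" using O.power_diff_one[OF zeta_O] by blast
    have "\<eta> * ((\<zeta> ^ k - 1) / (\<zeta> - 1)) \<in> \<O>"
      using r zeta_1_nz eta by (intro O.mult_in) (auto simp: O_iff)
    then show ?thesis
      using val_ge_mult[of "inverse \<xi>" "v (inverse \<xi>)" "\<eta> * ((\<zeta> ^ k - 1) / (\<zeta> - 1))" 0] xi(3)
      by (simp add: \<epsilon>_def val_ring_def)
  qed
  moreover have "\<epsilon> \<noteq> 0 \<and> v \<epsilon> = v (inverse \<xi>)" if "\<tau> \<noteq> id"
    using v_zeta_power[of k] k(2) that eta xi(3) zeta_1_nz by (simp add: \<epsilon>_def v_mult v_divide)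
  ultimately show ?thesis using that by blast
qed

text \<open>The weak bound holds for all exponents and automorphisms, as needed for the ramification
  ideal; the exact value requires exponents prime to \<open>q\<close>.\<close>

lemma gal_xi_power_ge:
  assumes \<tau>: "\<tau> \<in> gal K"
  shows "val_ge v (\<tau> (\<xi> ^ i) - \<xi> ^ i) (v (\<xi> ^ i * inverse \<xi>))"
proof -
  obtain \<epsilon> where \<epsilon>: "\<tau> \<xi> = \<xi> * (1 + \<epsilon>)" "val_ge v \<epsilon> (v (inverse \<xi>))" using gal_xi[OF \<tau>] by metis
  have "\<epsilon> / inverse \<xi> \<in> \<O>" using \<epsilon>(2) inverse_xi(2) by (simp add: divide_in_O_iff)
  then have "\<epsilon> / inverse \<xi> * inverse \<xi> \<in> \<O>" using M_subset_O[OF inverse_xi(1)] by (rule O.mult_in)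
  then have "1 + \<epsilon> \<in> \<O>" using xi(3) by (intro O.add_in O.one_in) simp
  then obtain r where r: "r \<in> \<O>" "(1 + \<epsilon>) ^ i - 1 = (1 + \<epsilon> - 1) * r" using O.power_diff_one by blast
  have "\<tau> (\<xi> ^ i) - \<xi> ^ i = \<xi> ^ i * ((1 + \<epsilon>) ^ i - 1)"
    by (simp add: gal_power[OF \<tau>] \<epsilon>(1) power_mult_distrib right_diff_distrib)
  also have "\<dots> = \<xi> ^ i * \<epsilon> * r" by (simp add: r(2) mult.assoc)
  finally have *: "\<tau> (\<xi> ^ i) - \<xi> ^ i = \<xi> ^ i * \<epsilon> * r" .
  have "val_ge v (\<xi> ^ i * \<epsilon>) (v (\<xi> ^ i) + v (inverse \<xi>))"
    using xi(3) by (intro val_ge_mult[OF _ \<epsilon>(2)]) auto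
  then have "val_ge v (\<xi> ^ i * \<epsilon> * r) (v (\<xi> ^ i) + v (inverse \<xi>) + 0)"
    using r(1) by (intro val_ge_mult[of "\<xi> ^ i * \<epsilon>"]) (auto simp: val_ring_def)
  then show ?thesis unfolding * using xi(3) by (simp add: v_mult)
qed

text \<open>\<open>(1 + \<epsilon>) ^ i - 1\<close> is \<epsilon> times a geometric sum congruent to
  \<open>i\<close> modulo \<M>. For \<open>0 < i < q\<close> this sum is a unit, as the residue
  characteristic is \<open>q\<close>.\<close>

lemma gal_xi_power:
  assumes \<tau>: "\<tau> \<in> gal K" "\<tau> \<noteq> id" and i: "0 < i" "i < q"
  shows "\<tau> (\<xi> ^ i) - \<xi> ^ i \<noteq> 0" "v (\<tau> (\<xi> ^ i) - \<xi> ^ i) = v (\<xi> ^ i * inverse \<xi>)"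
proof -
  obtain \<epsilon> where \<epsilon>: "\<tau> \<xi> = \<xi> * (1 + \<epsilon>)" "\<epsilon> \<noteq> 0" "v \<epsilon> = v (inverse \<xi>)" using gal_xi[OF \<tau>(1)] \<tau>(2) by metis
  have \<epsilon>M: "\<epsilon> \<in> \<M>" using M_mono[OF inverse_xi] \<epsilon>(3) by simp
  then have O1: "1 + \<epsilon> \<in> \<O>" by (intro O.add_in O.one_in M_subset_O)
  have gt: "val_gt v ((1 + \<epsilon>) ^ l - 1) 0" for l
  proof -
    obtain r where r: "r \<in> \<O>" "(1 + \<epsilon>) ^ l - 1 = (1 + \<epsilon> - 1) * r" using O.power_diff_one[OF O1] by blast
    then have "(1 + \<epsilon>) ^ l - 1 \<in> \<M>" using O_idealD(4)[OF O_ideal_M r(1) \<epsilon>M] by (simp add: mult.commute)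
    from M_pos[OF this] show ?thesis by (auto simp: val_gt_def)
  qed
  define s where "s = (\<Sum>l<i. (1 + \<epsilon>) ^ l)"
  have "s = of_nat i + (\<Sum>l<i. (1 + \<epsilon>) ^ l - 1)" by (simp add: s_def sum_subtractf)
  moreover have "val_gt v (\<Sum>l<i. (1 + \<epsilon>) ^ l - 1) (v (of_nat i))"
    unfolding v_of_nat_less(2)[OF char_q i] by (intro val_gt_sum gt)
  ultimately have s: "s \<noteq> 0 \<and> v s = 0"
    using v_add_eq[OF v_of_nat_less(1)[OF char_q i]] v_of_nat_less(2)[OF char_q i] by simp
  have "\<tau> (\<xi> ^ i) - \<xi> ^ i = \<xi> ^ i * ((1 + \<epsilon>) ^ i - 1)"
    by (simp add: gal_power[OF \<tau>(1)] \<epsilon>(1) power_mult_distrib right_diff_distrib)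
  also have "(1 + \<epsilon>) ^ i - 1 = \<epsilon> * s" using power_diff_1_eq[of "1 + \<epsilon>" i] by (simp add: s_def)
  finally have *: "\<tau> (\<xi> ^ i) - \<xi> ^ i = \<xi> ^ i * (\<epsilon> * s)" .
  show "\<tau> (\<xi> ^ i) - \<xi> ^ i \<noteq> 0" "v (\<tau> (\<xi> ^ i) - \<xi> ^ i) = v (\<xi> ^ i * inverse \<xi>)"
    unfolding * using s \<epsilon> xi(3) by (auto simp: v_mult)
qed

lemma case_ii_ramification: "ramification_ideal K v = scale_ideal (inverse \<xi>) \<O>"
proof -
  obtain \<sigma> where \<sigma>: "\<sigma> \<in> gal K" "\<sigma> \<noteq> id" using ex_gal by blast
  show ?thesis
    using gal_xi_power[OF \<sigma>, of 1] q_ge_2 gal_xi_power_ge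
    by (intro ramification_ideal_eq[OF xi(2) M_subset_O[OF inverse_xi(1)] inverse_xi(2) _ \<sigma>(1)]) auto
qed

text \<open>The derivative of the orbit polynomial at \<open>u\<close> is the product of the
  \<open>q - 1\<close> differences from the conjugates, each with the value of
  \<open>u / \<xi>\<close>. Collecting the powers of \<open>inverse \<xi>\<close> gives
  \<open>s\<close>.\<close>

lemma case_ii_iso:
  "module_isomorphic (OL v) \<Omega>
    (ideal_quot (OL v) \<M> (\<J> (inverse \<xi> ^ (q - 1))))"
proof -
  obtain j where j: "j \<in> {1..q-1}" "generates_O (\<xi> ^ j)"
    using case_ii by (auto simp: kummer_case_ii_iff xi_def)
  then have j': "0 < j" "j < q" using q_ge_2 by auto
  show ?thesis
  proof (rule kaehler_iso)
    show "outside (\<xi> ^ j)" using j' by (intro outside_power xi not_dvd_less)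
    show "generates_O (\<xi> ^ j)" by fact
    show "inverse \<xi> ^ (q - 1) \<in> \<O>" by (intro O.power_in M_subset_O inverse_xi)
    show "inverse \<xi> ^ (q - 1) \<noteq> 0" using inverse_xi by simp
    fix c assume c: "c \<in> K" "c \<noteq> 0" "0 < v (c * \<xi> ^ j)"
    define u where "u = c * \<xi> ^ j"
    obtain \<sigma> where \<sigma>: "\<sigma> \<in> gal K" "\<sigma> \<noteq> id" using ex_gal by blast
    \<comment> \<open>The orbit polynomial replaces an explicit equation for powers of \<xi>. Its
      coefficients lie in \<open>K\<close> by invariance and in \<O> because conjugates of integral
      elements are integral.\<close>
    define h where "h = (\<Prod>i<q. [:- (\<sigma> ^^ i) u, 1:])"
    have u: "u \<in> \<O>" "u \<noteq> 0" using c xi(3) by (auto simp: u_def O_iff less_imp_le)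
    have "h \<in> polys_over K" unfolding h_def by (intro orbit_poly_over[OF \<sigma>] q_pos) (simp add: gal_order[OF \<sigma>])
    moreover have "h \<in> polys_over \<O>"
      unfolding h_def using gal_O[OF gal_funpow[OF \<sigma>(1)]] u
      by (intro O.prod_polys_over) (simp add: O.pCons_polys_over O.zero_polys_over O.one_in O.minus_in)
    ultimately have h: "h \<in> polys_over \<A>" by (simp add: polys_over_def A_iff)
    have deg: "degree h = q" "lead_coeff h = 1" unfolding h_def by (rule degree_orbit_poly)+
    have "poly h u = 0" using q_pos by (auto simp: h_def poly_prod intro!: prod_zero bexI[of _ 0])
    have diff: "u - (\<sigma> ^^ i) u \<noteq> 0 \<and> v (u - (\<sigma> ^^ i) u) = v (inverse \<xi> * u)" if i: "i \<in> {1..q-1}" for i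
    proof -
      have \<tau>: "\<sigma> ^^ i \<in> gal K" by (rule gal_funpow[OF \<sigma>(1)])
      have i': "0 < i" "i < q" using i q_ge_2 by auto
      \<comment> \<open>The order of \<sigma> is the prime \<open>q\<close>, so a proper power of
        \<sigma> is trivial only if \<sigma> is.\<close>
      have "\<sigma> ^^ i \<noteq> id"
      proof
        assume id: "\<sigma> ^^ i = id"
        obtain a b where ab: "i * a = q * b + 1" using bezout_q[OF not_dvd_less[OF i']] .
        have "\<sigma> ^^ (i * a) = id" using id by (simp flip: funpow_mult)
        moreover have "\<sigma> ^^ (q * b) = id" using gal_order[OF \<sigma>] by (simp flip: funpow_mult)
        ultimately have "\<sigma> = id" unfolding ab by (simp add: funpow_add)
        then show False using \<sigma>(2) by simp
      qed
      note g = gal_xi_power[OF \<tau> this j']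
      have "u - (\<sigma> ^^ i) u = - (c * ((\<sigma> ^^ i) (\<xi> ^ j) - \<xi> ^ j))"
        by (simp add: u_def gal_mult[OF \<tau>] gal_fix[OF \<tau> c(1)] algebra_simps)
      then show ?thesis using g c(2) xi(3) by (simp add: u_def v_mult add.commute add.left_commute)
    qed
    have "poly (pderiv h) u = (\<Prod>i=1..q-1. u - (\<sigma> ^^ i) u)"
      using pderiv_prod_root[of "\<lambda>i. (\<sigma> ^^ i) u" "q - 1"] q_pos by (simp add: h_def)
    moreover have "(\<Prod>i=1..q-1. u - (\<sigma> ^^ i) u) \<noteq> 0" using diff by (subst prod_zero_iff) auto
    moreover have "v (\<Prod>i=1..q-1. u - (\<sigma> ^^ i) u) = v (inverse \<xi> ^ (q - 1) * u ^ (q - 1))"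
    proof -
      have "v (\<Prod>i=1..q-1. u - (\<sigma> ^^ i) u) = (\<Sum>i=1..q-1. v (u - (\<sigma> ^^ i) u))"
        using diff by (intro v_prod) auto
      also have "\<dots> = (\<Sum>i=1..q-1. v (inverse \<xi> * u))" using diff by (intro sum.cong) auto
      also have "\<dots> = v ((inverse \<xi> * u) ^ (q - 1))"
        using v_prod[of "{1..q-1}" "\<lambda>_. inverse \<xi> * u"] u(2) inverse_xi(2) by simp
      finally show ?thesis by (simp only: power_mult_distrib)
    qed
    ultimately show "\<exists>h\<in>polys_over \<A>. lead_coeff h = 1 \<and> degree h = q \<and> poly h (c * \<xi> ^ j) = 0 \<and>
        poly (pderiv h) (c * \<xi> ^ j) \<noteq> 0 \<and>
        v (poly (pderiv h) (c * \<xi> ^ j)) = v (inverse \<xi> ^ (q - 1) * (c * \<xi> ^ j) ^ (q - 1))"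
      using h deg \<open>poly h u = 0\<close> unfolding u_def[symmetric] by (intro bexI[of _ h]) auto
  qed
qed

end

end

theorem theorem4p8:
  fixes K :: "'l::field set" and v :: "'l \<Rightarrow> 'g::linordered_ab_group_add"
    and q :: nat and \<zeta> :: 'l
  assumes "valuation v"
    and "kummer_extension K q"
    and "value_index K v = q"
    and "\<zeta> \<in> K" and "primitive_root_of_unity q \<zeta>"
  shows
    "((\<exists>\<eta>. kummer_case_i K v q \<eta>) \<or> (\<exists>\<eta>. kummer_case_ii K v q \<zeta> \<eta>)) \<and>
     (q \<noteq> ring_char (residue_field K v) \<longrightarrow> (\<exists>\<eta>. kummer_case_i K v q \<eta>)) \<and>
     ((\<exists>\<eta>. kummer_case_i K v q \<eta>) \<longrightarrow>
        module_isomorphic (OL v) (kaehler (OL v) (val_ring K v))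
          (ideal_quot (OL v) (ME K v) (scale_ideal (of_nat q) (OL_power v (ME K v) q))) \<and>
        (q \<noteq> ring_char (residue_field K v) \<longrightarrow>
           ideal_quot (OL v) (ME K v) (scale_ideal (of_nat q) (OL_power v (ME K v) q)) =
           ideal_quot (OL v) (ME K v) (OL_power v (ME K v) q)) \<and>
        (q = ring_char (residue_field K v) \<longrightarrow>
           module_isomorphic (OL v)
             (ideal_quot (OL v) (ME K v) (scale_ideal (of_nat q) (OL_power v (ME K v) q)))
             (ideal_quot (OL v) (scale_ideal (\<zeta> - 1) (ME K v))
               (OL_power v (scale_ideal (\<zeta> - 1) (ME K v)) q)) \<and>
           ideal_quot (OL v) (scale_ideal (\<zeta> - 1) (ME K v))
             (OL_power v (scale_ideal (\<zeta> - 1) (ME K v)) q) =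
           ideal_quot (OL v) (OL_prod v (ramification_ideal K v) (ME K v))
             (OL_power v (OL_prod v (ramification_ideal K v) (ME K v)) q)) \<and>
        (carrier (kaehler (OL v) (val_ring K v)) =
             {\<zero>\<^bsub>kaehler (OL v) (val_ring K v)\<^esub>} \<longleftrightarrow>
           of_nat q \<notin> ME K v \<and> \<not> principalideal (ME K v) (set_ring (OE K v)))) \<and>
     (q \<noteq> ring_char (residue_field K v) \<longrightarrow> of_nat q \<notin> ME K v) \<and>
     (\<forall>\<eta> \<xi>. kummer_case_ii K v q \<zeta> \<eta> \<and> \<xi> = (\<eta> - 1) / (\<zeta> - 1) \<longrightarrow>
        module_isomorphic (OL v) (kaehler (OL v) (val_ring K v))
          (ideal_quot (OL v) (scale_ideal (inverse \<xi>) (ME K v))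
            (OL_power v (scale_ideal (inverse \<xi>) (ME K v)) q)) \<and>
        ideal_quot (OL v) (scale_ideal (inverse \<xi>) (ME K v))
          (OL_power v (scale_ideal (inverse \<xi>) (ME K v)) q) =
        ideal_quot (OL v) (OL_prod v (ramification_ideal K v) (ME K v))
          (OL_power v (OL_prod v (ramification_ideal K v) (ME K v)) q) \<and>
        carrier (kaehler (OL v) (val_ring K v)) \<noteq> {\<zero>\<^bsub>kaehler (OL v) (val_ring K v)\<^esub>})"
proof -
  interpret kummer_valued v K q \<zeta>
    using assms
    by (intro kummer_valued.intro totally_ramified.intro valued_field.intro
        totally_ramified_axioms.intro kummer_valued_axioms.intro)
      (auto simp: kummer_extension_def galois_extension_def)
  have qO: "of_nat q \<in> \<O>" by (rule O.of_nat_in)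
  have v_q0: "v (of_nat q) = 0" if "q \<noteq> ring_char (residue_field K v)"
    using that qO of_nat_q_nz unfolding residue_char_iff by (auto simp: O_iff)
  \<comment> \<open>Here \<open>q\<close> is a unit of \<O>, so the two denominators coincide as
    sets and the quotients are equal, not only isomorphic.\<close>
  have scale_q: "\<J> (of_nat q) = OL_power v \<M> q"
    if "q \<noteq> ring_char (residue_field K v)"
    using scale_eq[OF O_ideal_power[OF O_ideal_M] of_nat_q_nz one_neq_zero, of q] v_q0[OF that] by simp
  have q_M: "of_nat q \<notin> \<M>" if "q \<noteq> ring_char (residue_field K v)"
    using v_q0[OF that] of_nat_q_nz H_0 by (auto simp: M_iff)
  have i: "module_isomorphic (OL v) \<Omega> (ideal_quot (OL v) \<M> (\<J> (of_nat q)))"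
    "carrier \<Omega> = {\<zero>\<^bsub>\<Omega>\<^esub>} \<longleftrightarrow> of_nat q \<notin> \<M> \<and> \<not> principal_M"
    "OL_prod v (ramification_ideal K v) \<M> = scale_ideal (\<zeta> - 1) \<M>"
    if case_i: "\<exists>\<eta>. kummer_case_i K v q \<eta>"
  proof -
    obtain \<eta> where \<eta>: "kummer_case_i K v q \<eta>" using case_i by blast
    show iso: "module_isomorphic (OL v) \<Omega> (ideal_quot (OL v) \<M> (\<J> (of_nat q)))"
      by (rule case_i_iso[OF \<eta>])
    show "carrier \<Omega> = {\<zero>\<^bsub>\<Omega>\<^esub>} \<longleftrightarrow> of_nat q \<notin> \<M> \<and> \<not> principal_M"
      using Omega_trivial_iff[OF iso qO] scale_M_power_eq_iff[OF qO of_nat_q_nz] by simp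
    show "OL_prod v (ramification_ideal K v) \<M> = scale_ideal (\<zeta> - 1) \<M>"
      unfolding case_i_ramification[OF \<eta>] by (rule scale_O_prod[OF zeta_1_O O_ideal_M])
  qed
  have ii: "module_isomorphic (OL v) \<Omega>
      (ideal_quot (OL v) (scale_ideal (inverse \<xi>) \<M>) (OL_power v (scale_ideal (inverse \<xi>) \<M>) q))"
    "OL_prod v (ramification_ideal K v) \<M> = scale_ideal (inverse \<xi>) \<M>"
    "carrier \<Omega> \<noteq> {\<zero>\<^bsub>\<Omega>\<^esub>}"
    if "kummer_case_ii K v q \<zeta> \<eta> \<and> \<xi> = (\<eta> - 1) / (\<zeta> - 1)" for \<eta> \<xi>
  proof -
    have *: "kummer_case_ii K v q \<zeta> \<eta>" "\<xi> = (\<eta> - 1) / (\<zeta> - 1)" using that by auto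
    note inv = inverse_xi[OF *]
    have w: "inverse \<xi> \<in> \<O>" by (rule M_subset_O[OF inv(1)])
    have s: "inverse \<xi> ^ (q - 1) \<in> \<O>" "inverse \<xi> ^ (q - 1) \<noteq> 0" using w inv(2) by (auto intro: O.power_in)
    \<comment> \<open>The exponent \<open>q - 1\<close> is positive, so \<open>s\<close> itself lies
      in \<M>; this makes the quotient nonzero without regard to principality.\<close>
    have sM: "inverse \<xi> ^ (q - 1) \<in> \<M>" using M_power_mult[OF O.one_in inv(1), of "q - 1"] q_ge_2 by simp
    show "module_isomorphic (OL v) \<Omega>
      (ideal_quot (OL v) (scale_ideal (inverse \<xi>) \<M>) (OL_power v (scale_ideal (inverse \<xi>) \<M>) q))"
      by (rule module_isomorphic_trans[OF case_ii_iso[OF *] M_quot_scale_iso[OF s w inv(2) refl]])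
    show "OL_prod v (ramification_ideal K v) \<M> = scale_ideal (inverse \<xi>) \<M>"
      unfolding case_ii_ramification[OF *] by (rule scale_O_prod[OF w O_ideal_M])
    show "carrier \<Omega> \<noteq> {\<zero>\<^bsub>\<Omega>\<^esub>}"
      using Omega_trivial_iff[OF case_ii_iso[OF *] s(1)] scale_M_power_neq[OF sM s(2)] by simp
  qed
  show ?thesis
  proof (intro conjI allI impI, goal_cases)
    case 1
    then show ?case using ex_case by blast
  next
    case 2
    then show ?case using ex_case unfolding residue_char_iff by blast
  next
    case 3
    then show ?case by (rule i(1))
  next
    case 4
    show ?case unfolding scale_q[OF 4(2)] ..
  next
    case 5
    show ?case by (rule M_quot_scale_iso[OF qO of_nat_q_nz zeta_1_O zeta_1_nz v_q])
  next
    case 6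
    show ?case unfolding i(3)[OF 6(1)] ..
  next
    case 7
    then show ?case by (rule i(2))
  next
    case 8
    then show ?case by (rule q_M)
  next
    case (9 \<eta> \<xi>)
    then show ?case by (rule ii(1))
  next
    case (10 \<eta> \<xi>)
    show ?case unfolding ii(2)[OF 10] ..
  next
    case (11 \<eta> \<xi>)
    then show ?case by (rule ii(3))
  qed
qed

end
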